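(* Let $V$ be a finite dimensional complex vector space with a norm $N_V=\|\cdot\|_V$. Then the graded norms $\mathrm{Sym}_{\pi}(N_V)$, $\mathrm{Sym}_{\epsilon}(N_V)$ and $\mathrm{Sym}_{\mathrm{ev}}(N_V)$ on the symmetric algebra $\mathrm{Sym}(V)$ are equivalent.
   Context: For finite dimensional normed complex vector spaces $(V_i,\|\cdot\|_i)$, $i=1,2$, the projective tensor norm on $V_1\otimes V_2$ is $\|f\|_{\otimes_\pi}=\inf\{\sum\|x_i\|_1\|y_i\|_2: f=\sum x_i\otimes y_i\}$ and the injective tensor norm is $\|f\|_{\otimes_\epsilon}=\sup\{|(\phi\otimes\psi)(f)|:\phi\in V_1^*,\psi\in V_2^*,\|\phi\|_1^*=\|\psi\|_2^*=1\}$, with $\|\cdot\|_i^*$ the dual norms. By iteration they define the norms $N_V\otimes_\pi\cdots\otimes_\pi N_V$ and $N_V\otimes_\epsilon\cdots\otimes_\epsilon N_V$ on $V^{\otimes k}$. Let $\mathrm{Pol}:\mathrm{Sym}^k(V)\to V^{\otimes k}$ be the polarisation map, $v_1\cdots v_k\mapsto\frac1{k!}\sum_{\sigma\in S_k}v_{\sigma(1)}\otimes\cdots\otimes v_{\sigma(k)}$. The norms $\mathrm{Sym}^k_\pi(N_V)$ and $\mathrm{Sym}^k_\epsilon(N_V)$ on $\mathrm{Sym}^k(V)$ are the restrictions along $\mathrm{Pol}$ of the $k$-fold projective, respectively injective, tensor norms. The norm $\mathrm{Sym}^k_{\mathrm{ev}}(N_V)$ is $P\mapsto\sup\{|P(v)|: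 v\in V^*,\|v\|_V^*\le1\}$, viewing $P\in\mathrm{Sym}^k(V)$ as a homogeneous polynomial on $V^*$. The graded norms $\mathrm{Sym}_\pi(N_V)$, $\mathrm{Sym}_\epsilon(N_V)$, $\mathrm{Sym}_{\mathrm{ev}}(N_V)$ on $\mathrm{Sym}(V)=\oplus_k\mathrm{Sym}^k(V)$ have these as graded pieces. Two graded norms $N=\sum N_k$, $N'=\sum N'_k$ on $\mathrm{Sym}(V)$ are equivalent if for every $\epsilon>0$ there is $k_0$ with $e^{-\epsilon k}N_k\le N'_k\le e^{\epsilon k}N_k$ for all $k\ge k_0$. *)

theory Defs
  imports Complex_Main "HOL-Library.Poly_Mapping" "HOL-Combinatorics.Permutations"
begin

section \<open>Complex vector spaces\<close>

class complex_vec = ab_group_add +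
  fixes scaleC :: "complex \<Rightarrow> 'a \<Rightarrow> 'a"  (infixr \<open>*\<^sub>C\<close> 75)
  assumes scaleC_add_right: "c *\<^sub>C (x + y) = c *\<^sub>C x + c *\<^sub>C y"
    and scaleC_add_left: "(c + d) *\<^sub>C x = c *\<^sub>C x + d *\<^sub>C x"
    and scaleC_scaleC: "c *\<^sub>C (d *\<^sub>C x) = (c * d) *\<^sub>C x"
    and scaleC_one: "1 *\<^sub>C x = x"

interpretation cvec: vector_space "scaleC :: complex \<Rightarrow> 'a \<Rightarrow> 'a::complex_vec"
  by standard (simp_all add: scaleC_add_right scaleC_add_left scaleC_scaleC scaleC_one)

interpretation cvec: vector_space_pair
  "scaleC :: complex \<Rightarrow> 'a \<Rightarrow> 'a::complex_vec" "scaleC :: complex \<Rightarrow> 'b \<Rightarrow> 'b::complex_vec" ..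

abbreviation clinear :: "('a::complex_vec \<Rightarrow> 'b::complex_vec) \<Rightarrow> bool" where
  "clinear \<equiv> Vector_Spaces.linear scaleC scaleC"

lemma clinearI:
  assumes "\<And>x y. f (x + y) = f x + f y" "\<And>c x. f (c *\<^sub>C x) = c *\<^sub>C f x"
  shows "clinear f"
  using assms by unfold_locales

lemma cvec_span_trans:
  "x - y \<in> cvec.span R \<Longrightarrow> y - z \<in> cvec.span R \<Longrightarrow> x - z \<in> cvec.span R"
  using cvec.span_add[of "x - y" R "y - z"] by simp

lemma cvec_span_sym: "x - y \<in> cvec.span R \<Longrightarrow> y - x \<in> cvec.span R"
  using cvec.span_neg[of "x - y" R] by simp

lemma cvec_span_add:
  "x - x' \<in> cvec.span R \<Longrightarrow> y - y' \<in> cvec.span R \<Longrightarrow> (x + y) - (x' + y') \<in> cvec.span R"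
  using cvec.span_add[of "x - x'" R "y - y'"] by (simp add: algebra_simps)

lemma cvec_span_diff:
  "x - x' \<in> cvec.span R \<Longrightarrow> y - y' \<in> cvec.span R \<Longrightarrow> (x - y) - (x' - y') \<in> cvec.span R"
  using cvec.span_diff[of "x - x'" R "y - y'"] by (simp add: algebra_simps)

lemma cvec_span_uminus: "x - x' \<in> cvec.span R \<Longrightarrow> (- x) - (- x') \<in> cvec.span R"
  using cvec.span_neg[of "x - x'" R] by simp

lemma cvec_span_scale: "x - x' \<in> cvec.span R \<Longrightarrow> c *\<^sub>C x - c *\<^sub>C x' \<in> cvec.span R"
  using cvec.span_scale[of "x - x'" R c] by (simp add: cvec.scale_right_diff_distrib)

instantiation complex :: complex_vec
begin
definition scaleC_complex :: "complex \<Rightarrow> complex \<Rightarrow> complex" where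
  "scaleC_complex c z = c * z"
instance by standard (simp_all add: scaleC_complex_def algebra_simps)
end

lemma scaleC_complex [simp]: "c *\<^sub>C z = c * z" for z :: complex
  by (rule scaleC_complex_def)

instantiation poly_mapping :: (type, complex_vec) complex_vec
begin
lift_definition scaleC_poly_mapping :: "complex \<Rightarrow> ('a \<Rightarrow>\<^sub>0 'b) \<Rightarrow> ('a \<Rightarrow>\<^sub>0 'b)"
  is "\<lambda>c f x. c *\<^sub>C f x"
  by (erule rev_finite_subset) auto
instance
  by standard (transfer; simp add: fun_eq_iff scaleC_add_right scaleC_add_left scaleC_scaleC scaleC_one)+
end

lemma lookup_scaleC [simp]: "Poly_Mapping.lookup (c *\<^sub>C f) x = c *\<^sub>C Poly_Mapping.lookup f x"
  by transfer simp


section \<open>The tensor algebra\<close>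

text \<open>
  The type \<open>'v list \<Rightarrow>\<^sub>0 complex\<close> is the free vector space on the formal
  words \<open>x\<^sub>1 \<otimes> \<dots> \<otimes> x\<^sub>k\<close> of all lengths \<open>k\<close>. The tensor algebra
  \<open>T(V) = \<Oplus>\<^sub>k V\<^sup>\<otimes>\<^sup>k\<close> is its quotient by the multilinearity relations.
\<close>

abbreviation word :: "'v list \<Rightarrow> ('v list \<Rightarrow>\<^sub>0 complex)" where
  "word xs \<equiv> Poly_Mapping.single xs 1"

definition tensor_relations :: "('v::complex_vec list \<Rightarrow>\<^sub>0 complex) set" where
  "tensor_relations =
     {word (xs @ (x + y) # ys) - (word (xs @ x # ys) + word (xs @ y # ys)) | xs x y ys. True} \<union>
     {word (xs @ (c *\<^sub>C x) # ys) - c *\<^sub>C word (xs @ x # ys) | xs c x ys. True}"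

quotient_type (overloaded) 'v tensor = "'v::complex_vec list \<Rightarrow>\<^sub>0 complex" /
  "\<lambda>f g. f - g \<in> cvec.span tensor_relations"
proof (rule equivpI)
  show "reflp (\<lambda>f g :: 'v list \<Rightarrow>\<^sub>0 complex. f - g \<in> cvec.span tensor_relations)"
    by (simp add: reflp_def cvec.span_zero)
  show "symp (\<lambda>f g :: 'v list \<Rightarrow>\<^sub>0 complex. f - g \<in> cvec.span tensor_relations)"
    by (rule sympI) (rule cvec_span_sym)
  show "transp (\<lambda>f g :: 'v list \<Rightarrow>\<^sub>0 complex. f - g \<in> cvec.span tensor_relations)"
    by (rule transpI) (rule cvec_span_trans)
qed

instantiation tensor :: (complex_vec) complex_vec
begin
lift_definition zero_tensor :: "'a tensor" is 0 .
lift_definition plus_tensor :: "'a tensor \<Rightarrow> 'a tensor \<Rightarrow> 'a tensor" is "(+)"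
  by (rule cvec_span_add)
lift_definition minus_tensor :: "'a tensor \<Rightarrow> 'a tensor \<Rightarrow> 'a tensor" is "(-)"
  by (rule cvec_span_diff)
lift_definition uminus_tensor :: "'a tensor \<Rightarrow> 'a tensor" is "uminus"
  by (rule cvec_span_uminus)
lift_definition scaleC_tensor :: "complex \<Rightarrow> 'a tensor \<Rightarrow> 'a tensor" is "scaleC"
  by (rule cvec_span_scale)
instance
  by standard
    (transfer; simp add: cvec.span_zero algebra_simps cvec.scale_right_distrib cvec.scale_left_distrib)+
end

lift_definition tprod :: "'v::complex_vec list \<Rightarrow> 'v tensor" is word .

text \<open>The summand \<open>V\<^sup>\<otimes>\<^sup>k\<close> of the tensor algebra.\<close>

definition tensor_power :: "nat \<Rightarrow> 'v::complex_vec tensor set" where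
  "tensor_power k = cvec.span {tprod xs | xs. length xs = k}"

text \<open>
  A map on words of all lengths that is multilinear on the words of each fixed length factors
  uniquely through a linear map on the tensor algebra.
\<close>

definition multilinear :: "('v::complex_vec list \<Rightarrow> 'w::complex_vec) \<Rightarrow> bool" where
  "multilinear m \<longleftrightarrow>
     (\<forall>xs x y ys. m (xs @ (x + y) # ys) = m (xs @ x # ys) + m (xs @ y # ys)) \<and>
     (\<forall>xs c x ys. m (xs @ (c *\<^sub>C x) # ys) = c *\<^sub>C m (xs @ x # ys))"

definition tensor_lift :: "('v::complex_vec list \<Rightarrow> 'w::complex_vec) \<Rightarrow> 'v tensor \<Rightarrow> 'w" where
  "tensor_lift m = (THE g. clinear g \<and> (\<forall>xs. g (tprod xs) = m xs))"

definition free_lift :: "('b \<Rightarrow> 'w::complex_vec) \<Rightarrow> ('b \<Rightarrow>\<^sub>0 complex) \<Rightarrow> 'w" where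
  "free_lift m f = (\<Sum>x\<in>Poly_Mapping.keys f. Poly_Mapping.lookup f x *\<^sub>C m x)"

lemma free_lift_superset:
  assumes "finite S" "Poly_Mapping.keys f \<subseteq> S"
  shows "free_lift m f = (\<Sum>x\<in>S. Poly_Mapping.lookup f x *\<^sub>C m x)"
  unfolding free_lift_def
  by (rule sum.mono_neutral_left) (use assms in \<open>auto simp: in_keys_iff\<close>)

lemma clinear_free_lift: "clinear (free_lift m)"
proof (rule clinearI)
  fix f g :: "'a \<Rightarrow>\<^sub>0 complex" and c
  let ?S = "Poly_Mapping.keys f \<union> Poly_Mapping.keys g"
  have "free_lift m (f + g) = (\<Sum>x\<in>?S. Poly_Mapping.lookup (f + g) x *\<^sub>C m x)"
    by (rule free_lift_superset) (simp_all add: keys_add)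
  also have "\<dots> = free_lift m f + free_lift m g"
    by (simp add: lookup_add cvec.scale_left_distrib sum.distrib
        free_lift_superset[of ?S f] free_lift_superset[of ?S g])
  finally show "free_lift m (f + g) = free_lift m f + free_lift m g" .
  have "free_lift m (c *\<^sub>C f) = (\<Sum>x\<in>Poly_Mapping.keys f. Poly_Mapping.lookup (c *\<^sub>C f) x *\<^sub>C m x)"
    by (rule free_lift_superset) (auto simp: in_keys_iff)
  then show "free_lift m (c *\<^sub>C f) = c *\<^sub>C free_lift m f"
    by (simp add: free_lift_def cvec.scale_sum_right)
qed

lemma free_lift_word [simp]: "free_lift m (Poly_Mapping.single x 1) = m x"
  by (simp add: free_lift_def)

lemma span_words: "f \<in> cvec.span (range (\<lambda>x. Poly_Mapping.single x (1::complex)))"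
proof -
  have "f = (\<Sum>x\<in>Poly_Mapping.keys f. Poly_Mapping.lookup f x *\<^sub>C Poly_Mapping.single x 1)"
    by (rule poly_mapping_eqI)
      (auto simp: lookup_sum lookup_single when_def in_keys_iff if_distrib cong: if_cong)
  also have "\<dots> \<in> cvec.span (range (\<lambda>x. Poly_Mapping.single x 1))"
    by (intro cvec.span_sum cvec.span_scale cvec.span_base) auto
  finally show ?thesis .
qed

lemma clinear_abs_tensor: "clinear abs_tensor"
  by (rule clinearI) (simp_all add: plus_tensor.abs_eq scaleC_tensor.abs_eq)

lemma span_tprod: "cvec.span (range tprod) = (UNIV :: 'v::complex_vec tensor set)"
proof -
  have "t \<in> cvec.span (range tprod)" for t :: "'v tensor"
  proof -
    obtain f where f: "t = abs_tensor f"
      by (metis Quotient3_abs_rep[OF Quotient3_tensor])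
    have "abs_tensor f \<in> abs_tensor ` cvec.span (range word)"
      using span_words[of f] by blast
    also have "\<dots> = cvec.span (range tprod)"
      by (simp add: cvec.linear_span_image[OF clinear_abs_tensor, symmetric] image_image
          tprod.abs_eq)
    finally show ?thesis using f by simp
  qed
  then show ?thesis by blast
qed

lemma tensor_lift_unique_ex:
  assumes m: "multilinear m"
  shows "\<exists>!g. clinear g \<and> (\<forall>xs. g (tprod xs) = m xs)"
proof (rule ex_ex1I)
  interpret L: Vector_Spaces.linear scaleC scaleC "free_lift m" by (rule clinear_free_lift)
  have "free_lift m r = 0" if "r \<in> tensor_relations" for r
    using that m by (auto simp: tensor_relations_def L.diff L.add L.scale multilinear_def)
  then have "free_lift m r = 0" if "r \<in> cvec.span tensor_relations" for r
    using that L.eq_0_on_span by blast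
  then have eq: "free_lift m f = free_lift m f'" if "f - f' \<in> cvec.span tensor_relations" for f f'
    using that by (metis L.diff eq_iff_diff_eq_0)
  define g where "g t = free_lift m (rep_tensor t)" for t
  have g: "g (abs_tensor f) = free_lift m f" for f
    unfolding g_def
    by (rule eq, rule Quotient3_rep_abs[OF Quotient3_tensor]) (simp add: cvec.span_zero)
  have "clinear g"
  proof (rule clinearI)
    fix s t :: "'a tensor" and c
    obtain e f where "s = abs_tensor e" "t = abs_tensor f"
      by (metis Quotient3_abs_rep[OF Quotient3_tensor])
    then show "g (s + t) = g s + g t" "g (c *\<^sub>C s) = c *\<^sub>C g s"
      by (simp_all add: g plus_tensor.abs_eq scaleC_tensor.abs_eq L.add L.scale)
  qed
  moreover have "g (tprod xs) = m xs" for xs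
    by (simp add: tprod.abs_eq g)
  ultimately show "\<exists>g. clinear g \<and> (\<forall>xs. g (tprod xs) = m xs)" by blast
next
  fix g h :: "'a tensor \<Rightarrow> 'b"
  assume *: "clinear g \<and> (\<forall>xs. g (tprod xs) = m xs)" "clinear h \<and> (\<forall>xs. h (tprod xs) = m xs)"
  have "g t = h t" for t
    by (rule cvec.linear_eq_on[of g h t "range tprod"]) (use * in \<open>auto simp: span_tprod\<close>)
  then show "g = h" by blast
qed

lemma tensor_lift:
  assumes "multilinear m"
  shows clinear_tensor_lift: "clinear (tensor_lift m)"
    and tensor_lift_tprod: "tensor_lift m (tprod xs) = m xs"
  using theI'[OF tensor_lift_unique_ex[OF assms]] unfolding tensor_lift_def by blast+

lemma multilinear_tprod: "multilinear tprod"
  unfolding multilinear_def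
  by (intro conjI allI; transfer; rule cvec.span_base; unfold tensor_relations_def; blast)


section \<open>The symmetric algebra\<close>

text \<open>
  \<open>Sym(V)\<close> is the quotient of the tensor algebra by the two-sided ideal generated by the
  elements \<open>x \<otimes> y - y \<otimes> x\<close>; as a vector space, this ideal is spanned by the elements below.
\<close>

definition sym_relations :: "'v::complex_vec tensor set" where
  "sym_relations = {tprod (xs @ x # y # ys) - tprod (xs @ y # x # ys) | xs x y ys. True}"

quotient_type (overloaded) 'v sym_alg = "'v::complex_vec tensor" /
  "\<lambda>f g. f - g \<in> cvec.span sym_relations"
proof (rule equivpI)
  show "reflp (\<lambda>f g :: 'v tensor. f - g \<in> cvec.span sym_relations)"
    by (simp add: reflp_def cvec.span_zero)
  show "symp (\<lambda>f g :: 'v tensor. f - g \<in> cvec.span sym_relations)"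
    by (rule sympI) (rule cvec_span_sym)
  show "transp (\<lambda>f g :: 'v tensor. f - g \<in> cvec.span sym_relations)"
    by (rule transpI) (rule cvec_span_trans)
qed

instantiation sym_alg :: (complex_vec) complex_vec
begin
lift_definition zero_sym_alg :: "'a sym_alg" is 0 .
lift_definition plus_sym_alg :: "'a sym_alg \<Rightarrow> 'a sym_alg \<Rightarrow> 'a sym_alg" is "(+)"
  by (rule cvec_span_add)
lift_definition minus_sym_alg :: "'a sym_alg \<Rightarrow> 'a sym_alg \<Rightarrow> 'a sym_alg" is "(-)"
  by (rule cvec_span_diff)
lift_definition uminus_sym_alg :: "'a sym_alg \<Rightarrow> 'a sym_alg" is "uminus"
  by (rule cvec_span_uminus)
lift_definition scaleC_sym_alg :: "complex \<Rightarrow> 'a sym_alg \<Rightarrow> 'a sym_alg" is "scaleC"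
  by (rule cvec_span_scale)
instance
  by standard
    (transfer; simp add: cvec.span_zero algebra_simps cvec.scale_right_distrib cvec.scale_left_distrib)+
end

text \<open>The product \<open>x\<^sub>1 \<cdots> x\<^sub>k\<close> in the symmetric algebra.\<close>

lift_definition sprod :: "'v::complex_vec list \<Rightarrow> 'v sym_alg" is tprod .

definition sym_power :: "nat \<Rightarrow> 'v::complex_vec sym_alg set" where
  "sym_power k = cvec.span {sprod xs | xs. length xs = k}"

definition symmetric_map :: "('v list \<Rightarrow> 'w) \<Rightarrow> bool" where
  "symmetric_map m \<longleftrightarrow> (\<forall>xs x y ys. m (xs @ x # y # ys) = m (xs @ y # x # ys))"

definition sym_lift :: "('v::complex_vec list \<Rightarrow> 'w::complex_vec) \<Rightarrow> 'v sym_alg \<Rightarrow> 'w" where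
  "sym_lift m = (THE g. clinear g \<and> (\<forall>xs. g (sprod xs) = m xs))"

lemma clinear_abs_sym_alg: "clinear abs_sym_alg"
  by (rule clinearI) (simp_all add: plus_sym_alg.abs_eq scaleC_sym_alg.abs_eq)

lemma span_sprod: "cvec.span (range sprod) = (UNIV :: 'v::complex_vec sym_alg set)"
proof -
  have "t \<in> cvec.span (range sprod)" for t :: "'v sym_alg"
  proof -
    obtain f where f: "t = abs_sym_alg f"
      by (metis Quotient3_abs_rep[OF Quotient3_sym_alg])
    have "abs_sym_alg f \<in> abs_sym_alg ` cvec.span (range tprod)"
      by (simp add: span_tprod)
    also have "\<dots> = cvec.span (range sprod)"
      by (simp add: cvec.linear_span_image[OF clinear_abs_sym_alg, symmetric] image_image
          sprod.abs_eq)
    finally show ?thesis using f by simp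
  qed
  then show ?thesis by blast
qed

lemma sym_lift_unique_ex:
  assumes m: "multilinear m" and s: "symmetric_map m"
  shows "\<exists>!g. clinear g \<and> (\<forall>xs. g (sprod xs) = m xs)"
proof (rule ex_ex1I)
  interpret L: Vector_Spaces.linear scaleC scaleC "tensor_lift m" by (rule tensor_lift[OF m])
  have "tensor_lift m r = 0" if "r \<in> sym_relations" for r
    using that s by (auto simp: sym_relations_def L.diff tensor_lift_tprod[OF m] symmetric_map_def)
  then have "tensor_lift m r = 0" if "r \<in> cvec.span sym_relations" for r
    using that L.eq_0_on_span by blast
  then have eq: "tensor_lift m f = tensor_lift m f'" if "f - f' \<in> cvec.span sym_relations" for f f'
    using that by (metis L.diff eq_iff_diff_eq_0)
  define g where "g t = tensor_lift m (rep_sym_alg t)" for t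
  have g: "g (abs_sym_alg f) = tensor_lift m f" for f
    unfolding g_def
    by (rule eq, rule Quotient3_rep_abs[OF Quotient3_sym_alg]) (simp add: cvec.span_zero)
  have "clinear g"
  proof (rule clinearI)
    fix s t :: "'a sym_alg" and c
    obtain e f where "s = abs_sym_alg e" "t = abs_sym_alg f"
      by (metis Quotient3_abs_rep[OF Quotient3_sym_alg])
    then show "g (s + t) = g s + g t" "g (c *\<^sub>C s) = c *\<^sub>C g s"
      by (simp_all add: g plus_sym_alg.abs_eq scaleC_sym_alg.abs_eq L.add L.scale)
  qed
  moreover have "g (sprod xs) = m xs" for xs
    by (simp add: sprod.abs_eq g tensor_lift_tprod[OF m])
  ultimately show "\<exists>g. clinear g \<and> (\<forall>xs. g (sprod xs) = m xs)" by blast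
next
  fix g h :: "'a sym_alg \<Rightarrow> 'b"
  assume *: "clinear g \<and> (\<forall>xs. g (sprod xs) = m xs)" "clinear h \<and> (\<forall>xs. h (sprod xs) = m xs)"
  have "g t = h t" for t
    by (rule cvec.linear_eq_on[of g h t "range sprod"]) (use * in \<open>auto simp: span_sprod\<close>)
  then show "g = h" by blast
qed

lemma sym_lift:
  assumes "multilinear m" "symmetric_map m"
  shows clinear_sym_lift: "clinear (sym_lift m)"
    and sym_lift_sprod: "sym_lift m (sprod xs) = m xs"
  using theI'[OF sym_lift_unique_ex[OF assms]] unfolding sym_lift_def by blast+


subsection \<open>Polarisation and evaluation\<close>

text \<open>The map \<open>Pol\<close>, \<open>v\<^sub>1 \<cdots> v\<^sub>k \<mapsto> 1/k! \<Sum>\<^sub>\<sigma> v\<^bsub>\<sigma>(1)\<^esub> \<otimes> \<dots> \<otimes> v\<^bsub>\<sigma>(k)\<^esub>\<close>.\<close>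

definition symmetrised :: "'v::complex_vec list \<Rightarrow> 'v tensor" where
  "symmetrised xs =
     (1 / fact (length xs)) *\<^sub>C (\<Sum>\<sigma> | \<sigma> permutes {..<length xs}. tprod (permute_list \<sigma> xs))"

definition pol :: "'v::complex_vec sym_alg \<Rightarrow> 'v tensor" where
  "pol = sym_lift symmetrised"

lemma multilinear_symmetrised: "multilinear (symmetrised :: 'v::complex_vec list \<Rightarrow> 'v tensor)"
proof -
  have "\<exists>as bs. \<forall>z. permute_list \<sigma> (xs @ z # ys) = as @ z # bs"
    if \<sigma>: "\<sigma> permutes {..<length xs + Suc (length ys)}" for \<sigma> and xs ys :: "'v list"
  proof -
    let ?n = "length xs + Suc (length ys)"
    define j where "j = inv \<sigma> (length xs)"
    have \<sigma>j: "\<sigma> j = length xs"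
      unfolding j_def using \<sigma> by (simp add: permutes_inverses)
    have j: "j < ?n"
      using permutes_in_image[OF \<sigma>, of j] \<sigma>j by simp
    define e where "e z i = (xs @ z # ys) ! \<sigma> i" for z :: 'v and i
    have other: "e z i = e z' i" if "i \<noteq> j" for z z' i
    proof -
      have "\<sigma> i \<noteq> length xs"
        using that \<sigma>j permutes_inj[OF \<sigma>] by (metis injD)
      then show ?thesis
        by (auto simp: e_def nth_append nth_Cons split: nat.splits)
    qed
    have split: "[0..<?n] = [0..<j] @ j # [Suc j..<?n]"
      using j upt_add_eq_append[of 0 j "?n - j"] by (simp add: upt_conv_Cons)
    have "permute_list \<sigma> (xs @ z # ys) = map (e 0) [0..<j] @ z # map (e 0) [Suc j..<?n]" for z
    proof -
      have "permute_list \<sigma> (xs @ z # ys) = map (e z) [0..<?n]"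
        by (simp add: permute_list_def e_def)
      also have "\<dots> = map (e z) [0..<j] @ e z j # map (e z) [Suc j..<?n]"
        unfolding split by simp
      also have "e z j = z" by (simp add: e_def \<sigma>j)
      also have "map (e z) [0..<j] = map (e 0) [0..<j]"
        by (rule map_cong) (auto intro: other)
      also have "map (e z) [Suc j..<?n] = map (e 0) [Suc j..<?n]"
        by (rule map_cong) (auto intro: other)
      finally show ?thesis .
    qed
    then show ?thesis by blast
  qed
  then have
    add: "tprod (permute_list \<sigma> (xs @ (x + y) # ys)) =
      tprod (permute_list \<sigma> (xs @ x # ys)) + tprod (permute_list \<sigma> (xs @ y # ys))" and
    scale: "tprod (permute_list \<sigma> (xs @ (c *\<^sub>C x) # ys)) = c *\<^sub>C tprod (permute_list \<sigma> (xs @ x # ys))"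
    if "\<sigma> permutes {..<length xs + Suc (length ys)}" for \<sigma> c x y and xs ys :: "'v list"
    using that multilinear_tprod unfolding multilinear_def by metis+
  show ?thesis
    unfolding multilinear_def symmetrised_def
    by (simp add: add scale sum.distrib cvec.scale_right_distrib cvec.scale_sum_right mult.commute)
qed

lemma symmetric_symmetrised: "symmetric_map (symmetrised :: 'v::complex_vec list \<Rightarrow> 'v tensor)"
  unfolding symmetric_map_def
proof (intro allI)
  fix xs ys :: "'v list" and x y
  let ?n = "length xs + Suc (Suc (length ys))" and ?k = "length xs"
  define \<tau> where "\<tau> = transpose ?k (Suc ?k)"
  have \<tau>: "\<tau> permutes {..<?n}"
    unfolding \<tau>_def by (rule permutes_swap_id) auto
  have swap: "xs @ y # x # ys = permute_list \<tau> (xs @ x # y # ys)"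
  proof (rule nth_equalityI)
    fix i assume "i < length (xs @ y # x # ys)"
    then have i: "i < ?n" by simp
    consider "i < ?k" | "i = ?k" | "i = Suc ?k" | m where "i = ?k + Suc (Suc m)"
      by (metis add_Suc_right less_imp_Suc_add linorder_neqE_nat not_less_eq)
    then show "(xs @ y # x # ys) ! i = permute_list \<tau> (xs @ x # y # ys) ! i"
      using i by cases (simp_all add: permute_list_def \<tau>_def transpose_def nth_append del: upt_Suc)
  qed simp
  have "(\<Sum>\<sigma> | \<sigma> permutes {..<?n}. tprod (permute_list \<sigma> (xs @ y # x # ys))) =
        (\<Sum>\<sigma> | \<sigma> permutes {..<?n}. tprod (permute_list (\<tau> \<circ> \<sigma>) (xs @ x # y # ys)))"
    unfolding swap by (rule sum.cong) (simp_all add: permute_list_compose)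
  also have "\<dots> = (\<Sum>\<sigma> | \<sigma> permutes {..<?n}. tprod (permute_list \<sigma> (xs @ x # y # ys)))"
    by (rule setum_permutations_compose_left[OF \<tau>, symmetric])
  finally show "symmetrised (xs @ x # y # ys) = symmetrised (xs @ y # x # ys)"
    by (simp add: symmetrised_def)
qed

lemma clinear_pol: "clinear pol"
  and pol_sprod: "pol (sprod xs) = symmetrised xs"
  unfolding pol_def
  by (rule clinear_sym_lift sym_lift_sprod, rule multilinear_symmetrised, rule symmetric_symmetrised)+

text \<open>
  An element of \<open>Sym\<^sup>k(V)\<close> seen as a homogeneous polynomial on the dual space of \<open>V\<close>:
  the product \<open>x\<^sub>1 \<cdots> x\<^sub>k\<close> takes the value \<open>\<phi>(x\<^sub>1) \<cdots> \<phi>(x\<^sub>k)\<close> at \<open>\<phi>\<close>.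
\<close>

definition sym_eval :: "'v::complex_vec sym_alg \<Rightarrow> ('v \<Rightarrow> complex) \<Rightarrow> complex" where
  "sym_eval P \<phi> = sym_lift (\<lambda>xs. \<Prod>x\<leftarrow>xs. \<phi> x) P"

lemma
  assumes "clinear \<phi>"
  shows clinear_sym_eval: "clinear (\<lambda>P. sym_eval P \<phi>)"
    and sym_eval_sprod: "sym_eval (sprod xs) \<phi> = (\<Prod>x\<leftarrow>xs. \<phi> x)"
proof -
  interpret L: Vector_Spaces.linear scaleC scaleC \<phi> by (rule assms)
  have "multilinear (\<lambda>xs. \<Prod>x\<leftarrow>xs. \<phi> x)"
    by (simp add: multilinear_def L.add L.scale algebra_simps)
  moreover have "symmetric_map (\<lambda>xs. \<Prod>x\<leftarrow>xs. \<phi> x)"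
    by (simp add: symmetric_map_def algebra_simps)
  ultimately show "clinear (\<lambda>P. sym_eval P \<phi>)" "sym_eval (sprod xs) \<phi> = (\<Prod>x\<leftarrow>xs. \<phi> x)"
    unfolding sym_eval_def by (rule clinear_sym_lift sym_lift_sprod; assumption)+
qed


section \<open>Norms\<close>

definition is_norm :: "('v::complex_vec \<Rightarrow> real) \<Rightarrow> bool" where
  "is_norm N \<longleftrightarrow> (\<forall>x. N x \<ge> 0) \<and> (\<forall>x. N x = 0 \<longleftrightarrow> x = 0) \<and>
     (\<forall>x y. N (x + y) \<le> N x + N y) \<and> (\<forall>c x. N (c *\<^sub>C x) = cmod c * N x)"

text \<open>
  Below, \<open>A\<close> and \<open>B\<close> are the (finite dimensional) subspaces on which the norms \<open>N\<close> and \<open>M\<close> live.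
  Functionals on \<open>A\<close> are given as restrictions of functionals on the ambient type.
\<close>

definition dual_norm :: "'a::complex_vec set \<Rightarrow> ('a \<Rightarrow> real) \<Rightarrow> ('a \<Rightarrow> complex) \<Rightarrow> real" where
  "dual_norm A N \<phi> = Sup {cmod (\<phi> x) | x. x \<in> A \<and> N x \<le> 1}"

text \<open>
  Projective and injective norm on the tensor product of \<open>A\<close> and \<open>B\<close>, whose tensor map
  is \<open>t\<close>.
\<close>

definition projective_norm ::
  "('a::complex_vec \<Rightarrow> 'b::complex_vec \<Rightarrow> 'c::complex_vec) \<Rightarrow> 'a set \<Rightarrow> ('a \<Rightarrow> real) \<Rightarrow>
   'b set \<Rightarrow> ('b \<Rightarrow> real) \<Rightarrow> 'c \<Rightarrow> real" where
  "projective_norm t A N B M f =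
     Inf {\<Sum>(x, y)\<leftarrow>ps. N x * M y | ps. set ps \<subseteq> A \<times> B \<and> f = (\<Sum>(x, y)\<leftarrow>ps. t x y)}"

text \<open>
  The functional \<open>\<theta>\<close> is \<open>\<phi> \<otimes> \<psi>\<close>: its values on the tensor product of \<open>A\<close> and \<open>B\<close> are
  determined by those on the elements \<open>t x y\<close>. The supremum is taken in \<open>[0, \<infinity>)\<close>; the
  inserted \<open>0\<close> only matters when \<open>A\<close> or \<open>B\<close> is zero, where no functional has norm \<open>1\<close>.
\<close>

definition injective_norm ::
  "('a::complex_vec \<Rightarrow> 'b::complex_vec \<Rightarrow> 'c::complex_vec) \<Rightarrow> 'a set \<Rightarrow> ('a \<Rightarrow> real) \<Rightarrow>
   'b set \<Rightarrow> ('b \<Rightarrow> real) \<Rightarrow> 'c \<Rightarrow> real" where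
  "injective_norm t A N B M f =
     Sup (insert 0 {cmod (\<theta> f) | \<theta> \<phi> \<psi>.
       clinear \<phi> \<and> clinear \<psi> \<and> dual_norm A N \<phi> = 1 \<and> dual_norm B M \<psi> = 1 \<and>
       clinear \<theta> \<and> (\<forall>x\<in>A. \<forall>y\<in>B. \<theta> (t x y) = \<phi> x * \<psi> y)})"

text \<open>
  The tensor map \<open>V\<^sup>\<otimes>\<^sup>k \<times> V \<rightarrow> V\<^sup>\<otimes>\<^sup>(\<^sup>k\<^sup>+\<^sup>1\<^sup>)\<close>, \<open>(x\<^sub>1 \<otimes> \<dots> \<otimes> x\<^sub>k, v) \<mapsto> x\<^sub>1 \<otimes> \<dots> \<otimes> x\<^sub>k \<otimes> v\<close>, for
  all \<open>k\<close> at once.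
\<close>

definition tensor_snoc :: "'v::complex_vec tensor \<Rightarrow> 'v \<Rightarrow> 'v tensor" where
  "tensor_snoc f v = tensor_lift (\<lambda>xs. tprod (xs @ [v])) f"

lemma clinear_tensor_snoc: "clinear (\<lambda>f. tensor_snoc f v)"
  and tensor_snoc_tprod: "tensor_snoc (tprod xs) v = tprod (xs @ [v])"
proof -
  have "multilinear (\<lambda>xs. tprod (xs @ [v]))"
    using multilinear_tprod unfolding multilinear_def by (metis append.assoc append_Cons)
  then show "clinear (\<lambda>f. tensor_snoc f v)" "tensor_snoc (tprod xs) v = tprod (xs @ [v])"
    unfolding tensor_snoc_def by (rule clinear_tensor_lift tensor_lift_tprod; assumption)+
qed

lemma tensor_functional_exists:
  fixes \<phi> :: "'v::complex_vec tensor \<Rightarrow> complex" and \<psi> :: "'v \<Rightarrow> complex"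
  assumes \<phi>: "clinear \<phi>" and \<psi>: "clinear \<psi>"
  shows "\<exists>\<theta>. clinear \<theta> \<and> (\<forall>f v. \<theta> (tensor_snoc f v) = \<phi> f * \<psi> v)"
proof -
  interpret P: Vector_Spaces.linear scaleC scaleC \<phi> by (rule \<phi>)
  interpret Q: Vector_Spaces.linear scaleC scaleC \<psi> by (rule \<psi>)
  define m where "m xs = (if xs = [] then 0 else \<phi> (tprod (butlast xs)) * \<psi> (last xs))" for xs
  have "multilinear m"
    using multilinear_tprod[where 'a = 'v, unfolded multilinear_def]
    by (auto simp: m_def multilinear_def butlast_append P.add P.scale Q.add Q.scale ring_distribs)
  note lin = clinear_tensor_lift[OF this] and prod = tensor_lift_tprod[OF this]
  have "tensor_lift m (tensor_snoc f v) = \<phi> f * \<psi> v" for f v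
  proof (rule cvec.linear_eq_on[of _ _ f "range tprod"])
    show "clinear (\<lambda>f. tensor_lift m (tensor_snoc f v))"
      using Vector_Spaces.linear_compose[OF clinear_tensor_snoc lin] by (simp add: comp_def)
    show "clinear (\<lambda>f. \<phi> f * \<psi> v)"
      by (rule clinearI) (simp_all add: P.add P.scale algebra_simps)
  qed (auto simp: span_tprod tensor_snoc_tprod prod, simp add: m_def)
  with lin show ?thesis by blast
qed

text \<open>
  The canonical identifications of \<open>V\<^sup>\<otimes>\<^sup>0\<close> with the complex numbers and of \<open>V\<^sup>\<otimes>\<^sup>1\<close> with \<open>V\<close>.
\<close>

definition degree0 :: "'v::complex_vec tensor \<Rightarrow> complex" where
  "degree0 = tensor_lift (\<lambda>xs. if xs = [] then 1 else 0)"

definition degree1 :: "'v::complex_vec tensor \<Rightarrow> 'v" where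
  "degree1 = tensor_lift (\<lambda>xs. case xs of [v] \<Rightarrow> v | _ \<Rightarrow> 0)"

lemma clinear_degree0: "clinear degree0"
  and degree0_tprod: "degree0 (tprod xs) = (if xs = [] then 1 else 0)"
proof -
  have "multilinear (\<lambda>xs. if xs = [] then 1 else 0 :: complex)"
    by (simp add: multilinear_def)
  then show "clinear degree0" "degree0 (tprod xs) = (if xs = [] then 1 else 0)"
    unfolding degree0_def by (rule clinear_tensor_lift tensor_lift_tprod; assumption)+
qed

lemma clinear_degree1: "clinear degree1"
  and degree1_tprod: "degree1 (tprod xs) = (case xs of [v] \<Rightarrow> v | _ \<Rightarrow> 0)"
proof -
  have "multilinear (\<lambda>xs. case xs of [v] \<Rightarrow> v | _ \<Rightarrow> 0)"
    by (auto simp: multilinear_def Cons_eq_append_conv append_eq_Cons_conv split: list.splits)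
  then show "clinear degree1" "degree1 (tprod xs) = (case xs of [v] \<Rightarrow> v | _ \<Rightarrow> 0)"
    unfolding degree1_def by (rule clinear_tensor_lift tensor_lift_tprod; assumption)+
qed

text \<open>The \<open>k\<close>-fold norms, as functions on the subspaces \<open>tensor_power k\<close>.\<close>

fun projective_power :: "('v::complex_vec \<Rightarrow> real) \<Rightarrow> nat \<Rightarrow> 'v tensor \<Rightarrow> real" where
  "projective_power N 0 = (\<lambda>f. cmod (degree0 f))"
| "projective_power N (Suc 0) = (\<lambda>f. N (degree1 f))"
| "projective_power N (Suc (Suc k)) =
     projective_norm tensor_snoc (tensor_power (Suc k)) (projective_power N (Suc k)) UNIV N"

fun injective_power :: "('v::complex_vec \<Rightarrow> real) \<Rightarrow> nat \<Rightarrow> 'v tensor \<Rightarrow> real" where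
  "injective_power N 0 = (\<lambda>f. cmod (degree0 f))"
| "injective_power N (Suc 0) = (\<lambda>f. N (degree1 f))"
| "injective_power N (Suc (Suc k)) =
     injective_norm tensor_snoc (tensor_power (Suc k)) (injective_power N (Suc k)) UNIV N"

text \<open>
  A graded norm on \<open>Sym(V)\<close> is represented by the family of its graded pieces, the \<open>k\<close>-th of
  which matters only on \<open>sym_power k\<close>.
\<close>

definition sym_pi :: "('v::complex_vec \<Rightarrow> real) \<Rightarrow> nat \<Rightarrow> 'v sym_alg \<Rightarrow> real" where
  "sym_pi N k P = projective_power N k (pol P)"

definition sym_eps :: "('v::complex_vec \<Rightarrow> real) \<Rightarrow> nat \<Rightarrow> 'v sym_alg \<Rightarrow> real" where
  "sym_eps N k P = injective_power N k (pol P)"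

definition sym_ev :: "('v::complex_vec \<Rightarrow> real) \<Rightarrow> nat \<Rightarrow> 'v sym_alg \<Rightarrow> real" where
  "sym_ev N k P = Sup {cmod (sym_eval P \<phi>) | \<phi>. clinear \<phi> \<and> dual_norm UNIV N \<phi> \<le> 1}"

definition equivalent_graded_norms ::
  "(nat \<Rightarrow> 'v::complex_vec sym_alg \<Rightarrow> real) \<Rightarrow> (nat \<Rightarrow> 'v sym_alg \<Rightarrow> real) \<Rightarrow> bool" where
  "equivalent_graded_norms N N' \<longleftrightarrow>
     (\<forall>\<epsilon>>0. \<exists>k0. \<forall>k\<ge>k0. \<forall>P\<in>sym_power k.
        exp (- \<epsilon> * real k) * N k P \<le> N' k P \<and> N' k P \<le> exp (\<epsilon> * real k) * N k P)"

end

theory Submission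
  imports Defs "HOL-Analysis.Topology_Euclidean_Space" "HOL-Library.Multiset"
    "HOL-Library.Product_Plus"
begin

text \<open>
  The inequalities \<open>ev \<le> \<epsilon> \<le> \<pi>\<close> are elementary, so everything rests on \<open>\<pi> \<le> e\<^sup>o\<^sup>(\<^sup>k\<^sup>) ev\<close> on
  \<open>Sym\<^sup>k(V)\<close>. The identity of \<open>Sym\<^sup>k(V)\<close> is the \<open>k\<close>-th power of the single element
  \<open>U = \<Sum>\<^sub>b b \<otimes> b\<^sup>*\<close> of the commutative algebra \<open>Sym(V) \<otimes> Sym(V\<^sup>*)\<close>. Give this algebra the gauge
  of the products \<open>v\<^sub>1 \<cdots> v\<^sub>n \<otimes> (l\<^sup>l / l!) \<psi>\<^sup>l\<close> with \<open>v\<^sub>i\<close> and \<open>\<psi>\<close> in the unit balls; averaging over roots of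
  unity shows that it is submultiplicative. A bounded character is a pair \<open>(\<phi>, v)\<close> with
  \<open>\<bar>\<phi>(v)\<bar>\<^sup>l l\<^sup>l / l! \<le> 1\<close> for all \<open>l\<close>, so it sends \<open>U\<close> into the disc of radius \<open>1/e\<close>. By Gelfand's spectral radius
  formula, \<open>U\<^sup>k\<close> is a combination of the generators with coefficients of total size \<open>e\<^sup>-\<^sup>k\<^sup>+\<^sup>o\<^sup>(\<^sup>k\<^sup>)\<close>. Contracting
  with \<open>P\<close> writes \<open>P\<close> as a combination of products \<open>v\<^sub>1 \<cdots> v\<^sub>k\<close> whose coefficients have total size at
  most \<open>e\<^sup>-\<^sup>k\<^sup>+\<^sup>o\<^sup>(\<^sup>k\<^sup>) (k\<^sup>k / k!) ev(P) \<le> e\<^sup>o\<^sup>(\<^sup>k\<^sup>) ev(P)\<close>.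
\<close>

section \<open>Characters of commutative algebras with a submultiplicative seminorm\<close>

text \<open>The obstacle: polarising directly loses the factor k^k / k!, which grows like e^k and is
  not subexponential. The argument pays this price on purpose. The generators carry the weight l^l /
  l!, so contraction with P costs up to e^k, and the bound 1/e for the spectral radius of U returns
  e^-k up to a subexponential factor. The weight serves two ends. A product \<phi>^a \<psi>^b is not
  a power of one functional but, up to a constant, a coefficient of (s \<phi> + t \<theta>
  \<psi>)^(a+b) as \<theta> runs over the unit circle; with s = a/(a+b) and t = b/(a+b) the weights
  turn the averaging into coefficients of total size exactly 1. And |x|^l l^l / l! \<le> 1 for all l
  forces |x| \<le> 1/e, because k^k / k! is e^k up to a polynomial factor. Finite dimension enters
  through U, a finite sum over a basis, and through the boundedness of functionals. The gauge is
  only a seminorm. Its spectral radius formula comes from minimising among seminorms that keep the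
  powers of U large: the minimiser is multiplicative, and an argument of Ostrowski makes every
  element a scalar modulo its null ideal.\<close>

locale complex_algebra =
  fixes \<iota> :: "complex \<Rightarrow> 'r::comm_ring_1"
  assumes \<iota>_add: "\<iota> (c + d) = \<iota> c + \<iota> d"
    and \<iota>_mult: "\<iota> (c * d) = \<iota> c * \<iota> d"
    and \<iota>_1: "\<iota> 1 = 1"
begin

lemma \<iota>_0: "\<iota> 0 = 0"
  using \<iota>_add[of 0 0] by simp

lemma \<iota>_minus: "\<iota> (- c) = - \<iota> c"
  using \<iota>_add[of c "- c"] by (simp add: \<iota>_0 eq_neg_iff_add_eq_0 add.commute)

lemma \<iota>_diff: "\<iota> (c - d) = \<iota> c - \<iota> d"
  using \<iota>_add[of c "- d"] by (simp add: \<iota>_minus)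

lemma \<iota>_power: "\<iota> (c ^ n) = \<iota> c ^ n"
  by (induction n) (simp_all add: \<iota>_1 \<iota>_mult)

lemma \<iota>_of_nat: "\<iota> (of_nat n) = of_nat n"
  by (induction n) (simp_all add: \<iota>_0 \<iota>_1 \<iota>_add)

lemma \<iota>_sum: "\<iota> (\<Sum>x\<in>A. f x) = (\<Sum>x\<in>A. \<iota> (f x))"
  by (induction A rule: infinite_finite_induct) (simp_all add: \<iota>_0 \<iota>_add)

text \<open>The value at 1 is left free, so degenerate gauges are included. For scalars an
  inequality is enough: inverting the scalar turns it into an equality.\<close>

definition alg_seminorm :: "('r \<Rightarrow> real) \<Rightarrow> bool" where
  "alg_seminorm q \<longleftrightarrow> (\<forall>a. 0 \<le> q a) \<and> (\<forall>a b. q (a + b) \<le> q a + q b) \<and>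
     (\<forall>a b. q (a * b) \<le> q a * q b) \<and> (\<forall>c a. q (\<iota> c * a) \<le> cmod c * q a)"

context
  fixes q assumes q: "alg_seminorm q"
begin

lemma nonneg: "0 \<le> q a" and triangle: "q (a + b) \<le> q a + q b"
  and submult: "q (a * b) \<le> q a * q b" and scale_le: "q (\<iota> c * a) \<le> cmod c * q a"
  using q unfolding alg_seminorm_def by blast+

lemma zero: "q 0 = 0"
  using scale_le[of 0 0] nonneg[of 0] by (simp add: \<iota>_0)

lemma scale: "q (\<iota> c * a) = cmod c * q a"
proof (cases "c = 0")
  case True then show ?thesis by (simp add: \<iota>_0 zero)
next
  case False
  have "q a = q (\<iota> (inverse c) * (\<iota> c * a))"
    using False by (simp add: \<iota>_mult[symmetric] mult.assoc[symmetric] \<iota>_1)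
  also have "\<dots> \<le> cmod (inverse c) * q (\<iota> c * a)" by (rule scale_le)
  finally have "cmod c * q a \<le> q (\<iota> c * a)"
    using False by (simp add: norm_inverse pos_le_divide_eq inverse_eq_divide norm_divide mult.commute)
  with scale_le[of c a] show ?thesis by simp
qed

lemma minus: "q (- a) = q a"
  using scale[of "- 1" a] by (simp add: \<iota>_minus \<iota>_1)

lemma triangle_diff: "q (a - b) \<le> q a + q b"
  using triangle[of a "- b"] by (simp add: minus)

lemma triangle_rev: "q a - q b \<le> q (a - b)"
  using triangle[of "a - b" b] by simp

lemma seminorm_sum: "q (\<Sum>x\<in>A. f x) \<le> (\<Sum>x\<in>A. q (f x))"
  by (induction A rule: infinite_finite_induct) (auto simp: zero intro: order_trans[OF triangle])

lemma seminorm_of_nat: "q (of_nat n * a) = real n * q a"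
  using scale[of "of_nat n" a] by (simp add: \<iota>_of_nat)

text \<open>Exponents start at one because q 1 may exceed 1.\<close>

lemma power_le: "q (a ^ Suc n) \<le> q a ^ Suc n"
proof (induction n)
  case (Suc n)
  have "q (a ^ Suc (Suc n)) \<le> q a * q (a ^ Suc n)"
    using submult[of a "a ^ Suc n"] by simp
  also have "\<dots> \<le> q a * q a ^ Suc n"
    by (rule mult_left_mono[OF Suc nonneg])
  finally show ?case by simp
qed simp

text \<open>Write m = n * d + e with e < n: each of the d blocks contributes a factor s ^ n, and C
  absorbs the finitely many remainders. One good exponent thus controls all powers.\<close>

lemma power_growth:
  assumes n: "0 < n" "q (a ^ n) \<le> s ^ n" and s: "0 < s"
  shows "\<exists>C. \<forall>m. q (a ^ m) \<le> C * s ^ m"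
proof (intro exI allI)
  fix m
  define C where "C = (\<Sum>e<n. q (a ^ e) / s ^ e)"
  have C: "q (a ^ e) \<le> C * s ^ e" if "e < n" for e
  proof -
    have "q (a ^ e) / s ^ e \<le> C"
      unfolding C_def by (rule member_le_sum) (use that s nonneg in auto)
    then show ?thesis using s by (simp add: divide_simps)
  qed
  have "q (a ^ (n * d + e)) \<le> C * s ^ (n * d + e)" if "e < n" for d e
  proof (induction d)
    case 0 show ?case using C[OF that] by simp
  next
    case (Suc d)
    have "a ^ (n * Suc d + e) = a ^ n * a ^ (n * d + e)"
      by (simp add: power_add[symmetric] add.assoc)
    then have "q (a ^ (n * Suc d + e)) \<le> q (a ^ n) * q (a ^ (n * d + e))"
      by (metis submult)
    also have "\<dots> \<le> s ^ n * (C * s ^ (n * d + e))"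
      by (rule mult_mono) (use n Suc nonneg s in auto)
    finally show ?case by (simp add: power_add mult_ac)
  qed
  from this[of "m mod n" "m div n"] show "q (a ^ m) \<le> (\<Sum>e<n. q (a ^ e) / s ^ e) * s ^ m"
    using n by (simp add: C_def)
qed

section \<open>Growth rates of powers and the spectral radius\<close>

definition spec_rates :: "'r \<Rightarrow> real set" where
  "spec_rates a = {s. 0 < s \<and> (\<exists>C. \<forall>m. q (a ^ m) \<le> C * s ^ m)}"

text \<open>This is the limit of the n-th roots of q (a ^ n). Taking the infimum of admissible
  growth rates, each with its own constant, lets sums and products be estimated without
  limits.\<close>

definition spec_rad :: "'r \<Rightarrow> real" where
  "spec_rad a = Inf (spec_rates a)"

lemma spec_rates_power: "0 < n \<Longrightarrow> 0 < s \<Longrightarrow> q (a ^ n) \<le> s ^ n \<Longrightarrow> s \<in> spec_rates a"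
  using power_growth unfolding spec_rates_def by blast

lemma spec_rates_gt: "q a < s \<Longrightarrow> s \<in> spec_rates a"
  using nonneg[of a] by (intro spec_rates_power[of 1]) auto

lemma spec_rad_le: "s \<in> spec_rates a \<Longrightarrow> spec_rad a \<le> s"
  unfolding spec_rad_def by (rule cInf_lower) (auto simp: spec_rates_def intro!: bdd_belowI[of _ 0])

lemma spec_rad_geI:
  assumes "\<And>s. s \<in> spec_rates a \<Longrightarrow> t \<le> s" shows "t \<le> spec_rad a"
  unfolding spec_rad_def using assms spec_rates_gt[of a "q a + 1"] by (intro cInf_greatest) auto

lemma spec_rad_approx: "0 < e \<Longrightarrow> \<exists>s\<in>spec_rates a. s < spec_rad a + e"
  unfolding spec_rad_def
  by (rule cInf_lessD) (use spec_rates_gt[of a "q a + 1"] in auto)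

lemma spec_rad_le_seminorm: "spec_rad a \<le> q a"
  by (rule field_le_epsilon) (auto intro!: spec_rad_le spec_rates_gt)

lemma spec_rates_pos: "s \<in> spec_rates a \<Longrightarrow> 0 < s"
  by (simp add: spec_rates_def)

lemma spec_rates_constant:
  assumes "s \<in> spec_rates a" obtains C where "0 \<le> C" "\<And>m. q (a ^ m) \<le> C * s ^ m"
proof -
  obtain C where C: "\<And>m. q (a ^ m) \<le> C * s ^ m"
    using assms by (auto simp: spec_rates_def)
  from C[of 0] nonneg[of "a ^ 0"] have "0 \<le> C" by simp
  with C that show ?thesis by blast
qed

text \<open>The binomial theorem applies because the algebra is commutative; the constants multiply
  while the rates add.\<close>

lemma spec_rates_add:
  assumes "s \<in> spec_rates a" "t \<in> spec_rates b" shows "s + t \<in> spec_rates (a + b)"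
proof -
  obtain C D where C: "0 \<le> C" "\<And>m. q (a ^ m) \<le> C * s ^ m"
    and D: "0 \<le> D" "\<And>m. q (b ^ m) \<le> D * t ^ m"
    using assms spec_rates_constant by metis
  note pos = assms[THEN spec_rates_pos]
  have "q ((a + b) ^ m) \<le> (C * D) * (s + t) ^ m" for m
  proof -
    have "q ((a + b) ^ m) \<le> (\<Sum>i\<le>m. q (of_nat (m choose i) * (a ^ i * b ^ (m - i))))"
      unfolding binomial_ring mult.assoc by (rule seminorm_sum)
    also have "\<dots> \<le> (\<Sum>i\<le>m. (C * D) * (real (m choose i) * s ^ i * t ^ (m - i)))"
    proof (rule sum_mono)
      fix i
      have "q (a ^ i * b ^ (m - i)) \<le> q (a ^ i) * q (b ^ (m - i))" by (rule submult)
      also have "\<dots> \<le> (C * s ^ i) * (D * t ^ (m - i))"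
        by (rule mult_mono) (use C D pos nonneg in auto)
      finally have "q (a ^ i * b ^ (m - i)) \<le> (C * s ^ i) * (D * t ^ (m - i))" .
      from mult_left_mono[OF this, of "real (m choose i)"]
      show "q (of_nat (m choose i) * (a ^ i * b ^ (m - i))) \<le>
            (C * D) * (real (m choose i) * s ^ i * t ^ (m - i))"
        unfolding seminorm_of_nat by (simp add: mult_ac)
    qed
    also have "\<dots> = (C * D) * (s + t) ^ m"
      by (simp add: binomial_ring sum_distrib_left mult_ac)
    finally show ?thesis .
  qed
  then show ?thesis using pos by (auto simp: spec_rates_def)
qed

lemma spec_rates_mult:
  assumes "s \<in> spec_rates a" "t \<in> spec_rates b" shows "s * t \<in> spec_rates (a * b)"
proof -
  obtain C D where C: "0 \<le> C" "\<And>m. q (a ^ m) \<le> C * s ^ m"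
    and D: "0 \<le> D" "\<And>m. q (b ^ m) \<le> D * t ^ m"
    using assms spec_rates_constant by metis
  note pos = assms[THEN spec_rates_pos]
  have "q ((a * b) ^ m) \<le> (C * D) * (s * t) ^ m" for m
  proof -
    have "q ((a * b) ^ m) \<le> q (a ^ m) * q (b ^ m)"
      by (simp add: power_mult_distrib submult)
    also have "\<dots> \<le> (C * s ^ m) * (D * t ^ m)"
      by (rule mult_mono) (use C D pos nonneg in auto)
    finally show ?thesis by (simp add: power_mult_distrib mult_ac)
  qed
  then show ?thesis using pos by (auto simp: spec_rates_def)
qed

lemma alg_seminorm_spec_rad: "alg_seminorm spec_rad"
  unfolding alg_seminorm_def
proof (intro conjI allI)
  show pos: "0 \<le> spec_rad a" for a
    by (rule spec_rad_geI) (auto dest: spec_rates_pos)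
  show "spec_rad (a + b) \<le> spec_rad a + spec_rad b" for a b
  proof (rule field_le_epsilon)
    fix e :: real assume "0 < e"
    then obtain s t where "s \<in> spec_rates a" "s < spec_rad a + e / 2"
      "t \<in> spec_rates b" "t < spec_rad b + e / 2"
      using spec_rad_approx[of "e / 2"] by (metis half_gt_zero)
    then show "spec_rad (a + b) \<le> spec_rad a + spec_rad b + e"
      using spec_rad_le[OF spec_rates_add] by fastforce
  qed
  show mult: "spec_rad (a * b) \<le> spec_rad a * spec_rad b" for a b
  proof -
    have *: "spec_rad (a * b) \<le> s * t" if "s \<in> spec_rates a" "t \<in> spec_rates b" for s t
      using that by (intro spec_rad_le spec_rates_mult)
    have **: "spec_rad (a * b) \<le> s * spec_rad b" if "s \<in> spec_rates a" for s
    proof -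
      have "spec_rad (a * b) / s \<le> spec_rad b"
        by (rule spec_rad_geI)
          (use *[OF that] spec_rates_pos[OF that] in \<open>simp add: divide_le_eq mult.commute\<close>)
      then show ?thesis using spec_rates_pos[OF that] by (simp add: divide_le_eq mult.commute)
    qed
    show ?thesis
    \<comment> \<open>The infimum over the rates of b is already taken in \<open>**\<close>. Taking
      it over the rates of a divides by \<open>spec_rad b\<close>, so the value 0 is treated
      apart.\<close>
    proof (cases "spec_rad b = 0")
      case True
      with **[OF spec_rates_gt[of a "q a + 1"]] show ?thesis by simp
    next
      case False
      with pos[of b] have b: "0 < spec_rad b" by simp
      have "spec_rad (a * b) / spec_rad b \<le> spec_rad a"
        by (rule spec_rad_geI) (use ** b in \<open>simp add: divide_le_eq\<close>)
      then show ?thesis using b by (simp add: divide_le_eq)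
    qed
  qed
  show "spec_rad (\<iota> c * a) \<le> cmod c * spec_rad a" for c a
  proof -
    have "spec_rad (\<iota> c) \<le> cmod c"
    proof (rule field_le_epsilon)
      fix e :: real assume "0 < e"
      have "q (\<iota> c ^ m) \<le> q 1 * (cmod c + e) ^ m" for m
      proof -
        have "q (\<iota> c ^ m) = cmod c ^ m * q 1"
          using scale[of "c ^ m" 1] by (simp add: \<iota>_power norm_power)
        also have "\<dots> \<le> (cmod c + e) ^ m * q 1"
          by (intro mult_right_mono power_mono nonneg) (use \<open>0 < e\<close> in auto)
        finally show ?thesis by (simp add: mult.commute)
      qed
      then have "cmod c + e \<in> spec_rates (\<iota> c)"
        using \<open>0 < e\<close> norm_ge_zero[of c] unfolding spec_rates_def
        by (auto intro: add_nonneg_pos)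
      then show "spec_rad (\<iota> c) \<le> cmod c + e" by (rule spec_rad_le)
    qed
    then show ?thesis using mult[of "\<iota> c" a] pos[of a] by (meson mult_right_mono order_trans)
  qed
qed

section \<open>Localisation of a seminorm at an element\<close>

definition localised :: "'r \<Rightarrow> 'r \<Rightarrow> real" where
  "localised a b = (INF j. q (b * a ^ j) / q a ^ j)"

context
  fixes a assumes a: "0 < q a"
begin

lemma localised_term_antimono:
  assumes "i \<le> j" shows "q (b * a ^ j) / q a ^ j \<le> q (b * a ^ i) / q a ^ i"
  using assms
proof (rule lift_Suc_antimono_le[rotated])
  fix n
  have "q (b * a ^ n * a) \<le> q (b * a ^ n) * q a" by (rule submult)
  then show "q (b * a ^ Suc n) / q a ^ Suc n \<le> q (b * a ^ n) / q a ^ n"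
    using a by (simp add: divide_simps mult_ac)
qed

lemma localised_le: "localised a b \<le> q (b * a ^ j) / q a ^ j"
  unfolding localised_def
  by (rule cINF_lower) (use nonneg a in \<open>auto intro!: bdd_belowI[of _ 0]\<close>)

lemma localised_geI: "(\<And>j. t \<le> q (b * a ^ j) / q a ^ j) \<Longrightarrow> t \<le> localised a b"
  unfolding localised_def by (rule cINF_greatest) auto

lemma localised_le_seminorm: "localised a b \<le> q b"
  using localised_le[of b 0] by simp

lemma localised_approx:
  assumes "0 < e" shows "\<exists>j0. \<forall>j\<ge>j0. q (b * a ^ j) / q a ^ j < localised a b + e"
proof -
  have "\<exists>j0. q (b * a ^ j0) / q a ^ j0 < localised a b + e"
    using localised_geI[of "localised a b + e" b] assms by (meson less_add_same_cancel1 not_less)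
  then show ?thesis using localised_term_antimono by (meson order_le_less_trans)
qed

lemma localised_nonneg: "0 \<le> localised a b"
  by (rule localised_geI) (use nonneg a in auto)

lemma localised_limit: "(\<lambda>j. q (b * a ^ j) / q a ^ j) \<longlonglongrightarrow> localised a b"
proof (rule LIMSEQ_I)
  fix e :: real assume "0 < e"
  from localised_approx[OF this, of b]
  show "\<exists>no. \<forall>n\<ge>no. norm (q (b * a ^ n) / q a ^ n - localised a b) < e"
    using localised_le[of b] by (smt (verit) real_norm_def)
qed

text \<open>The quotients decrease in j, so the infimum is a limit and inherits the inequalities
  termwise. The purpose is minimality: if this smaller seminorm equals q, its term at j = 1 shows
  that multiplication by a scales q by exactly q a.\<close>

lemma alg_seminorm_localised: "alg_seminorm (localised a)"
  unfolding alg_seminorm_def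
proof (intro conjI allI)
  fix b c :: 'r and z
  show "0 \<le> localised a b" by (rule localised_nonneg)
  show "localised a (b + c) \<le> localised a b + localised a c"
  proof (rule LIMSEQ_le[OF localised_limit tendsto_add[OF localised_limit localised_limit]])
    show "\<exists>N. \<forall>n\<ge>N. q ((b + c) * a ^ n) / q a ^ n \<le> q (b * a ^ n) / q a ^ n + q (c * a ^ n) / q a ^ n"
      using triangle[of "b * a ^ _" "c * a ^ _"] a
      by (auto simp: add_divide_distrib[symmetric] distrib_right divide_le_cancel)
  qed
  show "localised a (b * c) \<le> localised a b * localised a c"
  proof (rule LIMSEQ_le_const[OF tendsto_mult[OF localised_limit localised_limit]])
    have "localised a (b * c) \<le> q (b * a ^ n) / q a ^ n * (q (c * a ^ n) / q a ^ n)" for n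
    proof -
      \<comment> \<open>The exponent is doubled so that each factor receives its own a ^ n.\<close>
      have "b * c * a ^ (n + n) = (b * a ^ n) * (c * a ^ n)" by (simp add: power_add mult_ac)
      then have "q (b * c * a ^ (n + n)) \<le> q (b * a ^ n) * q (c * a ^ n)" by (metis submult)
      then show ?thesis
        using localised_le[of "b * c" "n + n"] a
        by (simp add: power_add) (meson divide_right_mono mult_nonneg_nonneg order_less_imp_le
            order_trans zero_le_power)
    qed
    then show "\<exists>N. \<forall>n\<ge>N. localised a (b * c) \<le> q (b * a ^ n) / q a ^ n * (q (c * a ^ n) / q a ^ n)"
      by blast
  qed
  show "localised a (\<iota> z * b) \<le> cmod z * localised a b"
    by (rule LIMSEQ_le[OF localised_limit tendsto_mult_left[OF localised_limit]])
      (auto simp: scale mult.assoc)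
qed

end

end

text \<open>Ostrowski: if the minimum \<open>r\<close> of \<open>\<lambda> \<mapsto> q (a - \<lambda>)\<close> were positive, then at distance less than
  \<open>r\<close> from a minimiser all points would be minimisers, because \<open>b ^ 2 ^ k - d ^ 2 ^ k\<close> is a product of
  linear factors.\<close>

lemma multiplicative_scalar:
  assumes q: "alg_seminorm q" and mult: "\<And>a b. q (a * b) = q a * q b" and one: "q 1 = 1"
  shows "\<exists>z. q (a - \<iota> z) = 0"
proof -
  note nonneg = nonneg[OF q] and scale = scale[OF q]
  have iota: "q (\<iota> z) = cmod z" for z using scale[of z 1] one by simp
  have lip: "\<bar>q (a - \<iota> z) - q (a - \<iota> w)\<bar> \<le> cmod (z - w)" for z w
  proof -
    have "q (a - \<iota> z) - q (a - \<iota> w) \<le> q ((a - \<iota> z) - (a - \<iota> w))"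
      "q (a - \<iota> w) - q (a - \<iota> z) \<le> q ((a - \<iota> w) - (a - \<iota> z))"
      by (rule triangle_rev[OF q])+
    moreover have "(a - \<iota> z) - (a - \<iota> w) = \<iota> (w - z)" "(a - \<iota> w) - (a - \<iota> z) = \<iota> (z - w)"
      by (simp_all add: \<iota>_diff)
    ultimately show ?thesis by (simp add: iota norm_minus_commute)
  qed
  have large: "cmod z - q a \<le> q (a - \<iota> z)" for z
    using triangle_rev[OF q, of "\<iota> z" a] minus[OF q, of "a - \<iota> z"] by (simp add: iota)
  have cont: "continuous_on UNIV (\<lambda>z. q (a - \<iota> z))"
    unfolding continuous_on_iff dist_norm real_norm_def
    using lip by (meson order_le_less_trans)
  \<comment> \<open>A minimum over a disc exists by compactness. The radius 2 * q a suffices,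
    because outside it \<open>large\<close> gives more than q a, the value at 0.\<close>
  obtain z0 where z0: "\<And>z. cmod z \<le> 2 * q a \<Longrightarrow> q (a - \<iota> z0) \<le> q (a - \<iota> z)"
  proof -
    have "compact (cball (0::complex) (2 * q a))" by simp
    from continuous_attains_inf[OF this _ continuous_on_subset[OF cont]]
    show ?thesis using that nonneg[of a] by (auto simp: cball_def dist_norm)
  qed
  define r where "r = q (a - \<iota> z0)"
  have min: "r \<le> q (a - \<iota> z)" for z
  proof (cases "cmod z \<le> 2 * q a")
    case False
    then show ?thesis using large[of z] z0[of 0] nonneg[of a] by (simp add: \<iota>_0 r_def)
  qed (simp add: z0 r_def)
  have "r = 0"
  proof (rule ccontr)
    assume "r \<noteq> 0"
    then have r: "0 < r" using nonneg[of "a - \<iota> z0"] by (simp add: r_def)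
    have spread: "q (a - \<iota> (z + d)) = r" if z: "q (a - \<iota> z) = r" and d: "cmod d < r" for z d
    proof -
      define b where "b = a - \<iota> z"
      have b: "r \<le> q (b - \<iota> w)" for w
        using min[of "z + w"] by (simp add: b_def \<iota>_add algebra_simps)
      \<comment> \<open>Dyadic exponents let each induction step factor with a single complex square
        root of w.\<close>
      have pow: "r ^ 2 ^ k \<le> q (b ^ 2 ^ k - \<iota> w)" for k w
      proof (induction k arbitrary: w)
        case 0 show ?case using b by simp
      next
        case (Suc k)
        have "b ^ 2 ^ Suc k - \<iota> w = (b ^ 2 ^ k - \<iota> (csqrt w)) * (b ^ 2 ^ k - \<iota> (- csqrt w))"
          using \<iota>_mult[of "csqrt w" "csqrt w"]
          by (simp add: \<iota>_minus algebra_simps mult_2 power_add flip: power2_eq_square)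
        then show ?case
          using mult_mono[OF Suc Suc, of "csqrt w" "- csqrt w"] r nonneg
          by (simp add: mult mult_2 power_add)
      qed
      \<comment> \<open>The factor b - d is kept; the others are b ^ 2 ^ i + d ^ 2 ^ i for i < k,
        each of size at least r ^ 2 ^ i by \<open>pow\<close>, and these exponents add up to 2 ^ k -
        1.\<close>
      have "q (b - \<iota> d) * r ^ (2 ^ k - 1) \<le> q (b ^ 2 ^ k - \<iota> (d ^ 2 ^ k))" for k
      proof (induction k)
        case (Suc k)
        have "b ^ 2 ^ Suc k - \<iota> (d ^ 2 ^ Suc k) =
            (b ^ 2 ^ k - \<iota> (d ^ 2 ^ k)) * (b ^ 2 ^ k - \<iota> (- (d ^ 2 ^ k)))"
          by (simp add: \<iota>_minus \<iota>_mult algebra_simps mult_2 power_add)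
        moreover have "(2::nat) ^ Suc k - 1 = (2 ^ k - 1) + 2 ^ k"
          by (simp add: mult_2)
        then have "q (b - \<iota> d) * r ^ (2 ^ Suc k - 1) = q (b - \<iota> d) * r ^ (2 ^ k - 1) * r ^ 2 ^ k"
          by (simp only: power_add mult.assoc)
        moreover have "\<dots> \<le> q (b ^ 2 ^ k - \<iota> (d ^ 2 ^ k)) * q (b ^ 2 ^ k - \<iota> (- (d ^ 2 ^ k)))"
          by (rule mult_mono[OF Suc pow]) (use r nonneg in auto)
        ultimately show ?case by (simp only: mult)
      qed simp
      moreover have "q (b ^ 2 ^ k - \<iota> (d ^ 2 ^ k)) \<le> r ^ 2 ^ k + cmod d ^ 2 ^ k" for k
      proof -
        have "q (b ^ n) = q b ^ n" for n by (induction n) (simp_all add: one mult)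
        then show ?thesis
          using triangle_diff[OF q, of "b ^ 2 ^ k" "\<iota> (d ^ 2 ^ k)"] z
          by (simp add: iota norm_power b_def)
      qed
      ultimately have bound: "q (b - \<iota> d) * r ^ (2 ^ k - 1) \<le> r ^ 2 ^ k + cmod d ^ 2 ^ k" for k
        by (meson order_trans)
      have *: "q (b - \<iota> d) \<le> r + r * (cmod d / r) ^ 2 ^ k" for k
      proof -
        have "q (b - \<iota> d) * r ^ (2 ^ k - 1) * r \<le> (r ^ 2 ^ k + cmod d ^ 2 ^ k) * r"
          using bound[of k] r by (intro mult_right_mono) auto
        moreover have "r ^ (2 ^ k - 1) * r = r ^ 2 ^ k"
          by (metis One_nat_def Suc_pred mult.commute pos2 power_Suc zero_less_power)
        ultimately have "q (b - \<iota> d) * r ^ 2 ^ k \<le> (r ^ 2 ^ k + cmod d ^ 2 ^ k) * r"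
          by (simp add: mult.assoc)
        then show ?thesis using r by (simp add: field_simps power_divide)
      qed
      have "(\<lambda>k. r + r * (cmod d / r) ^ 2 ^ k) \<longlonglongrightarrow> r + r * 0"
      proof (intro tendsto_intros)
        have "(\<lambda>n. (cmod d / r) ^ n) \<longlonglongrightarrow> 0"
          by (rule LIMSEQ_power_zero) (use d r in simp)
        moreover have "strict_mono (\<lambda>k::nat. (2::nat) ^ k)"
          by (rule strict_monoI) simp
        ultimately show "(\<lambda>k. (cmod d / r) ^ 2 ^ k) \<longlonglongrightarrow> 0"
          using LIMSEQ_subseq_LIMSEQ[of "\<lambda>n. (cmod d / r) ^ n" 0 "\<lambda>k. 2 ^ k"] by (simp add: comp_def)
      qed
      then have "q (b - \<iota> d) \<le> r"
        using LIMSEQ_le_const[of _ "r + r * 0" "q (b - \<iota> d)"] * by simp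
      with b[of d] have "q (b - \<iota> d) = r" by simp
      then show ?thesis by (simp add: b_def \<iota>_add algebra_simps)
    qed
    \<comment> \<open>Steps of length r / 2 < r lead from minimiser to minimiser arbitrarily far
      along the real direction, where \<open>large\<close> contradicts the constant value r.\<close>
    have "q (a - \<iota> (z0 + of_nat n * of_real (r / 2))) = r" for n
    proof (induction n)
      case (Suc n)
      from spread[OF Suc, of "of_real (r / 2)"] r show ?case
        by (simp add: distrib_right add_divide_distrib add_ac)
    qed (simp add: r_def)
    then have "real n * (r / 2) \<le> r + q a + cmod z0" for n
      using large[of "z0 + of_nat n * of_real (r / 2)"] r
        norm_triangle_ineq2[of "of_nat n * of_real (r / 2)" "- z0"]
      by (fastforce simp: norm_mult add.commute simp del: of_real_divide)
    moreover obtain n where "(r + q a + cmod z0) / (r / 2) < real n"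
      using reals_Archimedean2 by blast
    ultimately show False
      using r by (metis half_gt_zero linorder_not_le pos_divide_less_eq)
  qed
  then show ?thesis unfolding r_def by blast
qed

text \<open>Among the submultiplicative seminorms below q0 that keep the lower bound on the powers
  of u, Zorn's lemma gives a minimal one. Its spectral radius and its localisations stay in this
  class, so minimality makes it multiplicative; by \<open>multiplicative_scalar\<close> every
  element is then a scalar modulo its null ideal.\<close>

theorem character_exists:
  assumes q0: "alg_seminorm q0" and \<rho>: "0 < \<rho>" and u: "\<And>m. \<rho> ^ m \<le> q0 (u ^ m)"
  shows "\<exists>h. (\<forall>a b. h (a + b) = h a + h b) \<and> (\<forall>a b. h (a * b) = h a * h b) \<and> (\<forall>c. h (\<iota> c) = c) \<and>
    (\<forall>a. cmod (h a) \<le> q0 a) \<and> \<rho> \<le> cmod (h u)"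
proof -
  define S where "S = {q. alg_seminorm q \<and> q \<le> q0 \<and> (\<forall>m. \<rho> ^ m \<le> q (u ^ m))}"
  have "\<exists>q\<in>S. \<forall>p\<in>S. p \<le> q \<longrightarrow> p = q"
  \<comment> \<open>The order is reversed: chains need lower bounds, and the element obtained is
    minimal.\<close>
  proof (rule predicate_Zorn[where P = "(\<ge>)"])
    show "partial_order_on S (relation_of (\<ge>) S)"
      by (auto simp: partial_order_on_def preorder_on_def refl_on_def trans_def antisym_def
          relation_of_def)
    show "\<exists>p\<in>S. \<forall>q\<in>C. q \<ge> p" if C: "C \<in> Chains (relation_of (\<ge>) S)" for C
    proof (cases "C = {}")
      case True
      have "q0 \<in> S" using q0 u by (simp add: S_def)
      with True show ?thesis by blast
    next
      case False
      have CS: "q \<in> S" if "q \<in> C" for q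
        using C that by (auto simp: Chains_def relation_of_def)
      have total: "p \<le> q \<or> q \<le> p" if "p \<in> C" "q \<in> C" for p q
        using C that by (auto simp: Chains_def relation_of_def)
      define p where "p a = (INF q\<in>C. q a)" for a
      have sn: "alg_seminorm q" if "q \<in> C" for q using CS[OF that] by (simp add: S_def)
      have le: "p a \<le> q a" if "q \<in> C" for q a
        unfolding p_def
        by (rule cINF_lower) (use that nonneg[OF sn] in \<open>auto intro!: bdd_belowI[of _ 0]\<close>)
      have geI: "t \<le> p a" if "\<And>q. q \<in> C \<Longrightarrow> t \<le> q a" for t a
        unfolding p_def by (rule cINF_greatest) (use that False in auto)
      have approx: "\<exists>q\<in>C. q a < p a + e" if "0 < e" for a e
        using geI[of "p a + e" a] that by (meson less_add_same_cancel1 not_less)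
      have pos: "0 \<le> p a" for a by (rule geI) (rule nonneg[OF sn])
      \<comment> \<open>By totality of the chain the smaller of two members serves both points.
        Subadditivity and submultiplicativity of the infimum need one seminorm that nearly attains
        it at a and at b.\<close>
      have common: "\<exists>q\<in>C. q a < p a + e \<and> q b < p b + e" if e: "0 < e" for a b e
      proof -
        obtain q where q: "q \<in> C" "q a < p a + e" using approx[OF e, of a] by blast
        obtain q' where q': "q' \<in> C" "q' b < p b + e" using approx[OF e, of b] by blast
        from total[OF q(1) q'(1)] show ?thesis
        proof
          assume "q \<le> q'"
          then show ?thesis using q q' le_funD[of q q' b] by (intro bexI[of _ q]) auto
        next
          assume "q' \<le> q"
          then show ?thesis using q q' le_funD[of q' q a] by (intro bexI[of _ q']) auto
        qed
      qed
      have "alg_seminorm p"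
        unfolding alg_seminorm_def
      proof (intro conjI allI)
        fix a b :: 'r and c
        show "0 \<le> p a" by (rule pos)
        show "p (a + b) \<le> p a + p b"
        proof (rule field_le_epsilon)
          fix e :: real assume "0 < e"
          then obtain q where q: "q \<in> C" "q a < p a + e / 2" "q b < p b + e / 2"
            using common[of "e / 2"] by auto
          show "p (a + b) \<le> p a + p b + e"
            using le[OF q(1), of "a + b"] triangle[OF sn[OF q(1)], of a b] q by simp
        qed
        show "p (a * b) \<le> p a * p b"
        proof -
          have "p (a * b) \<le> (p a + e) * (p b + e)" if e: "0 < e" for e
          proof -
            obtain q where q: "q \<in> C" "q a < p a + e" "q b < p b + e" using common[OF e] by auto
            have "p (a * b) \<le> q a * q b"
              using le[OF q(1), of "a * b"] submult[OF sn[OF q(1)], of a b] by simp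
            also have "\<dots> \<le> (p a + e) * (p b + e)"
              by (rule mult_mono) (use q pos[of a] e nonneg[OF sn[OF q(1)]] in auto)
            finally show ?thesis .
          qed
          then have ev: "\<forall>\<^sub>F e in at_right 0. p (a * b) \<le> (p a + e) * (p b + e)"
            by (auto simp: eventually_at_right_less intro: eventually_mono[OF eventually_at_right_less])
          have "((\<lambda>e. (p a + e) * (p b + e)) \<longlongrightarrow> (p a + 0) * (p b + 0)) (at_right 0)"
            by (intro tendsto_intros)
          from tendsto_lowerbound[OF this ev] show ?thesis by simp
        qed
        show "p (\<iota> c * a) \<le> cmod c * p a"
        proof (rule field_le_epsilon)
          fix e :: real assume e: "0 < e"
          define d where "d = e / (cmod c + 1)"
          have d: "0 < d" using e by (simp add: d_def add_nonneg_pos)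
          have "cmod c * d \<le> (cmod c + 1) * d" using d by simp
          also have "\<dots> = e" using norm_ge_zero[of c] by (simp add: d_def add_nonneg_eq_0_iff)
          finally have cd: "cmod c * d \<le> e" .
          obtain q where q: "q \<in> C" "q a < p a + d" using approx[OF d] by blast
          have "p (\<iota> c * a) \<le> cmod c * q a"
            using le[OF q(1), of "\<iota> c * a"] scale[OF sn[OF q(1)], of c a] by simp
          also have "\<dots> \<le> cmod c * (p a + d)" using q by (intro mult_left_mono) auto
          finally show "p (\<iota> c * a) \<le> cmod c * p a + e"
            using cd by (simp add: distrib_left)
        qed
      qed
      moreover have "p \<le> q0"
        using False CS le unfolding S_def le_fun_def by (metis (no_types, lifting) all_not_in_conv
            mem_Collect_eq order_trans le_fun_def)
      moreover have "\<rho> ^ m \<le> p (u ^ m)" for m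
        by (rule geI) (use CS in \<open>auto simp: S_def\<close>)
      ultimately have "p \<in> S" by (simp add: S_def)
      then show ?thesis using le by (auto simp: le_fun_def)
    qed
  qed
  then obtain q where "q \<in> S" and minimal: "\<And>p. p \<in> S \<Longrightarrow> p \<le> q \<Longrightarrow> p = q" by blast
  then have q: "alg_seminorm q" and le0: "q \<le> q0" and qu: "\<And>m. \<rho> ^ m \<le> q (u ^ m)"
    by (auto simp: S_def)
  have minimal': "p = q" if "alg_seminorm p" "\<And>a. p a \<le> q a" "\<And>m. \<rho> ^ m \<le> p (u ^ m)" for p
    by (rule minimal) (use that le0 in \<open>auto simp: S_def le_fun_def intro: order_trans\<close>)
  \<comment> \<open>If the powers of u ^ m grew at a rate s < \<rho> ^ m, the numbers (\<rho> ^ m /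
    s) ^ j would be bounded in j. So the spectral radius keeps the lower bound and equals q by
    minimality; this yields q (a ^ n) = q a ^ n.\<close>
  have "spec_rad q = q"
  proof (rule minimal'[OF alg_seminorm_spec_rad[OF q] spec_rad_le_seminorm[OF q]])
    fix m
    show "\<rho> ^ m \<le> spec_rad q (u ^ m)"
    proof (rule spec_rad_geI[OF q])
      fix s assume s: "s \<in> spec_rates q (u ^ m)"
      obtain C where C: "\<And>j. q ((u ^ m) ^ j) \<le> C * s ^ j"
        using spec_rates_constant[OF q s] by blast
      have s0: "0 < s" using spec_rates_pos[OF q s] .
      show "\<rho> ^ m \<le> s"
      proof (rule ccontr)
        assume "\<not> \<rho> ^ m \<le> s"
        then have "1 < \<rho> ^ m / s" using s0 by simp
        then obtain j where j: "C < (\<rho> ^ m / s) ^ j" using real_arch_pow by blast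
        have "(\<rho> ^ m) ^ j \<le> C * s ^ j"
          using C[of j] qu[of "m * j"] by (simp add: power_mult)
        then have "(\<rho> ^ m / s) ^ j \<le> C" using s0 by (simp add: power_divide divide_le_eq)
        with j show False by simp
      qed
    qed
  qed
  have pow: "q (a ^ n) = q a ^ n" if "0 < n" for a n
  proof (rule antisym)
    show "q (a ^ n) \<le> q a ^ n" using power_le[OF q, of a "n - 1"] that by simp
    show "q a ^ n \<le> q (a ^ n)"
    proof -
      have "q a \<le> root n (q (a ^ n)) + e" if "0 < e" for e
      proof -
        have "root n (q (a ^ n)) + e \<in> spec_rates q a"
        proof (rule spec_rates_power[OF q \<open>0 < n\<close>])
          have r: "0 \<le> root n (q (a ^ n))" using nonneg[OF q] by (simp add: real_root_ge_zero)
          then show "0 < root n (q (a ^ n)) + e" using that by simp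
          have "q (a ^ n) = root n (q (a ^ n)) ^ n"
            using \<open>0 < n\<close> nonneg[OF q] by simp
          also have "\<dots> \<le> (root n (q (a ^ n)) + e) ^ n"
            using r that by (intro power_mono) auto
          finally show "q (a ^ n) \<le> (root n (q (a ^ n)) + e) ^ n" .
        qed
        from spec_rad_le[OF q this] show ?thesis by (simp add: \<open>spec_rad q = q\<close>)
      qed
      then have "q a \<le> root n (q (a ^ n))" by (rule field_le_epsilon)
      then have "q a ^ n \<le> root n (q (a ^ n)) ^ n" using nonneg[OF q] by (intro power_mono) auto
      then show ?thesis using \<open>0 < n\<close> nonneg[OF q] by simp
    qed
  qed
  \<comment> \<open>Squaring leaves 0 and 1 as possible values of q 1, and the lower bound at m = 0
    excludes 0.\<close>
  have one: "q 1 = 1"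
    using pow[of 2 1] qu[of 0] by (simp add: power2_eq_square)
  have pow: "q (a ^ n) = q a ^ n" for a n
    using pow[of n a] one by (cases "n = 0") auto
  have u1: "\<rho> \<le> q u" using qu[of 1] by simp
  with \<rho> have qu0: "0 < q u" by simp
  have loc_mult: "q (b * a) = q b * q a" if "0 < q a" "localised q a = q" for a b
    using localised_le[OF q that(1), of b 1] that submult[OF q, of b a]
    by (simp add: divide_simps mult.commute)
  \<comment> \<open>Localising at u comes first: once multiplication by u is known to scale q,
    localising at an arbitrary a keeps the lower bound on the powers of u.\<close>
  have "localised q u = q"
  proof (rule minimal'[OF alg_seminorm_localised[OF q qu0] localised_le_seminorm[OF q qu0]])
    fix m
    have "q (u ^ m * u ^ j) / q u ^ j = q u ^ m" for j
      using qu0 by (simp add: power_add[symmetric] pow) (simp add: power_add)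
    then show "\<rho> ^ m \<le> localised q u (u ^ m)"
      by (intro localised_geI[OF q qu0]) (use u1 \<rho> in \<open>auto intro: power_mono\<close>)
  qed
  then have mult_u: "q (b * u) = q b * q u" for b by (rule loc_mult[OF qu0])
  have mult_u_pow: "q (b * u ^ m) = q b * q u ^ m" for b m
    using mult_u[of "b * u ^ _"] by (induction m) (simp_all add: mult_ac)
  have mult: "q (b * a) = q b * q a" for a b
  proof (cases "q a = 0")
    case True
    then show ?thesis using submult[OF q, of b a] nonneg[OF q, of "b * a"] by simp
  next
    case False
    then have a: "0 < q a" using nonneg[OF q, of a] by simp
    have "localised q a = q"
    proof (rule minimal'[OF alg_seminorm_localised[OF q a] localised_le_seminorm[OF q a]])
      fix m
      have "q (u ^ m * a ^ j) / q a ^ j = q u ^ m" for j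
        using a mult_u_pow[of "a ^ j" m] by (simp add: pow mult.commute)
      then show "\<rho> ^ m \<le> localised q a (u ^ m)"
        by (intro localised_geI[OF q a]) (use u1 \<rho> in \<open>auto intro: power_mono\<close>)
    qed
    then show ?thesis by (rule loc_mult[OF a])
  qed
  \<comment> \<open>The scalar congruent to a modulo the null ideal of q. It is unique because q is
    the modulus on scalars, and uniqueness gives additivity and multiplicativity.\<close>
  obtain h where h: "\<And>a. q (a - \<iota> (h a)) = 0"
    using multiplicative_scalar[OF q mult one] by metis
  have uniq: "z = h a" if "q (a - \<iota> z) = 0" for a z
  proof -
    have "cmod (h a - z) = q (\<iota> (h a - z))" using scale[OF q, of _ 1] one by simp
    also have "\<dots> = q ((a - \<iota> z) - (a - \<iota> (h a)))" by (simp add: \<iota>_diff)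
    also have "\<dots> \<le> 0" using triangle_diff[OF q, of "a - \<iota> z" "a - \<iota> (h a)"] that h by simp
    finally show ?thesis by simp
  qed
  have modulus: "cmod (h a) = q a" for a
  proof -
    have "cmod (h a) = q (\<iota> (h a))" using scale[OF q, of _ 1] one by simp
    then show ?thesis
      using triangle_rev[OF q, of a "\<iota> (h a)"] triangle_rev[OF q, of "\<iota> (h a)" a]
        minus[OF q, of "a - \<iota> (h a)"] h[of a] by simp
  qed
  have "h (a + b) = h a + h b" for a b
  proof (rule uniq[symmetric])
    have "q ((a - \<iota> (h a)) + (b - \<iota> (h b))) \<le> 0" using triangle[OF q] h by (metis add.right_neutral)
    then show "q (a + b - \<iota> (h a + h b)) = 0"
      using nonneg[OF q] by (simp add: \<iota>_add algebra_simps antisym)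
  qed
  moreover have "h (a * b) = h a * h b" for a b
  proof (rule uniq[symmetric])
    have "a * b - \<iota> (h a * h b) = (a - \<iota> (h a)) * b + \<iota> (h a) * (b - \<iota> (h b))"
      by (simp add: \<iota>_mult algebra_simps)
    then have "q (a * b - \<iota> (h a * h b)) \<le> 0"
      using triangle[OF q, of "(a - \<iota> (h a)) * b" "\<iota> (h a) * (b - \<iota> (h b))"] by (simp add: mult h)
    then show "q (a * b - \<iota> (h a * h b)) = 0" using nonneg[OF q] by (simp add: antisym)
  qed
  moreover have "h (\<iota> c) = c" for c
    by (rule uniq[symmetric]) (simp add: zero[OF q])
  moreover have "cmod (h a) \<le> q0 a" for a using le0 by (simp add: modulus le_fun_def)
  moreover have "\<rho> \<le> cmod (h u)" using u1 by (simp add: modulus)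
  ultimately show ?thesis by blast
qed

end

section \<open>Gauges of multiplicative generating sets\<close>

context complex_algebra
begin

text \<open>Modulo J, f is a finite linear combination of elements of G whose coefficients have
  total modulus at most r. The slack in both rules makes r an upper bound, so the relation is
  monotone in r.\<close>

inductive combination :: "'r set \<Rightarrow> 'r set \<Rightarrow> 'r \<Rightarrow> real \<Rightarrow> bool" for G J where
  ideal: "f \<in> J \<Longrightarrow> 0 \<le> r \<Longrightarrow> combination G J f r"
| step: "g \<in> G \<Longrightarrow> combination G J f r \<Longrightarrow> cmod c + r \<le> s \<Longrightarrow> combination G J (\<iota> c * g + f) s"

text \<open>The Minkowski gauge of the absolutely convex hull of G, taken modulo J.\<close>

definition gauge :: "'r set \<Rightarrow> 'r set \<Rightarrow> 'r \<Rightarrow> real" where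
  "gauge G J f = Inf {r. combination G J f r}"

lemma combination_nonneg: "combination G J f r \<Longrightarrow> 0 \<le> r"
proof (induction rule: combination.induct)
  case (step g f r c s)
  then show ?case using norm_ge_zero[of c] by linarith
qed

lemma combination_mono:
  assumes "combination G J f r" "r \<le> s" shows "combination G J f s"
  using assms(1)
proof cases
  case ideal
  then show ?thesis using assms(2) by (intro combination.ideal) auto
next
  case (step g f' r' c)
  then show ?thesis using combination.step[of g G J f' r' c s] assms(2) by simp
qed

definition is_ideal :: "'r set \<Rightarrow> bool" where
  "is_ideal J \<longleftrightarrow> 0 \<in> J \<and> (\<forall>f\<in>J. \<forall>g\<in>J. f + g \<in> J) \<and> (\<forall>f\<in>J. \<forall>g. g * f \<in> J)"

context
  fixes G J :: "'r set"
  assumes J: "is_ideal J"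
begin

lemma J0: "0 \<in> J" and J_add: "f \<in> J \<Longrightarrow> g \<in> J \<Longrightarrow> f + g \<in> J"
  and J_mult: "f \<in> J \<Longrightarrow> g * f \<in> J"
  using J unfolding is_ideal_def by simp_all

lemma combination_generator: "g \<in> G \<Longrightarrow> combination G J g 1"
  using combination.step[of g G J 0 0 1 1] combination.ideal[OF J0] by (simp add: \<iota>_1)

lemma combination_add_ideal:
  assumes "combination G J f r" "j \<in> J" shows "combination G J (j + f) r"
  using assms(1)
proof (induction rule: combination.induct)
  case (ideal f r)
  then show ?case using assms(2) by (intro combination.ideal J_add)
next
  case (step g f r c s)
  from combination.step[OF step(1,4,3)] show ?case by (simp add: add.left_commute)
qed

lemma combination_add:
  assumes "combination G J f r" "combination G J f' r'" shows "combination G J (f + f') (r + r')"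
  using assms
proof (induction rule: combination.induct)
  case (ideal f r)
  have "combination G J (f + f') r'" by (rule combination_add_ideal[OF ideal(3,1)])
  then show ?case by (rule combination_mono) (use ideal in simp)
next
  case (step g f r c s)
  then have "combination G J (\<iota> c * g + (f + f')) (s + r')"
    by (intro combination.step[of g G J "f + f'" "r + r'"]) auto
  then show ?case by (simp add: add.assoc)
qed

lemma combination_scale: "combination G J f r \<Longrightarrow> combination G J (\<iota> z * f) (cmod z * r)"
proof (induction rule: combination.induct)
  case (ideal f r) then show ?case by (intro combination.ideal J_mult) auto
next
  case (step g f r c s)
  have "combination G J (\<iota> (z * c) * g + \<iota> z * f) (cmod z * s)"
    by (rule combination.step[OF step(1,4)])
      (use mult_left_mono[OF step(3), of "cmod z"] in \<open>simp add: norm_mult distrib_left\<close>)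
  then show ?case by (simp add: \<iota>_mult distrib_left mult.assoc)
qed

lemma combination_sum:
  assumes "\<And>i. i \<in> A \<Longrightarrow> combination G J (f i) (r i)"
  shows "combination G J (\<Sum>i\<in>A. f i) (\<Sum>i\<in>A. r i)"
  using assms
  by (induction A rule: infinite_finite_induct)
    (auto intro: combination_add combination.ideal[OF J0])

context
  assumes "\<forall>g\<in>G. \<forall>h\<in>G. combination G J (g * h) 1"
begin

lemma G_mult: "g \<in> G \<Longrightarrow> h \<in> G \<Longrightarrow> combination G J (g * h) 1"
  using \<open>\<forall>g\<in>G. \<forall>h\<in>G. combination G J (g * h) 1\<close> by simp

lemma combination_mult_generator:
  assumes "combination G J f r" "h \<in> G" shows "combination G J (h * f) r"
  using assms
proof (induction rule: combination.induct)
  case (ideal f r) then show ?case by (intro combination.ideal J_mult) auto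
next
  case (step g f r c s)
  have "combination G J (\<iota> c * (h * g) + h * f) (cmod c * 1 + r)"
    by (intro combination_add combination_scale G_mult step)
  then show ?case using step(3) combination_mono[of G J _ "cmod c * 1 + r" s] by (simp add: distrib_left mult.left_commute)
qed

lemma combination_mult:
  assumes "combination G J f r" "combination G J f' r'" shows "combination G J (f * f') (r * r')"
  using assms
proof (induction rule: combination.induct)
  case (ideal f r)
  then have "f' * f \<in> J" by (intro J_mult)
  then show ?case
    using ideal combination_nonneg[OF ideal(3)]
    by (intro combination.ideal) (auto simp: mult.commute)
next
  case (step g f r c s)
  have "combination G J (\<iota> c * (g * f') + f * f') (cmod c * r' + r * r')"
    by (intro combination_add combination_scale combination_mult_generator step)
  then have "combination G J ((\<iota> c * g + f) * f') ((cmod c + r) * r')"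
    by (simp add: distrib_right mult.assoc)
  then show ?case
    by (rule combination_mono) (intro mult_right_mono step combination_nonneg[OF step(5)])
qed

context
  assumes span: "\<forall>f. \<exists>r. combination G J f r"
begin

lemma gauge_le: "combination G J f r \<Longrightarrow> gauge G J f \<le> r"
  unfolding gauge_def
  by (rule cInf_lower) (auto dest: combination_nonneg intro!: bdd_belowI[of _ 0])

lemma combination_gauge: "gauge G J f < r \<Longrightarrow> combination G J f r"
  unfolding gauge_def
  using cInf_lessD[of "{r. combination G J f r}" r] spec[OF span, of f] combination_mono[of G J f _ r]
  by fastforce

lemma alg_seminorm_gauge: "alg_seminorm (gauge G J)"
  unfolding alg_seminorm_def
proof (intro conjI allI)
  fix f g :: 'r and c
  show nn: "0 \<le> gauge G J f" for f
    unfolding gauge_def by (rule cInf_greatest) (use span combination_nonneg in auto)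
  have approx: "combination G J f (gauge G J f + e)" if "0 < e" for f e
    using that by (intro combination_gauge) simp
  show "gauge G J (f + g) \<le> gauge G J f + gauge G J g"
  proof (rule field_le_epsilon)
    fix e :: real assume "0 < e"
    then show "gauge G J (f + g) \<le> gauge G J f + gauge G J g + e"
      using gauge_le[OF combination_add[OF approx approx, of "e / 2" "e / 2" f g]] by simp
  qed
  have lim: "((\<lambda>e. c * (gauge G J f + e)) \<longlongrightarrow> c * (gauge G J f + 0)) (at_right 0)" for c
    by (intro tendsto_intros)
  have ev: "eventually P (at_right (0::real))" if "\<And>e. 0 < e \<Longrightarrow> P e" for P
    using that by (auto intro: eventually_mono[OF eventually_at_right_less])
  show "gauge G J (f * g) \<le> gauge G J f * gauge G J g"
  proof -
    have "((\<lambda>e. (gauge G J f + e) * (gauge G J g + e)) \<longlongrightarrow> (gauge G J f + 0) * (gauge G J g + 0)) (at_right 0)"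
      by (intro tendsto_intros)
    from tendsto_lowerbound[OF this ev] show ?thesis
      using gauge_le[OF combination_mult[OF approx approx]] by simp
  qed
  show "gauge G J (\<iota> c * f) \<le> cmod c * gauge G J f"
    using tendsto_lowerbound[OF lim ev, of "gauge G J (\<iota> c * f)" "cmod c"]
      gauge_le[OF combination_scale[OF approx]] by simp
qed

text \<open>If every u ^ m had gauge at least \<rho> ^ m, \<open>character_exists\<close> would give
  a character bounded by 1 on G with |h u| \<ge> \<rho>. So some power has smaller gauge, and by
  \<open>power_growth\<close> one such exponent controls all of them.\<close>

theorem combination_power_bound:
  assumes \<rho>: "0 < \<rho>"
    and chars: "\<And>h. (\<And>a b. h (a + b) = h a + h b) \<Longrightarrow> (\<And>a b. h (a * b) = h a * h b) \<Longrightarrow>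
      (\<And>c. h (\<iota> c) = c) \<Longrightarrow> (\<And>g. g \<in> G \<Longrightarrow> cmod (h g) \<le> 1) \<Longrightarrow> cmod (h u) < \<rho>"
  shows "\<exists>C. \<forall>m. combination G J (u ^ m) (C * \<rho> ^ m)"
proof -
  note q = alg_seminorm_gauge
  have "\<exists>m. gauge G J (u ^ m) < \<rho> ^ m"
  proof (rule ccontr)
    assume "\<not> ?thesis"
    then have "\<rho> ^ m \<le> gauge G J (u ^ m)" for m by (simp add: not_less)
    from character_exists[OF q \<rho> this] obtain h where
      h: "\<And>a b. h (a + b) = h a + h b" "\<And>a b. h (a * b) = h a * h b" "\<And>c. h (\<iota> c) = c"
      "\<And>a. cmod (h a) \<le> gauge G J a" "\<rho> \<le> cmod (h u)" by blast
    have "cmod (h g) \<le> 1" if "g \<in> G" for g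
      using h(4)[of g] gauge_le[OF combination_generator[OF that]] by simp
    with chars[of h] h(1-3,5) show False by (metis not_le)
  qed
  then obtain m where m: "gauge G J (u ^ m) < \<rho> ^ m" by blast
  have "\<exists>n>0. gauge G J (u ^ n) \<le> \<rho> ^ n"
  \<comment> \<open>Exponent 0 says nothing about u directly, but a gauge of 1 below 1 must be 0 by
    submultiplicativity, and then the gauge of u is 0 too.\<close>
  proof (cases "m = 0")
    case True
    with m have "gauge G J 1 < 1" by simp
    moreover have "gauge G J 1 \<le> gauge G J 1 * gauge G J 1" using submult[OF q, of 1 1] by simp
    ultimately have "gauge G J 1 = 0"
      using nonneg[OF q, of 1] by (simp add: mult_le_cancel_left1)
    then have "gauge G J u = 0" using submult[OF q, of 1 u] nonneg[OF q, of u] by simp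
    then show ?thesis using \<rho> by (intro exI[of _ 1]) simp
  qed (use m in \<open>auto intro: exI[of _ m]\<close>)
  then obtain n where n: "0 < n" "gauge G J (u ^ n) \<le> \<rho> ^ n" by blast
  from power_growth[OF q n \<rho>] obtain C where C: "\<And>m. gauge G J (u ^ m) \<le> C * \<rho> ^ m" by blast
  \<comment> \<open>The infimum need not be attained; the extra 1 makes the bound strict, so an
    actual combination exists.\<close>
  have "gauge G J (u ^ m) < (C + 1) * \<rho> ^ m" for m
    using C[of m] \<rho> by (simp add: distrib_right order_le_less_trans)
  then show ?thesis by (intro exI[of _ "C + 1"] allI combination_gauge)
qed

end
end
end

end

section \<open>The weights k^k / k! and averaging over roots of unity\<close>

definition power_coeff :: "nat \<Rightarrow> real" where
  "power_coeff k = real k ^ k / fact k"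

text \<open>An elementary form of Stirling's lower bound. The induction step is 1 - x \<le> exp (-
  x) at x = 1 / (l + 1), raised to the power l + 1; the polynomial loss is harmless for exponential
  rates.\<close>

lemma power_coeff_ge: "0 < l \<Longrightarrow> exp (real l) \<le> exp 1 * real l * power_coeff l"
proof (induction l rule: nat_induct_non_zero)
  case 1
  show ?case by (simp add: power_coeff_def)
next
  case (Suc l)
  have "1 - 1 / real (Suc l) \<le> exp (- (1 / real (Suc l)))"
    using exp_ge_add_one_self[of "- (1 / real (Suc l))"] by simp
  then have "real l / real (Suc l) \<le> exp (- (1 / real (Suc l)))"
    by (simp add: field_simps)
  then have "(real l / real (Suc l)) ^ Suc l \<le> exp (- (1 / real (Suc l))) ^ Suc l"
    by (intro power_mono) auto
  also have "\<dots> = exp (- 1)"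
    by (simp flip: exp_of_nat_mult del: of_nat_Suc power_Suc)
  finally have "exp 1 * real l ^ Suc l \<le> real (Suc l) ^ Suc l"
    by (simp add: power_divide exp_minus field_simps del: of_nat_Suc power_Suc)
  then have "exp 1 * (real l ^ Suc l / fact l) \<le> real (Suc l) ^ Suc l / fact l"
    by (simp add: divide_right_mono del: of_nat_Suc power_Suc)
  also have "real (Suc l) ^ Suc l / fact l = real (Suc l) * power_coeff (Suc l)"
    by (simp add: power_coeff_def del: of_nat_Suc)
  also have "real l ^ Suc l / fact l = real l * power_coeff l"
    by (simp add: power_coeff_def)
  finally have *: "exp 1 * (real l * power_coeff l) \<le> real (Suc l) * power_coeff (Suc l)" .
  have "exp (real (Suc l)) = exp 1 * exp (real l)" by (simp add: exp_add)
  also have "\<dots> \<le> exp 1 * (exp 1 * (real l * power_coeff l))"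
    using Suc.IH by (simp add: mult.assoc)
  also have "\<dots> \<le> exp 1 * (real (Suc l) * power_coeff (Suc l))"
    using * by simp
  finally show ?case by (simp only: mult.assoc)
qed

lemma power_coeff_nonneg: "0 \<le> power_coeff k"
  by (simp add: power_coeff_def)

lemma power_coeff_le: "power_coeff k \<le> exp (real k)"
proof -
  have "(\<Sum>n\<in>{k}. real k ^ n /\<^sub>R fact n) \<le> suminf (\<lambda>n. real k ^ n /\<^sub>R fact n)"
    by (rule sum_le_suminf[OF summable_exp_generic]) auto
  then show ?thesis by (simp add: power_coeff_def exp_def divide_inverse mult.commute)
qed

text \<open>The source of the radius 1/e: the weight is at least e^(l-1) / l, so it outgrows every
  geometric decay slower than e^(-l).\<close>

lemma power_coeff_unbounded:
  assumes "exp (- 1) < x" shows "\<exists>l. 1 < power_coeff l * x ^ l"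
proof -
  have y: "1 < exp 1 * x" using assms by (simp add: exp_minus field_simps)
  have "(\<lambda>n. of_nat n / (exp 1 * x) ^ n) \<longlonglongrightarrow> 0"
    by (rule lim_n_over_pown) (use y in simp)
  then have "eventually (\<lambda>n. real n / (exp 1 * x) ^ n < exp (- 1)) sequentially"
    by (rule order_tendstoD) simp
  then have "eventually (\<lambda>n. real n / (exp 1 * x) ^ n < exp (- 1) \<and> 0 < n) sequentially"
    using eventually_gt_at_top[of 0] by (rule eventually_conj)
  then obtain l where l: "real l / (exp 1 * x) ^ l < exp (- 1)" "0 < l"
    by (auto dest: eventually_happens)
  have x: "0 < x" using assms order_less_trans[OF exp_gt_zero] by blast
  have "real l < exp (- 1) * (exp 1 * x) ^ l"
    using l(1) x by (simp add: pos_divide_less_eq)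
  also have "(exp 1 * x) ^ l = exp (real l) * x ^ l"
    by (simp add: power_mult_distrib flip: exp_of_nat_mult)
  finally have "exp 1 * real l < exp (real l) * x ^ l"
    by (simp add: exp_minus field_simps)
  also have "\<dots> \<le> (exp 1 * real l * power_coeff l) * x ^ l"
    using power_coeff_ge[OF l(2)] x by (intro mult_right_mono) auto
  finally have "exp 1 * real l * 1 < exp 1 * real l * (power_coeff l * x ^ l)" by (simp add: mult.assoc)
  then show ?thesis using l(2) by (subst (asm) mult_less_cancel_left_pos) auto
qed

definition root_of_unity :: "nat \<Rightarrow> nat \<Rightarrow> complex" where
  "root_of_unity n i = cis (2 * pi * real i / real n)"

lemma norm_root_of_unity [simp]: "cmod (root_of_unity n i) = 1"
  by (simp add: root_of_unity_def)

lemma sum_root_of_unity: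
  assumes "a < n" "b < n"
  shows "(\<Sum>i<n. root_of_unity n i ^ a * cnj (root_of_unity n i) ^ b) = (if a = b then of_nat n else 0)"
proof (cases "a = b")
  case True
  have "root_of_unity n i ^ a * cnj (root_of_unity n i) ^ a = 1" for i
    by (simp add: power_mult_distrib[symmetric] complex_norm_square[symmetric])
  then show ?thesis using True by simp
next
  case False
  define w where "w = root_of_unity n a * cnj (root_of_unity n b)"
  have eq: "root_of_unity n i ^ a * cnj (root_of_unity n i) ^ b = w ^ i" for i
    by (simp add: w_def root_of_unity_def cis_cnj DeMoivre cis_mult algebra_simps power_mult_distrib)
  have inj: "inj_on (root_of_unity n) {..<n}"
    using bij_betw_roots_unity[of n] assms by (simp add: bij_betw_def root_of_unity_def[abs_def])
  have "w \<noteq> 1"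
  proof
    assume "w = 1"
    then have "root_of_unity n a * (cnj (root_of_unity n b) * root_of_unity n b) = root_of_unity n b"
      by (simp add: w_def flip: mult.assoc)
    then have "root_of_unity n a = root_of_unity n b"
      by (simp add: mult.commute[of "cnj _"] complex_norm_square[symmetric])
    with inj assms False show False by (auto dest: inj_onD)
  qed
  moreover have "root_of_unity n i ^ n = 1" if "i < n" for i
    using bij_betwE[OF bij_betw_roots_unity[of n], rule_format, of i] that by (simp add: root_of_unity_def)
  then have "w ^ n = 1"
    using assms by (simp add: w_def power_mult_distrib flip: complex_cnj_power)
  ultimately show ?thesis using False by (simp add: eq geometric_sum)
qed

text \<open>The identity that dictates the weights. What multiplies
  \<open>power_coeff (a + b)\<close> is the coefficient of z^a w^b in (s z + t w)^(a+b) for s =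
  a/(a+b) and t = b/(a+b).\<close>

lemma power_coeff_binomial:
  assumes "0 < a + b"
  shows "power_coeff a * power_coeff b = power_coeff (a + b) * real ((a + b) choose b) *
    (real a / real (a + b)) ^ a * (real b / real (a + b)) ^ b"
proof -
  have "real ((a + b) choose b) = fact (a + b) / (fact b * fact a)"
    using binomial_fact[of b "a + b", where 'a = real] by simp
  moreover have "real (a + b) ^ (a + b) \<noteq> 0" using assms by (simp del: of_nat_add)
  ultimately show ?thesis
    by (simp add: power_coeff_def power_divide power_add del: of_nat_add)
qed

text \<open>Averaging against the conjugate b-th powers of the roots of unity selects the term of
  degree b in w; k + 1 roots are taken since this degree runs over 0, ..., k. The averaging
  coefficients have total modulus 1, and by \<open>power_coeff_binomial\<close> no further factor
  appears.\<close>

lemma (in complex_algebra) power_mult_average: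
  assumes "0 < a + b"
  defines "k \<equiv> a + b" and "s \<equiv> complex_of_real (real a / real (a + b))"
    and "t \<equiv> complex_of_real (real b / real (a + b))"
  shows "\<iota> (power_coeff a * power_coeff b) * (z ^ a * w ^ b) =
    (\<Sum>i<Suc k. \<iota> (cnj (root_of_unity (Suc k) i) ^ b / of_nat (Suc k)) *
      (\<iota> (power_coeff k) * (\<iota> s * z + \<iota> (t * root_of_unity (Suc k) i) * w) ^ k))"
proof -
  let ?\<theta> = "root_of_unity (Suc k)" and ?n = "of_nat (Suc k) :: complex"
  have binom: "(\<iota> s * z + \<iota> (t * ?\<theta> i) * w) ^ k =
      (\<Sum>j\<le>k. \<iota> (of_nat (k choose j) * s ^ (k - j) * t ^ j * ?\<theta> i ^ j) * (z ^ (k - j) * w ^ j))" for i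
    unfolding add.commute[of "\<iota> s * z"] binomial_ring
    by (simp add: power_mult_distrib \<iota>_mult \<iota>_power \<iota>_of_nat mult_ac)
  have collect: "\<iota> x * (\<iota> p * (\<iota> y * v)) = \<iota> (x * p * y) * v" for x p y v
    by (simp add: \<iota>_mult mult.assoc)
  have "(\<Sum>i<Suc k. \<iota> (cnj (?\<theta> i) ^ b / ?n) *
      (\<iota> (power_coeff k) * (\<iota> s * z + \<iota> (t * ?\<theta> i) * w) ^ k)) =
    (\<Sum>i<Suc k. \<Sum>j\<le>k. \<iota> (power_coeff k / ?n * of_nat (k choose j) * s ^ (k - j) * t ^ j *
      (?\<theta> i ^ j * cnj (?\<theta> i) ^ b)) * (z ^ (k - j) * w ^ j))"
    unfolding binom sum_distrib_left
    unfolding collect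
    by (intro sum.cong refl, rule arg_cong2[where f = "\<lambda>c v. \<iota> c * v"])
      (simp_all add: divide_inverse mult_ac del: of_nat_Suc)
  also have "\<dots> = (\<Sum>j\<le>k. \<Sum>i<Suc k. \<iota> (power_coeff k / ?n * of_nat (k choose j) * s ^ (k - j) * t ^ j *
      (?\<theta> i ^ j * cnj (?\<theta> i) ^ b)) * (z ^ (k - j) * w ^ j))"
    by (rule sum.swap)
  also have "\<dots> = (\<Sum>j\<le>k. \<iota> (power_coeff k / ?n * of_nat (k choose j) * s ^ (k - j) * t ^ j *
      (\<Sum>i<Suc k. ?\<theta> i ^ j * cnj (?\<theta> i) ^ b)) * (z ^ (k - j) * w ^ j))"
    by (simp only: sum_distrib_right[symmetric] \<iota>_sum[symmetric] sum_distrib_left[symmetric])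
  also have "\<dots> = (\<Sum>j\<le>k. if j = b then \<iota> (power_coeff k * of_nat (k choose b) * s ^ a * t ^ b) *
      (z ^ a * w ^ b) else 0)"
    by (rule sum.cong)
      (use sum_root_of_unity[of _ "Suc k" b] in \<open>auto simp: k_def \<iota>_0 simp del: sum.lessThan_Suc of_nat_Suc\<close>)
  also have "\<dots> = \<iota> (power_coeff k * of_nat (k choose b) * s ^ a * t ^ b) * (z ^ a * w ^ b)"
    by (simp add: k_def)
  also have "power_coeff k * of_nat (k choose b) * s ^ a * t ^ b = complex_of_real (power_coeff a * power_coeff b)"
    unfolding power_coeff_binomial[OF assms(1)] by (simp add: k_def s_def t_def)
  finally show ?thesis by simp
qed

section \<open>Products in the symmetric algebra\<close>

lemma multilinear_add: "multilinear m \<Longrightarrow> m (xs @ (x + y) # ys) = m (xs @ x # ys) + m (xs @ y # ys)"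
  and multilinear_scale: "multilinear m \<Longrightarrow> m (xs @ (c *\<^sub>C x) # ys) = c *\<^sub>C m (xs @ x # ys)"
  by (simp_all add: multilinear_def)

lemma multilinear_sprod: "multilinear sprod"
  by (simp add: multilinear_def sprod.abs_eq plus_sym_alg.abs_eq scaleC_sym_alg.abs_eq
      multilinear_add[OF multilinear_tprod] multilinear_scale[OF multilinear_tprod])

lemma symmetric_sprod: "symmetric_map sprod"
  unfolding symmetric_map_def
  by (intro allI, transfer, rule cvec.span_base) (auto simp: sym_relations_def)

lemma symmetric_map_move:
  assumes "symmetric_map m" shows "m (zs @ as @ x # bs) = m (zs @ x # as @ bs)"
proof (induction as arbitrary: zs)
  case (Cons a as)
  have "m (zs @ (a # as) @ x # bs) = m ((zs @ [a]) @ as @ x # bs)" by simp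
  also have "\<dots> = m ((zs @ [a]) @ x # as @ bs)" by (rule Cons)
  also have "\<dots> = m (zs @ x # a # as @ bs)"
    using assms by (simp add: symmetric_map_def)
  finally show ?case by simp
qed simp

lemma symmetric_map_mset:
  assumes m: "symmetric_map m" and "mset xs = mset ys" shows "m (zs @ xs) = m (zs @ ys)"
  using assms(2)
proof (induction xs arbitrary: zs ys)
  case (Cons x xs)
  then have "x \<in> set ys" by (metis list.set_intros(1) mset_eq_setD)
  then obtain as bs where ys: "ys = as @ x # bs" by (meson split_list)
  with Cons.prems have "mset xs = mset (as @ bs)" by simp
  from Cons.IH[OF this, of "zs @ [x]"] show ?case
    by (simp add: ys symmetric_map_move[OF m])
qed simp

lemma multilinear_sum:
  assumes "multilinear m"
  shows "m (xs @ (\<Sum>i\<in>A. c i *\<^sub>C x i) # ys) = (\<Sum>i\<in>A. c i *\<^sub>C m (xs @ x i # ys))"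
proof -
  have "clinear (\<lambda>x. m (xs @ x # ys))"
    by (rule clinearI) (simp_all add: multilinear_add[OF assms] multilinear_scale[OF assms])
  then interpret Vector_Spaces.linear scaleC scaleC "\<lambda>x. m (xs @ x # ys)" .
  show ?thesis by (simp add: sum scale)
qed

text \<open>Monomials of the polynomial ring below are indexed by multisets; the chosen ordering is
  immaterial because \<open>sprod\<close> is symmetric.\<close>

definition sprod_mset :: "'v::complex_vec multiset \<Rightarrow> 'v sym_alg" where
  "sprod_mset M = sprod (SOME xs. mset xs = M)"

lemma sprod_mset [simp]: "sprod_mset (mset xs) = sprod xs"
proof -
  have "mset (SOME ys. mset ys = mset xs) = mset xs" by (rule someI) (rule refl)
  from symmetric_map_mset[OF symmetric_sprod this, of "[]"] show ?thesis
    by (simp add: sprod_mset_def)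
qed

text \<open>Polarisation: the coefficient of \<open>t\<close> in \<open>(v + t w)\<^sup>j zs\<close> is \<open>j v\<^sup>j\<^sup>-\<^sup>1 w zs\<close>.\<close>

lemma sprod_expand_power:
  fixes v w :: "'v::complex_vec"
  shows "\<exists>p. (\<forall>t. sprod (replicate j (v + t *\<^sub>C w) @ zs) = (\<Sum>i\<le>j. t ^ i *\<^sub>C p i)) \<and>
    p 0 = sprod (replicate j v @ zs) \<and>
    (0 < j \<longrightarrow> p 1 = of_nat j *\<^sub>C sprod (replicate (j - 1) v @ w # zs))"
proof (induction j arbitrary: zs)
  case 0
  show ?case by (intro exI[of _ "\<lambda>_. sprod zs"]) simp
next
  case (Suc j)
  note swap = symmetric_map_mset[OF symmetric_sprod, of _ _ "[]", simplified]
  obtain p where p: "\<And>t. sprod (replicate j (v + t *\<^sub>C w) @ v # zs) = (\<Sum>i\<le>j. t ^ i *\<^sub>C p i)"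
    "p 0 = sprod (replicate j v @ v # zs)"
    "0 < j \<longrightarrow> p 1 = of_nat j *\<^sub>C sprod (replicate (j - 1) v @ w # v # zs)"
    using Suc[of "v # zs"] by metis
  obtain r where r: "\<And>t. sprod (replicate j (v + t *\<^sub>C w) @ w # zs) = (\<Sum>i\<le>j. t ^ i *\<^sub>C r i)"
    "r 0 = sprod (replicate j v @ w # zs)"
    using Suc[of "w # zs"] by metis
  \<comment> \<open>The contribution of v has degree j in t, that of t w is shifted by one; padding
    with 0 brings both to degree j + 1.\<close>
  define p' where "p' i = (if i \<le> j then p i else 0)" for i
  define s where "s i = p' i + (case i of 0 \<Rightarrow> 0 | Suc i' \<Rightarrow> r i')" for i
  have "sprod (replicate (Suc j) (v + t *\<^sub>C w) @ zs) = (\<Sum>i\<le>Suc j. t ^ i *\<^sub>C s i)" for t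
  proof -
    have "sprod (replicate (Suc j) (v + t *\<^sub>C w) @ zs) = sprod (replicate j (v + t *\<^sub>C w) @ (v + t *\<^sub>C w) # zs)"
      by (rule swap) simp
    also have "\<dots> = (\<Sum>i\<le>j. t ^ i *\<^sub>C p i) + t *\<^sub>C (\<Sum>i\<le>j. t ^ i *\<^sub>C r i)"
      by (simp add: multilinear_add[OF multilinear_sprod] multilinear_scale[OF multilinear_sprod] p r)
    also have "(\<Sum>i\<le>j. t ^ i *\<^sub>C p i) = (\<Sum>i\<le>Suc j. t ^ i *\<^sub>C p' i)"
      by (simp add: p'_def)
    also have "t *\<^sub>C (\<Sum>i\<le>j. t ^ i *\<^sub>C r i) = (\<Sum>i\<le>Suc j. t ^ i *\<^sub>C (case i of 0 \<Rightarrow> 0 | Suc i' \<Rightarrow> r i'))"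
      by (simp add: sum.atMost_Suc_shift cvec.scale_sum_right del: sum.atMost_Suc)
    finally show ?thesis by (simp add: s_def sum.distrib cvec.scale_right_distrib del: sum.atMost_Suc)
  qed
  moreover have "s 0 = sprod (replicate (Suc j) v @ zs)"
    by (simp add: s_def p'_def p(2)) (rule swap, simp)
  moreover have "s 1 = of_nat (Suc j) *\<^sub>C sprod (replicate j v @ w # zs)"
  proof (cases j)
    case 0 then show ?thesis by (simp add: s_def p'_def r)
  next
    case (Suc j')
    have "sprod (replicate (j - 1) v @ w # v # zs) = sprod (replicate j v @ w # zs)"
      by (rule swap) (simp add: Suc)
    then have "s 1 = (of_nat j + 1) *\<^sub>C sprod (replicate j v @ w # zs)"
      using p(3) Suc by (simp add: s_def p'_def r cvec.scale_left_distrib del: of_nat_Suc)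
    then show ?thesis by (simp add: add.commute)
  qed
  ultimately show ?case by (intro exI[of _ s]) simp
qed

text \<open>Discrete Fourier inversion: the values at n + 1 roots of unity recover every coefficient
  as a finite linear combination.\<close>

lemma subspace_coefficient:
  assumes W: "cvec.subspace W" and mem: "\<And>t. (\<Sum>i\<le>n. t ^ i *\<^sub>C p i) \<in> W" and "b \<le> n"
  shows "p b \<in> W"
proof -
  let ?\<theta> = "root_of_unity (Suc n)"
  have "(\<Sum>j<Suc n. cnj (?\<theta> j) ^ b *\<^sub>C (\<Sum>i\<le>n. ?\<theta> j ^ i *\<^sub>C p i)) \<in> W"
    by (intro cvec.subspace_sum[OF W] cvec.subspace_scale[OF W] mem)
  also have "(\<Sum>j<Suc n. cnj (?\<theta> j) ^ b *\<^sub>C (\<Sum>i\<le>n. ?\<theta> j ^ i *\<^sub>C p i)) =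
      (\<Sum>i\<le>n. \<Sum>j<Suc n. (?\<theta> j ^ i * cnj (?\<theta> j) ^ b) *\<^sub>C p i)"
    unfolding cvec.scale_sum_right
    by (subst sum.swap) (simp add: scaleC_scaleC mult.commute del: sum.lessThan_Suc)
  also have "\<dots> = (\<Sum>i\<le>n. if i = b then of_nat (Suc n) *\<^sub>C p b else 0)"
    unfolding cvec.scale_sum_left[symmetric]
    by (rule sum.cong) (use sum_root_of_unity[of _ "Suc n" b] assms(3) in \<open>auto simp del: sum.lessThan_Suc\<close>)
  also have "\<dots> = of_nat (Suc n) *\<^sub>C p b" using assms(3) by simp
  finally have "of_nat (Suc n) *\<^sub>C p b \<in> W" .
  from cvec.subspace_scale[OF W this, of "1 / of_nat (Suc n)"] show ?thesis
    by (simp add: scaleC_scaleC scaleC_one del: of_nat_Suc)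
qed

text \<open>Induction on the number of factors outside the block of equal ones: the coefficient of t
  in (v + t w)^(j+1) ws is (j+1) v^j w ws, so a product with one more free factor lies in the span
  of products with fewer.\<close>

lemma span_pure_powers:
  "sym_power k = cvec.span (range (\<lambda>v. sprod (replicate k v)))" (is "_ = ?W")
proof
  have "sprod (replicate j v @ zs) \<in> ?W" if "j + length zs = k" for j v and zs :: "'a list"
    using that
  proof (induction "length zs" arbitrary: j v zs)
    case 0 then show ?case by (auto intro: cvec.span_base)
  next
    case (Suc n)
    then obtain w ws where zs: "zs = w # ws" by (cases zs) auto
    obtain p where p: "\<And>t. sprod (replicate (Suc j) (v + t *\<^sub>C w) @ ws) = (\<Sum>i\<le>Suc j. t ^ i *\<^sub>C p i)"
      "p 1 = of_nat (Suc j) *\<^sub>C sprod (replicate j v @ w # ws)"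
      using sprod_expand_power[where j = "Suc j" and v = v and w = w and zs = ws] by auto
    have "p 1 \<in> ?W"
      by (rule subspace_coefficient[where n = "Suc j"], rule cvec.subspace_span, fold p(1), rule Suc.hyps(1))
        (use Suc zs in auto)
    then have "(1 / of_nat (Suc j)) *\<^sub>C p 1 \<in> ?W" by (rule cvec.span_scale)
    then show ?case unfolding p(2) zs by (simp add: scaleC_scaleC scaleC_one del: of_nat_Suc)
  qed
  from this[of 0] show "sym_power k \<subseteq> ?W"
    unfolding sym_power_def by (intro cvec.span_minimal cvec.subspace_span) auto
  show "?W \<subseteq> sym_power k"
    unfolding sym_power_def
    by (rule cvec.span_mono) (auto intro: exI[of _ "replicate k _"])
qed

text \<open>Polynomials in variables x_b and y_b: a monomial is a pair of multisets, and adding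
  multisets multiplies monomials. For b in a basis this is Sym of V tensored with Sym of its dual;
  allowing every vector as an index keeps the basis out of the type.\<close>

type_synonym 'v bipoly = "('v multiset \<times> 'v multiset) \<Rightarrow>\<^sub>0 complex"

definition const :: "complex \<Rightarrow> 'v bipoly" where
  "const c = Poly_Mapping.single 0 c"

interpretation bipoly: complex_algebra "const :: complex \<Rightarrow> 'v bipoly"
  by unfold_locales (simp_all add: const_def single_add mult_single)

lemma const_mult: "const c * f = c *\<^sub>C f"
  unfolding const_def mult_map_scale_conv_mult[symmetric] by transfer (auto simp: when_def)

section \<open>Finite dimensional normed spaces and tensor norms\<close>

lemma dual_norm_le:
  assumes A: "cvec.subspace A" and N0: "N 0 = 0" and \<phi>: "\<And>x. x \<in> A \<Longrightarrow> cmod (\<phi> x) \<le> C * N x"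
    and C: "0 \<le> C"
  shows "dual_norm A N \<phi> \<le> C"
  unfolding dual_norm_def
proof (rule cSup_least)
  show "{cmod (\<phi> x) |x. x \<in> A \<and> N x \<le> 1} \<noteq> {}"
    using cvec.subspace_0[OF A] N0 by force
  fix r assume "r \<in> {cmod (\<phi> x) |x. x \<in> A \<and> N x \<le> 1}"
  then obtain x where x: "x \<in> A" "N x \<le> 1" "r = cmod (\<phi> x)" by blast
  show "r \<le> C" using \<phi>[OF x(1)] mult_left_mono[OF x(2) C] x(3) by simp
qed

text \<open>The hypothesis with C makes the supremum in \<open>dual_norm\<close> one over a bounded
  set; rescaling x to norm 1 does the rest.\<close>

lemma dual_norm_bound:
  assumes A: "cvec.subspace A" and lin: "clinear \<phi>"
    and nonneg: "\<And>x. x \<in> A \<Longrightarrow> 0 \<le> N x" and scale: "\<And>c x. x \<in> A \<Longrightarrow> N (c *\<^sub>C x) = cmod c * N x"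
    and \<phi>: "\<And>x. x \<in> A \<Longrightarrow> cmod (\<phi> x) \<le> C * N x" and x: "x \<in> A"
  shows "cmod (\<phi> x) \<le> dual_norm A N \<phi> * N x"
proof (cases "N x = 0")
  case True then show ?thesis using \<phi>[OF x] by simp
next
  case False
  with nonneg[OF x] have Nx: "0 < N x" by simp
  let ?y = "complex_of_real (1 / N x) *\<^sub>C x"
  have y: "?y \<in> A" by (rule cvec.subspace_scale[OF A x])
  have "cmod (\<phi> ?y) \<le> dual_norm A N \<phi>"
    unfolding dual_norm_def
  proof (rule cSup_upper)
    show "cmod (\<phi> ?y) \<in> {cmod (\<phi> x) |x. x \<in> A \<and> N x \<le> 1}"
      using y Nx scale[OF x, of "complex_of_real (1 / N x)"] by (auto simp: norm_divide)
    show "bdd_above {cmod (\<phi> x) |x. x \<in> A \<and> N x \<le> 1}"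
    proof (rule bdd_aboveI[of _ "\<bar>C\<bar>"])
      fix r assume "r \<in> {cmod (\<phi> x) |x. x \<in> A \<and> N x \<le> 1}"
      then obtain z where z: "z \<in> A" "N z \<le> 1" "r = cmod (\<phi> z)" by blast
      have "C * N z \<le> \<bar>C\<bar> * N z" using nonneg[OF z(1)] by (intro mult_right_mono) auto
      also have "\<dots> \<le> \<bar>C\<bar> * 1" by (rule mult_left_mono[OF z(2)]) simp
      finally show "r \<le> \<bar>C\<bar>" using \<phi>[OF z(1)] z(3) by simp
    qed
  qed
  then show ?thesis using Nx by (simp add: cvec.linear_scale[OF lin] norm_mult norm_divide divide_le_eq)
qed

lemma tensor_power_subspace: "cvec.subspace (tensor_power k)"
  unfolding tensor_power_def by (rule cvec.subspace_span)

lemma tprod_in_tensor_power: "tprod xs \<in> tensor_power (length xs)"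
  unfolding tensor_power_def by (rule cvec.span_base) auto

lemma linear_tensor_snoc_right: "clinear (tensor_snoc f)"
proof (rule clinearI)
  fix x y :: 'a and c
  have lin: "clinear (\<lambda>f. tensor_snoc f x + tensor_snoc f y)" "clinear (\<lambda>f. c *\<^sub>C tensor_snoc f x)"
    by (rule clinearI; simp add: cvec.linear_add[OF clinear_tensor_snoc]
        cvec.linear_scale[OF clinear_tensor_snoc] add_ac cvec.scale_right_distrib scaleC_scaleC mult.commute)+
  show "tensor_snoc f (x + y) = tensor_snoc f x + tensor_snoc f y"
    by (rule cvec.linear_eq_on[OF clinear_tensor_snoc lin(1), of f "range tprod"])
      (auto simp: span_tprod tensor_snoc_tprod multilinear_add[OF multilinear_tprod])
  show "tensor_snoc f (c *\<^sub>C x) = c *\<^sub>C tensor_snoc f x"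
    by (rule cvec.linear_eq_on[OF clinear_tensor_snoc lin(2), of f "range tprod"])
      (auto simp: span_tprod tensor_snoc_tprod multilinear_scale[OF multilinear_tprod])
qed

lemma tensor_power_Suc_decomposition:
  assumes "f \<in> tensor_power (Suc k)"
  shows "\<exists>ps. set ps \<subseteq> tensor_power k \<times> UNIV \<and> f = (\<Sum>(x, y)\<leftarrow>ps. tensor_snoc x y)"
  using assms unfolding tensor_power_def[of "Suc k"]
proof (induction rule: cvec.span_induct_alt)
  case base
  show ?case by (intro exI[of _ "[]"]) simp
next
  case (step c g f)
  then obtain ps where ps: "set ps \<subseteq> tensor_power k \<times> UNIV" "f = (\<Sum>(x, y)\<leftarrow>ps. tensor_snoc x y)"
    by blast
  obtain xs where xs: "g = tprod xs" "length xs = Suc k" using step(1) by blast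
  obtain ys y where ys: "xs = ys @ [y]" "length ys = k"
    using xs(2) by (metis length_append_singleton nat.inject rev_exhaust length_0_conv Zero_not_Suc)
  show ?case
    using ps tprod_in_tensor_power[of ys] ys xs
    by (intro exI[of _ "(tprod ys, c *\<^sub>C y) # ps"])
      (auto simp: tensor_snoc_tprod multilinear_scale[OF multilinear_tprod])
qed

lemma tprod_degree1:
  assumes "f \<in> tensor_power (Suc 0)" shows "tprod [degree1 f] = f"
proof -
  have "clinear (\<lambda>f. tprod [degree1 f])"
    using multilinear_add[OF multilinear_tprod, of "[]" _ _ "[]"]
      multilinear_scale[OF multilinear_tprod, of "[]" _ _ "[]"]
    by (intro clinearI) (simp_all add: cvec.linear_add[OF clinear_degree1] cvec.linear_scale[OF clinear_degree1])
  then show ?thesis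
    by (rule cvec.linear_eq_on[OF _ cvec.linear_id[unfolded id_def]])
      (use assms in \<open>auto simp: tensor_power_def degree1_tprod length_Suc_conv\<close>)
qed

lemma clinear_compose: "clinear f \<Longrightarrow> clinear g \<Longrightarrow> clinear (\<lambda>x. g (f x))"
  using Vector_Spaces.linear_compose[of scaleC scaleC f scaleC g] by (simp only: comp_def)

lemma linear_tprod_singleton: "clinear (\<lambda>v. tprod [v])"
  using multilinear_add[OF multilinear_tprod, of "[]" _ _ "[]"]
    multilinear_scale[OF multilinear_tprod, of "[]" _ _ "[]"]
  by (intro clinearI) simp_all

text \<open>\<open>injective_norm\<close> tests only functionals of dual norm exactly 1. A nonzero
  functional dominated by M has dual norm a in (0, 1], and dividing by a can only enlarge its
  values.\<close>

lemma dual_norm_normalise: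
  assumes A: "cvec.subspace A" and lin: "clinear \<phi>" and M0: "\<And>x. x \<in> A \<Longrightarrow> 0 \<le> M x"
    and Ms: "\<And>c x. x \<in> A \<Longrightarrow> M (c *\<^sub>C x) = cmod c * M x"
    and le: "\<And>x. x \<in> A \<Longrightarrow> cmod (\<phi> x) \<le> M x" and x: "x \<in> A" "\<phi> x \<noteq> 0"
  defines "a \<equiv> dual_norm A M \<phi>"
  shows "0 < a" "a \<le> 1" "clinear (\<lambda>y. complex_of_real (inverse a) * \<phi> y)"
    "dual_norm A M (\<lambda>y. complex_of_real (inverse a) * \<phi> y) = 1"
proof -
  have M_0: "M 0 = 0" using Ms[OF cvec.subspace_0[OF A], of 0] by simp
  have bound: "cmod (\<phi> y) \<le> a * M y" if "y \<in> A" for y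
    unfolding a_def using dual_norm_bound[OF A lin M0 Ms, of 1 y] le that by simp
  show a1: "a \<le> 1" unfolding a_def using dual_norm_le[where N = M and \<phi> = \<phi> and C = 1, OF A M_0] le by simp
  have "0 < cmod (\<phi> x)" using x by simp
  with bound[OF x(1)] have "0 < a * M x" by linarith
  with M0[OF x(1)] show a0: "0 < a" by (simp add: zero_less_mult_iff)
  let ?\<psi> = "\<lambda>y. complex_of_real (inverse a) * \<phi> y"
  show lin': "clinear ?\<psi>"
    using cvec.linear_add[OF lin] cvec.linear_scale[OF lin] by (intro clinearI) (simp_all add: distrib_left)
  have norm: "cmod (?\<psi> y) = inverse a * cmod (\<phi> y)" for y
    unfolding norm_mult norm_of_real using a0 by simp
  have le': "cmod (?\<psi> y) \<le> 1 * M y" if "y \<in> A" for y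
    unfolding norm using bound[OF that] a0 by (simp add: field_simps)
  have "dual_norm A M ?\<psi> \<le> 1" using dual_norm_le[where N = M and \<phi> = ?\<psi> and C = 1, OF A M_0] le' by simp
  moreover have "a \<le> a * dual_norm A M ?\<psi>"
  proof -
    have bound': "inverse a * cmod (\<phi> y) \<le> dual_norm A M ?\<psi> * M y" if "y \<in> A" for y
      using dual_norm_bound[OF A lin' M0 Ms le' that] unfolding norm by blast
    have "0 < inverse a * cmod (\<phi> x)" using a0 x by simp
    also have "\<dots> \<le> dual_norm A M ?\<psi> * M x" by (rule bound'[OF x(1)])
    finally have "0 \<le> a * dual_norm A M ?\<psi>"
      using M0[OF x(1)] a0 by (simp add: zero_less_mult_iff)
    moreover have "cmod (\<phi> y) \<le> a * dual_norm A M ?\<psi> * M y" if "y \<in> A" for y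
      using bound'[OF that] a0 by (simp add: field_simps)
    ultimately show ?thesis
      using dual_norm_le[where N = M and \<phi> = \<phi> and C = "a * dual_norm A M ?\<psi>", OF A M_0]
      by (simp add: a_def)
  qed
  ultimately show "dual_norm A M ?\<psi> = 1" using a0 by simp
qed

section \<open>Finite dimensional normed spaces: coordinates and functionals are bounded\<close>

locale fd_normed =
  fixes N :: "'v::complex_vec \<Rightarrow> real" and B :: "'v set"
  assumes fd: "finite_dimensional_vector_space (scaleC :: complex \<Rightarrow> 'v \<Rightarrow> 'v) B"
    and norm: "is_norm N"
begin

lemma finite_B: "finite B" and independent_B: "cvec.independent B" and span_B: "cvec.span B = UNIV"
  using fd by (auto simp: finite_dimensional_vector_space_def finite_dimensional_vector_space_axioms_def)

lemma N_nonneg [simp]: "0 \<le> N x" and N_eq_0 [simp]: "N x = 0 \<longleftrightarrow> x = 0"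
  and N_triangle: "N (x + y) \<le> N x + N y" and N_scale: "N (c *\<^sub>C x) = cmod c * N x"
  using norm unfolding is_norm_def by simp_all

lemma N_0 [simp]: "N 0 = 0"
  by simp

lemma N_minus: "N (- x) = N x"
  using N_scale[of "- 1" x] by (simp add: scaleC_one)

lemma N_sum: "N (\<Sum>i\<in>A. f i) \<le> (\<Sum>i\<in>A. N (f i))"
  by (induction A rule: infinite_finite_induct) (auto intro: order_trans[OF N_triangle])

abbreviation coord :: "'v \<Rightarrow> 'v \<Rightarrow> complex" where
  "coord b v \<equiv> cvec.representation B v b"

lemma linear_coord: "clinear (coord b)"
  by (rule clinearI)
    (simp_all add: cvec.representation_add[OF independent_B] cvec.representation_scale[OF independent_B] span_B)

lemma sum_coord: "(\<Sum>b\<in>B. coord b v *\<^sub>C b) = v"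
  using cvec.sum_representation_eq[OF independent_B _ finite_B order_refl, of v] by (simp add: span_B)

lemma coord_outside: "b \<notin> B \<Longrightarrow> coord b v = 0"
  using cvec.representation_ne_zero by blast

lemma linear_coord_expansion: "clinear \<phi> \<Longrightarrow> \<phi> v = (\<Sum>b\<in>B. coord b v *\<^sub>C \<phi> b)"
  using sum_coord[of v] by (metis (no_types, lifting) cvec.linear_sum cvec.linear_scale sum.cong)

text \<open>Otherwise a sequence in the span of S approaches a. Its coordinates are Cauchy by the
  bound C, hence converge, and their limits express a in the span.\<close>

lemma distance_to_span_pos:
  assumes S: "finite S" and C: "\<And>f s. s \<in> S \<Longrightarrow> cmod (f s) \<le> C * N (\<Sum>s\<in>S. f s *\<^sub>C s)"
    and a: "a \<notin> cvec.span S"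
  shows "\<exists>d>0. \<forall>f. d \<le> N (a - (\<Sum>s\<in>S. f s *\<^sub>C s))"
proof (rule ccontr)
  assume "\<not> ?thesis"
  then have "\<exists>f. N (a - (\<Sum>s\<in>S. f s *\<^sub>C s)) < inverse (real (Suc n))" for n
    by (meson inverse_positive_iff_positive not_le of_nat_0_less_iff zero_less_Suc)
  then obtain f where f: "\<And>n. N (a - (\<Sum>s\<in>S. f n s *\<^sub>C s)) < inverse (real (Suc n))"
    by metis
  let ?y = "\<lambda>n. \<Sum>s\<in>S. f n s *\<^sub>C s"
  have "\<exists>L. (\<lambda>n. f n s) \<longlonglongrightarrow> L" if s: "s \<in> S" for s
  proof -
    have C0: "0 \<le> \<bar>C\<bar>" by simp
    have diff: "cmod (f n s - f m s) \<le> \<bar>C\<bar> * (inverse (real (Suc n)) + inverse (real (Suc m)))" for n m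
    proof -
      have "cmod (f n s - f m s) \<le> C * N (?y n - ?y m)"
        using C[OF s, of "\<lambda>s. f n s - f m s"] by (simp add: cvec.scale_left_diff_distrib sum_subtractf)
      also have "\<dots> \<le> \<bar>C\<bar> * N (?y n - ?y m)" by (intro mult_right_mono) auto
      also have "N (?y n - ?y m) \<le> N (a - ?y n) + N (a - ?y m)"
        using N_triangle[of "a - ?y m" "- (a - ?y n)"] N_minus[of "a - ?y n"] by simp
      then have "\<bar>C\<bar> * N (?y n - ?y m) \<le> \<bar>C\<bar> * (inverse (real (Suc n)) + inverse (real (Suc m)))"
        using f[of n] f[of m] by (intro mult_left_mono) auto
      finally show ?thesis .
    qed
    have "Cauchy (\<lambda>n. f n s)"
    proof (rule CauchyI)
      fix e :: real assume e: "0 < e"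
      obtain M where M: "inverse (real (Suc M)) < e / (2 * \<bar>C\<bar> + 1)"
        using reals_Archimedean[of "e / (2 * \<bar>C\<bar> + 1)"] e by auto
      have "cmod (f m s - f n s) < e" if "M \<le> m" "M \<le> n" for m n
      proof -
        have "inverse (real (Suc m)) \<le> inverse (real (Suc M))" "inverse (real (Suc n)) \<le> inverse (real (Suc M))"
          using that by (auto simp: divide_simps)
        then have "cmod (f m s - f n s) \<le> \<bar>C\<bar> * (inverse (real (Suc M)) + inverse (real (Suc M)))"
          by (intro order_trans[OF diff] mult_left_mono add_mono) auto
        also have "\<dots> = 2 * \<bar>C\<bar> * inverse (real (Suc M))" by simp
        also have "\<dots> \<le> (2 * \<bar>C\<bar> + 1) * inverse (real (Suc M))" by (intro mult_right_mono) auto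
        also have "\<dots> < e" using M by (simp add: field_simps add_nonneg_pos)
        finally show ?thesis .
      qed
      then show "\<exists>M. \<forall>m\<ge>M. \<forall>n\<ge>M. cmod (f m s - f n s) < e" by blast
    qed
    then show ?thesis using Cauchy_convergent_iff convergent_def by blast
  qed
  then obtain g where g: "\<And>s. s \<in> S \<Longrightarrow> (\<lambda>n. f n s) \<longlonglongrightarrow> g s" by metis
  let ?z = "\<Sum>s\<in>S. g s *\<^sub>C s"
  have "N (a - ?z) \<le> inverse (real (Suc n)) + (\<Sum>s\<in>S. cmod (f n s - g s) * N s)" for n
  proof -
    have "N (a - ?z) \<le> N (a - ?y n) + N (?y n - ?z)"
      using N_triangle[of "a - ?y n" "?y n - ?z"] by simp
    also have "?y n - ?z = (\<Sum>s\<in>S. (f n s - g s) *\<^sub>C s)"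
      by (simp add: cvec.scale_left_diff_distrib sum_subtractf)
    also have "N \<dots> \<le> (\<Sum>s\<in>S. cmod (f n s - g s) * N s)"
      using N_sum[of "\<lambda>s. (f n s - g s) *\<^sub>C s" S] by (simp add: N_scale)
    finally show ?thesis using f[of n] by simp
  qed
  moreover have "(\<lambda>n. inverse (real (Suc n)) + (\<Sum>s\<in>S. cmod (f n s - g s) * N s)) \<longlonglongrightarrow>
      0 + (\<Sum>s\<in>S. cmod (g s - g s) * N s)"
    by (intro tendsto_intros g LIMSEQ_inverse_real_of_nat)
  ultimately have "N (a - ?z) \<le> 0"
    using LIMSEQ_le_const[of _ "0 + (\<Sum>s\<in>S. cmod (g s - g s) * N s)" "N (a - ?z)"] by auto
  then have "a = ?z" using N_nonneg[of "a - ?z"] by (metis N_eq_0 antisym eq_iff_diff_eq_0)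
  then show False
    using a by (metis (no_types, lifting) cvec.span_base cvec.span_scale cvec.span_sum)
qed

lemma coordinates_bounded:
  assumes "finite S" "cvec.independent S"
  shows "\<exists>C. \<forall>f. \<forall>s\<in>S. cmod (f s) \<le> C * N (\<Sum>s\<in>S. f s *\<^sub>C s)"
  using assms
proof (induction S rule: finite_induct)
  case (insert a S)
  from insert have ind: "cvec.independent S" and a: "a \<notin> cvec.span S"
    by (auto simp: cvec.independent_insert)
  from insert.IH[OF ind] obtain C where C: "\<And>f s. s \<in> S \<Longrightarrow> cmod (f s) \<le> C * N (\<Sum>s\<in>S. f s *\<^sub>C s)"
    by blast
  obtain d where d: "0 < d" "\<And>f. d \<le> N (a - (\<Sum>s\<in>S. f s *\<^sub>C s))"
    using distance_to_span_pos[OF insert.hyps(1) C a] by blast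
  \<comment> \<open>The coefficient at a is at most N x / d by the distance d, so the part of x in
    the span of S has norm at most (1 + N a / d) * N x, and C bounds its coordinates. The summand 1
    / d below covers the coordinate at a.\<close>
  define D where "D = \<bar>C\<bar> * (1 + N a / d)"
  have "cmod (f s) \<le> (D + 1 / d) * N (\<Sum>s\<in>insert a S. f s *\<^sub>C s)" if s: "s \<in> insert a S" for f s
  proof -
    let ?y = "\<Sum>s\<in>S. f s *\<^sub>C s"
    let ?x = "f a *\<^sub>C a + ?y"
    have fa: "cmod (f a) \<le> N ?x / d"
    proof (cases "f a = 0")
      case False
      have "f a *\<^sub>C (a - (\<Sum>s\<in>S. (- f s / f a) *\<^sub>C s)) = ?x"
        using False by (simp add: cvec.scale_right_distrib cvec.scale_sum_right scaleC_scaleC sum_negf)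
      then have "N ?x = cmod (f a) * N (a - (\<Sum>s\<in>S. (- f s / f a) *\<^sub>C s))" by (metis N_scale)
      moreover have "cmod (f a) * d \<le> cmod (f a) * N (a - (\<Sum>s\<in>S. (- f s / f a) *\<^sub>C s))"
        by (intro mult_left_mono d norm_ge_zero)
      ultimately show ?thesis using d(1) by (simp add: le_divide_eq)
    qed (use d in simp)
    have x: "(\<Sum>s\<in>insert a S. f s *\<^sub>C s) = ?x" using insert.hyps by simp
    have D: "0 \<le> D" using d by (simp add: D_def)
    show ?thesis
    proof (cases "s = a")
      case True
      have "cmod (f a) \<le> (1 / d) * N ?x" using fa by simp
      also have "\<dots> \<le> (D + 1 / d) * N ?x" using D by (intro mult_right_mono) auto
      finally show ?thesis unfolding x using True by simp
    next
      case False
      with s have s: "s \<in> S" by simp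
      have "N ?y \<le> N ?x + cmod (f a) * N a"
        using N_triangle[of ?x "- (f a *\<^sub>C a)"] by (simp add: N_minus N_scale)
      also have "\<dots> \<le> N ?x + N ?x / d * N a" using fa by (intro add_left_mono mult_right_mono) auto
      finally have "N ?y \<le> (1 + N a / d) * N ?x" by (simp add: algebra_simps)
      from mult_left_mono[OF this, of "\<bar>C\<bar>"] have "\<bar>C\<bar> * N ?y \<le> D * N ?x"
        by (simp add: D_def mult.assoc)
      moreover have "C * N ?y \<le> \<bar>C\<bar> * N ?y" by (intro mult_right_mono) auto
      moreover have "D * N ?x \<le> (D + 1 / d) * N ?x" using d by (intro mult_right_mono) auto
      ultimately show ?thesis unfolding x using C[OF s, of f] by linarith
    qed
  qed
  then show ?case by blast
qed simp

lemma functional_bounded: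
  assumes "clinear \<phi>" shows "\<exists>C\<ge>0. \<forall>x. cmod (\<phi> x) \<le> C * N x"
proof -
  obtain C where C: "\<And>f s. s \<in> B \<Longrightarrow> cmod (f s) \<le> C * N (\<Sum>s\<in>B. f s *\<^sub>C s)"
    using coordinates_bounded[OF finite_B independent_B] by blast
  have "cmod (\<phi> x) \<le> (\<Sum>b\<in>B. \<bar>C\<bar> * cmod (\<phi> b)) * N x" for x
  proof -
    have "cmod (\<phi> x) \<le> (\<Sum>b\<in>B. cmod (coord b x) * cmod (\<phi> b))"
      unfolding linear_coord_expansion[OF assms, of x]
      by (rule order_trans[OF norm_sum]) (simp add: norm_mult)
    also have "\<dots> \<le> (\<Sum>b\<in>B. (\<bar>C\<bar> * N x) * cmod (\<phi> b))"
    proof (intro sum_mono mult_right_mono norm_ge_zero)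
      fix b assume "b \<in> B"
      have "cmod (coord b x) \<le> C * N x" using C[OF \<open>b \<in> B\<close>, of "\<lambda>b. coord b x"] by (simp add: sum_coord)
      also have "\<dots> \<le> \<bar>C\<bar> * N x" by (intro mult_right_mono) auto
      finally show "cmod (coord b x) \<le> \<bar>C\<bar> * N x" .
    qed
    also have "\<dots> = (\<Sum>b\<in>B. \<bar>C\<bar> * cmod (\<phi> b)) * N x"
      by (simp add: sum_distrib_right sum_distrib_left mult_ac)
    finally show ?thesis .
  qed
  then show ?thesis by (intro exI[of _ "\<Sum>b\<in>B. \<bar>C\<bar> * cmod (\<phi> b)"]) (auto intro!: sum_nonneg)
qed

section \<open>Functionals of norm at most 1 and their tensor products\<close>

definition short_functional :: "('v \<Rightarrow> complex) \<Rightarrow> bool" where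
  "short_functional \<phi> \<longleftrightarrow> clinear \<phi> \<and> (\<forall>x. cmod (\<phi> x) \<le> N x)"

lemma dual_norm_UNIV_bound: "clinear \<phi> \<Longrightarrow> cmod (\<phi> x) \<le> dual_norm UNIV N \<phi> * N x"
  using functional_bounded[of \<phi>] dual_norm_bound[of UNIV \<phi> N _ x]
  by (auto simp: N_scale cvec.subspace_UNIV)

lemma short_functional_iff: "short_functional \<phi> \<longleftrightarrow> clinear \<phi> \<and> dual_norm UNIV N \<phi> \<le> 1"
proof safe
  assume \<phi>: "short_functional \<phi>"
  then show "clinear \<phi>" "dual_norm UNIV N \<phi> \<le> 1"
    using dual_norm_le[of UNIV N \<phi> 1] by (auto simp: short_functional_def cvec.subspace_UNIV)
next
  assume "clinear \<phi>" "dual_norm UNIV N \<phi> \<le> 1"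
  then show "short_functional \<phi>"
    unfolding short_functional_def
    using dual_norm_UNIV_bound[of \<phi>] mult_right_mono[of "dual_norm UNIV N \<phi>" 1 "N _"]
    by (auto intro: order_trans)
qed

text \<open>Pure tensors of short functionals, built by the same recursion as the norms and
  therefore starting in degree 1. With all factors equal they compute
  \<open>sym_eval\<close>.\<close>

inductive product_functional :: "nat \<Rightarrow> ('v tensor \<Rightarrow> complex) \<Rightarrow> bool" where
  degree1: "short_functional \<phi> \<Longrightarrow> product_functional (Suc 0) (\<lambda>f. \<phi> (degree1 f))"
| snoc: "product_functional k \<eta> \<Longrightarrow> short_functional \<psi> \<Longrightarrow> clinear \<theta> \<Longrightarrow>
    (\<And>f v. \<theta> (tensor_snoc f v) = \<eta> f * \<psi> v) \<Longrightarrow> product_functional (Suc k) \<theta>"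

lemma product_functional_linear: "product_functional k \<theta> \<Longrightarrow> clinear \<theta>"
proof (induction rule: product_functional.induct)
  case (degree1 \<phi>)
  then show ?case
    unfolding short_functional_def by (intro clinear_compose[OF clinear_degree1]) blast
qed

inductive product_span :: "nat \<Rightarrow> ('v tensor \<Rightarrow> complex) \<Rightarrow> bool" where
  zero: "product_span k (\<lambda>_. 0)"
| add: "product_functional k \<eta> \<Longrightarrow> product_span k \<theta> \<Longrightarrow> product_span k (\<lambda>f. c * \<eta> f + \<theta> f)"

lemma product_span_linear: "product_span k \<theta> \<Longrightarrow> clinear \<theta>"
proof (induction rule: product_span.induct)
  case (add k \<eta> \<theta> c)
  then show ?case
    using cvec.linear_add[OF product_functional_linear[OF add(1)]]
      cvec.linear_scale[OF product_functional_linear[OF add(1)]]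
      cvec.linear_add[OF add.IH] cvec.linear_scale[OF add.IH]
    by (intro clinearI) (simp_all add: distrib_left)
qed (rule clinearI, simp_all)

lemma product_span_add:
  "product_span k \<theta> \<Longrightarrow> product_span k \<theta>' \<Longrightarrow> product_span k (\<lambda>f. \<theta> f + \<theta>' f)"
proof (induction rule: product_span.induct)
  case (add k \<eta> \<theta> c)
  from product_span.add[OF add(1) add.IH[OF add.prems], of c] show ?case
    by (simp add: add.assoc)
qed simp

lemma product_span_sum:
  "finite A \<Longrightarrow> (\<And>i. i \<in> A \<Longrightarrow> product_span k (\<theta> i)) \<Longrightarrow> product_span k (\<lambda>f. \<Sum>i\<in>A. \<theta> i f)"
  by (induction A rule: finite_induct) (simp_all add: product_span.zero product_span_add)

lemma bounded_functional_normalise: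
  assumes "clinear \<psi>"
  shows "\<exists>C \<psi>'. short_functional \<psi>' \<and> \<psi> = (\<lambda>v. complex_of_real C * \<psi>' v)"
proof -
  obtain C where C: "0 \<le> C" "\<And>x. cmod (\<psi> x) \<le> C * N x" using functional_bounded[OF assms] by blast
  \<comment> \<open>C may be 0, hence the division by C + 1.\<close>
  let ?\<psi> = "\<lambda>v. complex_of_real (inverse (C + 1)) * \<psi> v"
  have "cmod (?\<psi> x) \<le> N x" for x
  proof -
    have "cmod (\<psi> x) \<le> (C + 1) * N x"
      using C(2)[of x] by (simp add: distrib_right add_increasing2)
    then show ?thesis using C(1)
      unfolding norm_mult norm_of_real by (simp add: field_simps)
  qed
  moreover have "clinear ?\<psi>"
    by (rule clinearI) (simp_all add: cvec.linear_add[OF assms] cvec.linear_scale[OF assms] algebra_simps)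
  moreover have "\<psi> = (\<lambda>v. complex_of_real (C + 1) * ?\<psi> v)"
  proof
    fix v
    have "complex_of_real (C + 1) * complex_of_real (inverse (C + 1)) = 1"
      unfolding of_real_mult[symmetric] using C(1) by simp
    then show "\<psi> v = complex_of_real (C + 1) * ?\<psi> v" by (simp only: mult.assoc[symmetric] mult_1)
  qed
  ultimately show ?thesis unfolding short_functional_def by blast
qed

lemma product_span_snoc:
  assumes "product_span k \<theta>" "clinear \<psi>"
  shows "\<exists>\<theta>'. product_span (Suc k) \<theta>' \<and> (\<forall>f v. \<theta>' (tensor_snoc f v) = \<theta> f * \<psi> v)"
  using assms(1)
proof (induction rule: product_span.induct)
  case (zero k)
  show ?case by (intro exI[of _ "\<lambda>_. 0"]) (simp add: product_span.zero)
next
  case (add k \<eta> \<theta> c)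
  obtain C \<psi>' where \<psi>: "short_functional \<psi>'" "\<psi> = (\<lambda>v. complex_of_real C * \<psi>' v)"
    using bounded_functional_normalise[OF assms(2)] by blast
  obtain \<eta>' where \<eta>': "clinear \<eta>'" "\<And>f v. \<eta>' (tensor_snoc f v) = \<eta> f * \<psi>' v"
    using tensor_functional_exists[OF product_functional_linear[OF add(1)]] \<psi>(1)
    by (metis short_functional_def)
  have pf: "product_functional (Suc k) \<eta>'" by (rule product_functional.snoc[OF add(1) \<psi>(1) \<eta>'])
  obtain \<theta>' where \<theta>': "product_span (Suc k) \<theta>'" "\<And>f v. \<theta>' (tensor_snoc f v) = \<theta> f * \<psi> v"
    using add.IH by blast
  have "product_span (Suc k) (\<lambda>f. (c * C) * \<eta>' f + \<theta>' f)"
    by (rule product_span.add[OF pf \<theta>'(1)])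
  moreover have "(c * C) * \<eta>' (tensor_snoc f v) + \<theta>' (tensor_snoc f v) = (c * \<eta> f + \<theta> f) * \<psi> v" for f v
    by (simp add: \<eta>'(2) \<theta>'(2)) (simp add: \<psi>(2) algebra_simps)
  ultimately show ?case by blast
qed

lemma eq_on_tensor_power_Suc:
  assumes "clinear \<theta>" "clinear \<theta>'"
    and "\<And>f v. f \<in> tensor_power k \<Longrightarrow> \<theta> (tensor_snoc f v) = \<theta>' (tensor_snoc f v)"
    and f: "f \<in> tensor_power (Suc k)"
  shows "\<theta> f = \<theta>' f"
proof -
  obtain ps where ps: "set ps \<subseteq> tensor_power k \<times> UNIV" "f = (\<Sum>(x, y)\<leftarrow>ps. tensor_snoc x y)"
    using tensor_power_Suc_decomposition[OF f] by blast
  have "\<theta> (\<Sum>(x, y)\<leftarrow>ps. tensor_snoc x y) = \<theta>' (\<Sum>(x, y)\<leftarrow>ps. tensor_snoc x y)"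
    using ps(1) assms(3)
    by (induction ps) (auto simp: cvec.linear_add assms(1,2) cvec.linear_0[OF assms(1)] cvec.linear_0[OF assms(2)])
  then show ?thesis using ps by simp
qed

text \<open>Expanding the last slot in the basis B reduces to lower degree. The result lets every
  linear functional be bounded by the injective norm, so that the suprema in
  \<open>dual_norm\<close> are over bounded sets.\<close>

lemma product_span_exhausts:
  assumes "clinear \<theta>"
  shows "\<exists>\<theta>'. product_span (Suc k) \<theta>' \<and> (\<forall>f\<in>tensor_power (Suc k). \<theta> f = \<theta>' f)"
  using assms
proof (induction k arbitrary: \<theta>)
  case 0
  have lin: "clinear (\<lambda>v. \<theta> (tprod [v]))"
    by (rule clinear_compose[OF linear_tprod_singleton 0])
  obtain C \<psi>' where \<psi>: "short_functional \<psi>'" "(\<lambda>v. \<theta> (tprod [v])) = (\<lambda>v. complex_of_real C * \<psi>' v)"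
    using bounded_functional_normalise[OF lin] by blast
  from product_span.add[OF product_functional.degree1[OF \<psi>(1)] product_span.zero, of C]
  have "product_span (Suc 0) (\<lambda>f. C * \<psi>' (degree1 f))" by simp
  moreover have "\<theta> f = C * \<psi>' (degree1 f)" if "f \<in> tensor_power (Suc 0)" for f
    using fun_cong[OF \<psi>(2), of "degree1 f"] tprod_degree1[OF that] by simp
  ultimately show ?case by blast
next
  case (Suc k)
  have "\<exists>\<theta>'. product_span (Suc (Suc k)) \<theta>' \<and>
      (\<forall>f\<in>tensor_power (Suc k). \<forall>v. \<theta>' (tensor_snoc f v) = \<theta> (tensor_snoc f b) * coord b v)" for b
  proof -
    have "clinear (\<lambda>f. \<theta> (tensor_snoc f b))"
      by (rule clinear_compose[OF clinear_tensor_snoc Suc.prems])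
    from Suc.IH[OF this] obtain \<eta> where "product_span (Suc k) \<eta>"
      "\<forall>f\<in>tensor_power (Suc k). \<theta> (tensor_snoc f b) = \<eta> f" by blast
    with product_span_snoc[OF this(1) linear_coord[of b]] show ?thesis by metis
  qed
  then obtain \<theta>' where \<theta>': "\<And>b. product_span (Suc (Suc k)) (\<theta>' b)"
    "\<And>b f v. f \<in> tensor_power (Suc k) \<Longrightarrow> \<theta>' b (tensor_snoc f v) = \<theta> (tensor_snoc f b) * coord b v"
    by metis
  let ?\<theta> = "\<lambda>f. \<Sum>b\<in>B. \<theta>' b f"
  have sp: "product_span (Suc (Suc k)) ?\<theta>" by (rule product_span_sum[OF finite_B \<theta>'(1)])
  have "\<theta> f = ?\<theta> f" if "f \<in> tensor_power (Suc (Suc k))" for f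
  proof (rule eq_on_tensor_power_Suc[OF Suc.prems product_span_linear[OF sp] _ that])
    fix f :: "'v tensor" and v assume f: "f \<in> tensor_power (Suc k)"
    have "clinear (\<lambda>v. \<theta> (tensor_snoc f v))"
      by (rule clinear_compose[OF linear_tensor_snoc_right Suc.prems])
    from linear_coord_expansion[OF this, of v]
    show "\<theta> (tensor_snoc f v) = ?\<theta> (tensor_snoc f v)"
      by (simp add: \<theta>'(2)[OF f] mult.commute)
  qed
  with sp show ?case by blast
qed

section \<open>Projective norms in positive degree\<close>

lemma projective_power_nonneg: "f \<in> tensor_power (Suc k) \<Longrightarrow> 0 \<le> projective_power N (Suc k) f"
proof (induction k arbitrary: f)
  case (Suc k)
  show ?case
    unfolding projective_power.simps projective_norm_def
  proof (rule cInf_greatest)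
    show "{\<Sum>(x, y)\<leftarrow>ps. projective_power N (Suc k) x * N y | ps.
        set ps \<subseteq> tensor_power (Suc k) \<times> UNIV \<and> f = (\<Sum>(x, y)\<leftarrow>ps. tensor_snoc x y)} \<noteq> {}"
      using tensor_power_Suc_decomposition[OF Suc.prems] by blast
  qed (auto intro!: sum_list_nonneg mult_nonneg_nonneg Suc.IH)
qed simp

lemma projective_power_Suc_le:
  assumes "set ps \<subseteq> tensor_power (Suc k) \<times> UNIV" "f = (\<Sum>(x, y)\<leftarrow>ps. tensor_snoc x y)"
  shows "projective_power N (Suc (Suc k)) f \<le> (\<Sum>(x, y)\<leftarrow>ps. projective_power N (Suc k) x * N y)"
  unfolding projective_power.simps projective_norm_def
proof (rule cInf_lower)
  show "bdd_below {\<Sum>(x, y)\<leftarrow>ps. projective_power N (Suc k) x * N y | ps.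
        set ps \<subseteq> tensor_power (Suc k) \<times> UNIV \<and> f = (\<Sum>(x, y)\<leftarrow>ps. tensor_snoc x y)}"
    by (rule bdd_belowI[of _ 0]) (auto intro!: sum_list_nonneg mult_nonneg_nonneg projective_power_nonneg)
qed (use assms in blast)

lemma projective_power_Suc_approx:
  assumes "f \<in> tensor_power (Suc (Suc k))" "0 < e"
  shows "\<exists>ps. set ps \<subseteq> tensor_power (Suc k) \<times> UNIV \<and> f = (\<Sum>(x, y)\<leftarrow>ps. tensor_snoc x y) \<and>
    (\<Sum>(x, y)\<leftarrow>ps. projective_power N (Suc k) x * N y) < projective_power N (Suc (Suc k)) f + e"
proof -
  let ?S = "{\<Sum>(x, y)\<leftarrow>ps. projective_power N (Suc k) x * N y | ps.
        set ps \<subseteq> tensor_power (Suc k) \<times> UNIV \<and> f = (\<Sum>(x, y)\<leftarrow>ps. tensor_snoc x y)}"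
  have "?S \<noteq> {}" using tensor_power_Suc_decomposition[OF assms(1)] by blast
  moreover have "Inf ?S < projective_power N (Suc (Suc k)) f + e"
    using assms(2) unfolding projective_power.simps projective_norm_def by linarith
  ultimately have "\<exists>r\<in>?S. r < projective_power N (Suc (Suc k)) f + e" by (rule cInf_lessD)
  then show ?thesis by auto
qed

lemma projective_power_add:
  assumes "f \<in> tensor_power (Suc k)" "g \<in> tensor_power (Suc k)"
  shows "projective_power N (Suc k) (f + g) \<le> projective_power N (Suc k) f + projective_power N (Suc k) g"
proof (cases k)
  case 0
  then show ?thesis by (simp add: cvec.linear_add[OF clinear_degree1] N_triangle)
next
  case (Suc j)
  show ?thesis
  proof (rule field_le_epsilon)
    fix e :: real assume e: "0 < e"
    from projective_power_Suc_approx[OF assms(1)[unfolded Suc], of "e / 2"] e obtain ps where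
      ps: "set ps \<subseteq> tensor_power (Suc j) \<times> UNIV" "f = (\<Sum>(x, y)\<leftarrow>ps. tensor_snoc x y)"
        "(\<Sum>(x, y)\<leftarrow>ps. projective_power N (Suc j) x * N y) < projective_power N (Suc (Suc j)) f + e / 2"
      by auto
    from projective_power_Suc_approx[OF assms(2)[unfolded Suc], of "e / 2"] e obtain qs where
      qs: "set qs \<subseteq> tensor_power (Suc j) \<times> UNIV" "g = (\<Sum>(x, y)\<leftarrow>qs. tensor_snoc x y)"
        "(\<Sum>(x, y)\<leftarrow>qs. projective_power N (Suc j) x * N y) < projective_power N (Suc (Suc j)) g + e / 2"
      by auto
    have "projective_power N (Suc (Suc j)) (f + g) \<le>
        (\<Sum>(x, y)\<leftarrow>ps @ qs. projective_power N (Suc j) x * N y)"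
      by (rule projective_power_Suc_le) (use ps qs in auto)
    then show "projective_power N (Suc k) (f + g) \<le>
        projective_power N (Suc k) f + projective_power N (Suc k) g + e"
      using ps(3) qs(3) unfolding Suc map_append sum_list_append by linarith
  qed
qed

lemma projective_power_scale:
  assumes f: "f \<in> tensor_power (Suc k)"
  shows "projective_power N (Suc k) (c *\<^sub>C f) \<le> cmod c * projective_power N (Suc k) f"
proof (cases k)
  case 0
  then show ?thesis by (simp add: cvec.linear_scale[OF clinear_degree1] N_scale)
next
  case (Suc j)
  show ?thesis
  proof (rule field_le_epsilon)
    fix e :: real assume e: "0 < e"
    \<comment> \<open>The tolerance is divided by cmod c + 1 because c may be 0.\<close>
    have c: "0 < cmod c + 1" by (simp add: add_nonneg_pos)
    with e have "0 < e / (cmod c + 1)" by simp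
    from projective_power_Suc_approx[OF f[unfolded Suc] this] obtain ps where
      ps: "set ps \<subseteq> tensor_power (Suc j) \<times> UNIV" "f = (\<Sum>(x, y)\<leftarrow>ps. tensor_snoc x y)"
        "(\<Sum>(x, y)\<leftarrow>ps. projective_power N (Suc j) x * N y) <
          projective_power N (Suc (Suc j)) f + e / (cmod c + 1)"
      by auto
    let ?qs = "map (\<lambda>(x, y). (x, c *\<^sub>C y)) ps"
    have "c *\<^sub>C (\<Sum>(x, y)\<leftarrow>ps. tensor_snoc x y) = (\<Sum>(x, y)\<leftarrow>?qs. tensor_snoc x y)"
      by (induction ps) (auto simp: cvec.scale_right_distrib cvec.linear_scale[OF linear_tensor_snoc_right])
    moreover have "(\<Sum>(x, y)\<leftarrow>?qs. projective_power N (Suc j) x * N y) =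
        cmod c * (\<Sum>(x, y)\<leftarrow>ps. projective_power N (Suc j) x * N y)"
      by (induction ps) (auto simp: N_scale algebra_simps)
    ultimately have "projective_power N (Suc (Suc j)) (c *\<^sub>C f) \<le>
        cmod c * (\<Sum>(x, y)\<leftarrow>ps. projective_power N (Suc j) x * N y)"
      using projective_power_Suc_le[of ?qs j "c *\<^sub>C f"] ps(1,2) by fastforce
    also have "\<dots> \<le> cmod c * (projective_power N (Suc (Suc j)) f + e / (cmod c + 1))"
      using ps(3) by (intro mult_left_mono) auto
    also have "\<dots> \<le> cmod c * projective_power N (Suc (Suc j)) f + e"
      using e c by (simp add: distrib_left divide_le_eq mult.commute[of "cmod c" e] mult_left_mono)
    finally show "projective_power N (Suc k) (c *\<^sub>C f) \<le> cmod c * projective_power N (Suc k) f + e"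
      by (simp add: Suc)
  qed
qed

lemma projective_power_sum:
  assumes "finite A" "\<And>i. i \<in> A \<Longrightarrow> f i \<in> tensor_power (Suc k)"
  shows "projective_power N (Suc k) (\<Sum>i\<in>A. f i) \<le> (\<Sum>i\<in>A. projective_power N (Suc k) (f i))"
  using assms
proof (induction A rule: finite_induct)
  case empty
  show ?case
    using projective_power_scale[OF cvec.subspace_0[OF tensor_power_subspace], of k 0] by simp
next
  case (insert a A)
  then show ?case
    using projective_power_add[of "f a" k "\<Sum>i\<in>A. f i"] cvec.subspace_sum[OF tensor_power_subspace, of A f]
    by simp
qed

lemma projective_power_tprod:
  "length xs = Suc k \<Longrightarrow> projective_power N (Suc k) (tprod xs) \<le> (\<Prod>x\<leftarrow>xs. N x)"
proof (induction k arbitrary: xs)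
  case 0
  then show ?case by (auto simp: length_Suc_conv degree1_tprod)
next
  case (Suc k)
  then obtain ys y where xs: "xs = ys @ [y]" "length ys = Suc k"
    by (metis length_append_singleton nat.inject rev_exhaust length_0_conv Zero_not_Suc)
  have "projective_power N (Suc (Suc k)) (tprod xs) \<le>
      (\<Sum>(x, y)\<leftarrow>[(tprod ys, y)]. projective_power N (Suc k) x * N y)"
    by (rule projective_power_Suc_le)
      (use tprod_in_tensor_power[of ys] xs in \<open>auto simp: tensor_snoc_tprod\<close>)
  also have "\<dots> \<le> (\<Prod>x\<leftarrow>xs. N x)"
    using mult_right_mono[OF Suc.IH[OF xs(2)], of "N y"] xs by simp
  finally show ?case .
qed

lemma symmetrised_in_tensor_power: "symmetrised xs \<in> tensor_power (length xs)"
  unfolding symmetrised_def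
  by (intro cvec.subspace_scale cvec.subspace_sum tensor_power_subspace)
    (metis length_permute_list tprod_in_tensor_power)

lemma projective_power_symmetrised:
  assumes "length xs = Suc k"
  shows "projective_power N (Suc k) (symmetrised xs) \<le> (\<Prod>x\<leftarrow>xs. N x)"
proof -
  let ?P = "{\<sigma>. \<sigma> permutes {..<length xs}}"
  have mem: "tprod (permute_list \<sigma> xs) \<in> tensor_power (Suc k)" for \<sigma>
    using tprod_in_tensor_power[of "permute_list \<sigma> xs"] assms by simp
  have "projective_power N (Suc k) (symmetrised xs) \<le>
      1 / fact (length xs) * projective_power N (Suc k) (\<Sum>\<sigma>\<in>?P. tprod (permute_list \<sigma> xs))"
    unfolding symmetrised_def
    by (rule order_trans[OF projective_power_scale])
      (auto simp: norm_divide intro!: cvec.subspace_sum[OF tensor_power_subspace] mem)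
  also have "\<dots> \<le> 1 / fact (length xs) * (\<Sum>\<sigma>\<in>?P. projective_power N (Suc k) (tprod (permute_list \<sigma> xs)))"
    by (intro mult_left_mono projective_power_sum mem) (auto simp: finite_permutations)
  also have "\<dots> \<le> 1 / fact (length xs) * (\<Sum>\<sigma>\<in>?P. \<Prod>x\<leftarrow>xs. N x)"
  proof (intro mult_left_mono sum_mono)
    fix \<sigma> assume "\<sigma> \<in> ?P"
    then have "mset (map N (permute_list \<sigma> xs)) = mset (map N xs)" by (simp add: mset_permute_list)
    then have "(\<Prod>x\<leftarrow>permute_list \<sigma> xs. N x) = (\<Prod>x\<leftarrow>xs. N x)"
      by (metis prod_mset_prod_list)
    then show "projective_power N (Suc k) (tprod (permute_list \<sigma> xs)) \<le> (\<Prod>x\<leftarrow>xs. N x)"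
      using projective_power_tprod[of "permute_list \<sigma> xs" k] assms by simp
  qed simp
  also have "\<dots> = (\<Prod>x\<leftarrow>xs. N x)"
    by (simp add: card_permutations)
  finally show ?thesis .
qed

section \<open>Injective norms in positive degree\<close>

definition injective_values :: "nat \<Rightarrow> 'v tensor \<Rightarrow> real set" where
  "injective_values k f = {cmod (\<theta> f) | \<theta> \<phi> \<psi>.
     clinear \<phi> \<and> clinear \<psi> \<and> dual_norm (tensor_power k) (injective_power N k) \<phi> = 1 \<and>
     dual_norm UNIV N \<psi> = 1 \<and> clinear \<theta> \<and>
     (\<forall>x\<in>tensor_power k. \<forall>y\<in>UNIV. \<theta> (tensor_snoc x y) = \<phi> x * \<psi> y)}"

lemma injective_power_Suc: "injective_power N (Suc (Suc k)) f = Sup (insert 0 (injective_values (Suc k) f))"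
  by (simp add: injective_norm_def injective_values_def)

text \<open>What the recursion must carry: the supremum in the next degree is finite only if
  functionals in this degree are bounded by the injective norm, which follows from the third clause
  and \<open>product_span_exhausts\<close>.\<close>

definition injective_regular :: "nat \<Rightarrow> bool" where
  "injective_regular k \<longleftrightarrow>
    (\<forall>f\<in>tensor_power k. 0 \<le> injective_power N k f) \<and>
    (\<forall>f\<in>tensor_power k. \<forall>c. injective_power N k (c *\<^sub>C f) = cmod c * injective_power N k f) \<and>
    (\<forall>\<theta>. product_functional k \<theta> \<longrightarrow> (\<forall>f\<in>tensor_power k. cmod (\<theta> f) \<le> injective_power N k f))"

context
  fixes k assumes regular: "injective_regular (Suc k)"
begin

lemma injective_nonneg: "f \<in> tensor_power (Suc k) \<Longrightarrow> 0 \<le> injective_power N (Suc k) f"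
  and injective_scale: "f \<in> tensor_power (Suc k) \<Longrightarrow>
      injective_power N (Suc k) (c *\<^sub>C f) = cmod c * injective_power N (Suc k) f"
  and injective_functional: "product_functional (Suc k) \<theta> \<Longrightarrow> f \<in> tensor_power (Suc k) \<Longrightarrow>
      cmod (\<theta> f) \<le> injective_power N (Suc k) f"
  using regular unfolding injective_regular_def by simp_all

lemma injective_functional_bounded:
  assumes "clinear \<theta>"
  shows "\<exists>C. \<forall>f\<in>tensor_power (Suc k). cmod (\<theta> f) \<le> C * injective_power N (Suc k) f"
proof -
  have "\<exists>C. \<forall>f\<in>tensor_power (Suc k). cmod (\<theta> f) \<le> C * injective_power N (Suc k) f"
    if "product_span (Suc k) \<theta>" for \<theta>
    using that
  proof (induction "Suc k" \<theta> rule: product_span.induct)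
    case zero
    show ?case by (intro exI[of _ 0]) simp
  next
    case (add \<eta> \<theta> c)
    then obtain C where C: "\<And>f. f \<in> tensor_power (Suc k) \<Longrightarrow> cmod (\<theta> f) \<le> C * injective_power N (Suc k) f"
      by blast
    have "cmod (c * \<eta> f + \<theta> f) \<le> (cmod c + C) * injective_power N (Suc k) f"
      if f: "f \<in> tensor_power (Suc k)" for f
    proof -
      have "cmod (c * \<eta> f + \<theta> f) \<le> cmod c * cmod (\<eta> f) + cmod (\<theta> f)"
        using norm_triangle_ineq[of "c * \<eta> f" "\<theta> f"] by (simp add: norm_mult)
      also have "\<dots> \<le> cmod c * injective_power N (Suc k) f + C * injective_power N (Suc k) f"
        by (intro add_mono mult_left_mono injective_functional[OF add.hyps(1) f] C[OF f]) simp
      finally show ?thesis by (simp add: distrib_right)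
    qed
    then show ?case by blast
  qed
  with product_span_exhausts[OF assms, of k] show ?thesis by metis
qed

lemma injective_dual_bound:
  assumes "clinear \<theta>" "f \<in> tensor_power (Suc k)"
  shows "cmod (\<theta> f) \<le> dual_norm (tensor_power (Suc k)) (injective_power N (Suc k)) \<theta> * injective_power N (Suc k) f"
proof -
  obtain C where "\<And>f. f \<in> tensor_power (Suc k) \<Longrightarrow> cmod (\<theta> f) \<le> C * injective_power N (Suc k) f"
    using injective_functional_bounded[OF assms(1)] by blast
  from dual_norm_bound[OF tensor_power_subspace assms(1) injective_nonneg injective_scale this assms(2)] show ?thesis
    by blast
qed

text \<open>A functional of dual norm 1 is dominated by the norm, so each admissible value is
  bounded by each decomposition of f. This gives finiteness of the supremum and, later, the
  comparison with the projective norm.\<close>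

lemma injective_values_le:
  assumes r: "r \<in> injective_values (Suc k) f"
    and ps: "set ps \<subseteq> tensor_power (Suc k) \<times> UNIV" "f = (\<Sum>(x, y)\<leftarrow>ps. tensor_snoc x y)"
  shows "r \<le> (\<Sum>(x, y)\<leftarrow>ps. injective_power N (Suc k) x * N y)"
proof -
  from r obtain \<theta> \<phi> \<psi> where *: "r = cmod (\<theta> f)" "clinear \<phi>" "clinear \<psi>"
    "dual_norm (tensor_power (Suc k)) (injective_power N (Suc k)) \<phi> = 1" "dual_norm UNIV N \<psi> = 1"
    "clinear \<theta>" "\<And>x y. x \<in> tensor_power (Suc k) \<Longrightarrow> \<theta> (tensor_snoc x y) = \<phi> x * \<psi> y"
    unfolding injective_values_def by blast
  have "cmod (\<theta> (\<Sum>(x, y)\<leftarrow>ps. tensor_snoc x y)) \<le> (\<Sum>(x, y)\<leftarrow>ps. injective_power N (Suc k) x * N y)"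
    using ps(1)
  proof (induction ps)
    case Nil
    show ?case using cvec.linear_0[OF *(6)] by simp
  next
    case (Cons p ps)
    obtain x y where p: "p = (x, y)" by force
    with Cons.prems have x: "x \<in> tensor_power (Suc k)" by simp
    have "cmod (\<phi> x) \<le> injective_power N (Suc k) x" "cmod (\<psi> y) \<le> N y"
      using injective_dual_bound[OF *(2) x] dual_norm_UNIV_bound[OF *(3), of y] *(4,5) by simp_all
    then have "cmod (\<theta> (tensor_snoc x y)) \<le> injective_power N (Suc k) x * N y"
      using injective_nonneg[OF x] by (simp add: *(7)[OF x] norm_mult mult_mono)
    moreover have "cmod (\<theta> (\<Sum>(x, y)\<leftarrow>ps. tensor_snoc x y)) \<le> (\<Sum>(x, y)\<leftarrow>ps. injective_power N (Suc k) x * N y)"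
      using Cons by simp
    moreover have "\<theta> (\<Sum>(x, y)\<leftarrow>p # ps. tensor_snoc x y) =
        \<theta> (tensor_snoc x y) + \<theta> (\<Sum>(x, y)\<leftarrow>ps. tensor_snoc x y)"
      using cvec.linear_add[OF *(6)] by (simp add: p)
    ultimately show ?case
      using norm_triangle_ineq[of "\<theta> (tensor_snoc x y)" "\<theta> (\<Sum>(x, y)\<leftarrow>ps. tensor_snoc x y)"]
      by (simp add: p)
  qed
  with * ps(2) show ?thesis by simp
qed

lemma bdd_above_injective_values:
  assumes "f \<in> tensor_power (Suc (Suc k))" shows "bdd_above (insert 0 (injective_values (Suc k) f))"
proof -
  obtain ps where "set ps \<subseteq> tensor_power (Suc k) \<times> UNIV" "f = (\<Sum>(x, y)\<leftarrow>ps. tensor_snoc x y)"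
    using tensor_power_Suc_decomposition[OF assms] by blast
  from injective_values_le[OF _ this] show ?thesis unfolding bdd_above_insert by (rule bdd_aboveI)
qed

lemma injective_Suc_nonneg: "f \<in> tensor_power (Suc (Suc k)) \<Longrightarrow> 0 \<le> injective_power N (Suc (Suc k)) f"
  unfolding injective_power_Suc by (rule cSup_upper[OF _ bdd_above_injective_values]) simp_all

lemma injective_Suc_scale_le:
  assumes f: "f \<in> tensor_power (Suc (Suc k))"
  shows "injective_power N (Suc (Suc k)) (c *\<^sub>C f) \<le> cmod c * injective_power N (Suc (Suc k)) f"
  unfolding injective_power_Suc[of k "c *\<^sub>C f"]
proof (rule cSup_least)
  fix r assume "r \<in> insert 0 (injective_values (Suc k) (c *\<^sub>C f))"
  then consider "r = 0" | "r \<in> injective_values (Suc k) (c *\<^sub>C f)" by blast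
  then show "r \<le> cmod c * injective_power N (Suc (Suc k)) f"
  proof cases
    case 1
    then show ?thesis using injective_Suc_nonneg[OF f] by simp
  next
    case 2
    then obtain \<theta> \<phi> \<psi> where *: "r = cmod (\<theta> (c *\<^sub>C f))" "clinear \<phi>" "clinear \<psi>"
      "dual_norm (tensor_power (Suc k)) (injective_power N (Suc k)) \<phi> = 1" "dual_norm UNIV N \<psi> = 1"
      "clinear \<theta>" "\<And>x y. x \<in> tensor_power (Suc k) \<Longrightarrow> \<theta> (tensor_snoc x y) = \<phi> x * \<psi> y"
      unfolding injective_values_def by blast
    then have "cmod (\<theta> f) \<in> injective_values (Suc k) f"
      unfolding injective_values_def by blast
    then have "cmod (\<theta> f) \<le> injective_power N (Suc (Suc k)) f"
      unfolding injective_power_Suc by (intro cSup_upper[OF _ bdd_above_injective_values[OF f]]) simp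
    moreover have "r = cmod c * cmod (\<theta> f)"
      using cvec.linear_scale[OF *(6), of c f] *(1) by (simp add: norm_mult)
    ultimately show ?thesis by (simp add: mult_left_mono)
  qed
qed simp

lemma injective_Suc_scale:
  assumes f: "f \<in> tensor_power (Suc (Suc k))"
  shows "injective_power N (Suc (Suc k)) (c *\<^sub>C f) = cmod c * injective_power N (Suc (Suc k)) f"
proof (cases "c = 0")
  case True
  then show ?thesis using injective_Suc_scale_le[OF f, of 0]
      injective_Suc_nonneg[OF cvec.subspace_0[OF tensor_power_subspace]] by simp
next
  case False
  have cf: "c *\<^sub>C f \<in> tensor_power (Suc (Suc k))"
    by (rule cvec.subspace_scale[OF tensor_power_subspace f])
  have "injective_power N (Suc (Suc k)) f \<le> inverse (cmod c) * injective_power N (Suc (Suc k)) (c *\<^sub>C f)"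
    using injective_Suc_scale_le[OF cf, of "inverse c"] False
    by (simp add: scaleC_scaleC scaleC_one norm_inverse)
  then have "cmod c * injective_power N (Suc (Suc k)) f \<le> injective_power N (Suc (Suc k)) (c *\<^sub>C f)"
    using False by (simp add: field_simps)
  with injective_Suc_scale_le[OF f, of c] show ?thesis by simp
qed

text \<open>Both tensor factors are divided by their dual norms, which lie in (0, 1]: the result is
  admissible in the supremum and its modulus is no smaller.\<close>

lemma injective_Suc_functional:
  assumes \<eta>: "product_functional (Suc k) \<eta>" and \<psi>: "short_functional \<psi>" and \<theta>: "clinear \<theta>"
    and prod: "\<And>f v. \<theta> (tensor_snoc f v) = \<eta> f * \<psi> v" and f: "f \<in> tensor_power (Suc (Suc k))"
  shows "cmod (\<theta> f) \<le> injective_power N (Suc (Suc k)) f"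
\<comment> \<open>A vanishing factor cannot be normalised, but then \<theta> vanishes on the whole
  tensor power.\<close>
proof (cases "(\<forall>x\<in>tensor_power (Suc k). \<eta> x = 0) \<or> (\<forall>v. \<psi> v = 0)")
  case True
  have "\<theta> f = 0"
    by (rule eq_on_tensor_power_Suc[OF \<theta> _ _ f, of "\<lambda>_. 0"])
      (use True in \<open>auto simp: prod intro: clinearI\<close>)
  then show ?thesis using injective_Suc_nonneg[OF f] by simp
next
  case False
  then obtain x v where x: "x \<in> tensor_power (Suc k)" "\<eta> x \<noteq> 0" and v: "v \<in> UNIV" "\<psi> v \<noteq> 0" by blast
  have \<psi>': "clinear \<psi>" "\<And>x. cmod (\<psi> x) \<le> N x" using \<psi> by (auto simp: short_functional_def)
  define a where "a = dual_norm (tensor_power (Suc k)) (injective_power N (Suc k)) \<eta>"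
  define b where "b = dual_norm UNIV N \<psi>"
  have a: "0 < a" "a \<le> 1" "clinear (\<lambda>y. complex_of_real (inverse a) * \<eta> y)"
    "dual_norm (tensor_power (Suc k)) (injective_power N (Suc k)) (\<lambda>y. complex_of_real (inverse a) * \<eta> y) = 1"
    unfolding a_def
    by (rule dual_norm_normalise[OF tensor_power_subspace product_functional_linear[OF \<eta>] injective_nonneg injective_scale
        injective_functional[OF \<eta>] x]; assumption)+
  have b: "0 < b" "b \<le> 1" "clinear (\<lambda>y. complex_of_real (inverse b) * \<psi> y)"
    "dual_norm UNIV N (\<lambda>y. complex_of_real (inverse b) * \<psi> y) = 1"
    unfolding b_def
    by (rule dual_norm_normalise[OF cvec.subspace_UNIV \<psi>'(1) N_nonneg N_scale \<psi>'(2) v])+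
  let ?\<theta> = "\<lambda>g. complex_of_real (inverse a * inverse b) * \<theta> g"
  have lin: "clinear ?\<theta>"
    using cvec.linear_add[OF \<theta>] cvec.linear_scale[OF \<theta>] by (intro clinearI) (simp_all add: distrib_left)
  have "?\<theta> (tensor_snoc g w) = (complex_of_real (inverse a) * \<eta> g) * (complex_of_real (inverse b) * \<psi> w)" for g w
    by (simp add: prod)
  then have "cmod (?\<theta> f) \<in> injective_values (Suc k) f"
    unfolding injective_values_def mem_Collect_eq
    by (intro exI[of _ ?\<theta>] exI[of _ "\<lambda>y. complex_of_real (inverse a) * \<eta> y"]
        exI[of _ "\<lambda>y. complex_of_real (inverse b) * \<psi> y"] conjI ballI a(3,4) b(3,4) lin refl)
  then have "cmod (?\<theta> f) \<le> injective_power N (Suc (Suc k)) f"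
    unfolding injective_power_Suc by (intro cSup_upper[OF _ bdd_above_injective_values[OF f]]) simp
  moreover have "cmod (\<theta> f) \<le> cmod (?\<theta> f)"
  proof -
    have "a * b \<le> 1" using a b by (simp add: mult_le_one)
    then have "1 \<le> inverse a * inverse b"
      using a(1) b(1) by (simp add: divide_simps flip: inverse_mult_distrib)
    then show ?thesis
      unfolding norm_mult norm_of_real using mult_right_mono[of 1 "\<bar>inverse a * inverse b\<bar>" "cmod (\<theta> f)"] by simp
  qed
  ultimately show ?thesis by simp
qed

lemma injective_Suc_le_projective:
  assumes le: "\<And>f. f \<in> tensor_power (Suc k) \<Longrightarrow> injective_power N (Suc k) f \<le> projective_power N (Suc k) f"
    and f: "f \<in> tensor_power (Suc (Suc k))"
  shows "injective_power N (Suc (Suc k)) f \<le> projective_power N (Suc (Suc k)) f"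
proof (rule field_le_epsilon)
  fix e :: real assume "0 < e"
  from projective_power_Suc_approx[OF f this] obtain ps where
    ps: "set ps \<subseteq> tensor_power (Suc k) \<times> UNIV" "f = (\<Sum>(x, y)\<leftarrow>ps. tensor_snoc x y)"
      "(\<Sum>(x, y)\<leftarrow>ps. projective_power N (Suc k) x * N y) < projective_power N (Suc (Suc k)) f + e"
    by blast
  have pos: "0 \<le> (\<Sum>(x, y)\<leftarrow>ps. injective_power N (Suc k) x * N y)"
    by (rule sum_list_nonneg) (use ps(1) injective_nonneg in auto)
  have "injective_power N (Suc (Suc k)) f \<le> (\<Sum>(x, y)\<leftarrow>ps. injective_power N (Suc k) x * N y)"
    unfolding injective_power_Suc
    by (rule cSup_least) (use injective_values_le[OF _ ps(1,2)] pos in auto)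
  also have "\<dots> \<le> (\<Sum>(x, y)\<leftarrow>ps. projective_power N (Suc k) x * N y)"
    by (rule sum_list_mono) (use ps(1) le in \<open>auto intro!: mult_right_mono\<close>)
  finally show "injective_power N (Suc (Suc k)) f \<le> projective_power N (Suc (Suc k)) f + e"
    using ps(3) by simp
qed

end

lemma injective_regular: "injective_regular (Suc k)"
proof (induction k)
  case 0
  have "cmod (\<theta> f) \<le> N (degree1 f)" if "product_functional (Suc 0) \<theta>" for \<theta> f
    using that
  proof cases
    case (snoc \<eta> \<psi>)
    \<comment> \<open>There is no product functional of degree 0.\<close>
    from snoc(1) show ?thesis by cases
  qed (simp add: short_functional_def)
  then show ?case
    by (simp add: injective_regular_def cvec.linear_scale[OF clinear_degree1] N_scale)
next
  case (Suc k)
  have "cmod (\<theta> f) \<le> injective_power N (Suc (Suc k)) f"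
    if "product_functional (Suc (Suc k)) \<theta>" "f \<in> tensor_power (Suc (Suc k))" for \<theta> f
    using that(1)
  proof cases
    case (snoc \<eta> \<psi>)
    from injective_Suc_functional[OF Suc snoc that(2)] show ?thesis .
  qed
  then show ?case
    unfolding injective_regular_def
    using injective_Suc_nonneg[OF Suc] injective_Suc_scale[OF Suc] by simp
qed

section \<open>Evaluation norm below injective norm below projective norm\<close>

lemma injective_le_projective:
  "f \<in> tensor_power (Suc k) \<Longrightarrow> injective_power N (Suc k) f \<le> projective_power N (Suc k) f"
proof (induction k arbitrary: f)
  case (Suc k)
  show ?case by (rule injective_Suc_le_projective[OF injective_regular Suc])
qed simp

lemma sym_eval_product_functional:
  assumes "short_functional \<phi>"
  shows "\<exists>\<theta>. product_functional (Suc k) \<theta> \<and> (\<forall>xs. length xs = Suc k \<longrightarrow> \<theta> (tprod xs) = (\<Prod>x\<leftarrow>xs. \<phi> x))"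
proof (induction k)
  case 0
  show ?case
    by (intro exI[of _ "\<lambda>f. \<phi> (degree1 f)"])
      (auto simp: degree1_tprod length_Suc_conv intro: product_functional.degree1 assms)
next
  case (Suc k)
  then obtain \<eta> where \<eta>: "product_functional (Suc k) \<eta>" "\<And>xs. length xs = Suc k \<Longrightarrow> \<eta> (tprod xs) = (\<Prod>x\<leftarrow>xs. \<phi> x)"
    by metis
  obtain \<theta> where \<theta>: "clinear \<theta>" "\<And>f v. \<theta> (tensor_snoc f v) = \<eta> f * \<phi> v"
    using tensor_functional_exists[OF product_functional_linear[OF \<eta>(1)]] assms
    by (metis short_functional_def)
  have "\<theta> (tprod xs) = (\<Prod>x\<leftarrow>xs. \<phi> x)" if len: "length xs = Suc (Suc k)" for xs
  proof -
    obtain ys y where "xs = ys @ [y]" "length ys = Suc k"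
      using len by (metis length_append_singleton nat.inject rev_exhaust length_0_conv Zero_not_Suc)
    then show ?thesis using \<theta>(2)[of "tprod ys" y] \<eta>(2) by (simp add: tensor_snoc_tprod)
  qed
  with product_functional.snoc[OF \<eta>(1) assms \<theta>] show ?case by (intro exI[of _ \<theta>]) simp
qed

lemma pol_in_tensor_power:
  assumes "P \<in> sym_power k" shows "pol P \<in> tensor_power k"
proof -
  have "pol P \<in> pol ` cvec.span {sprod xs |xs. length xs = k}"
    using assms by (simp add: sym_power_def)
  also have "\<dots> = cvec.span (pol ` {sprod xs |xs. length xs = k})"
    by (rule cvec.linear_span_image[OF clinear_pol, symmetric])
  also have "\<dots> \<subseteq> tensor_power k"
    by (rule cvec.span_minimal[OF _ tensor_power_subspace])
      (auto simp: pol_sprod symmetrised_in_tensor_power)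
  finally show ?thesis .
qed

text \<open>The value P(\<phi>) is the tensor power of \<phi> applied to \<open>pol P\<close>,
  because permuting factors does not change that functional; product functionals are dominated by
  the injective norm. The bound also makes the supremum in \<open>sym_ev\<close> finite.\<close>

lemma sym_eval_le_sym_eps:
  assumes P: "P \<in> sym_power (Suc k)" and \<phi>: "short_functional \<phi>"
  shows "cmod (sym_eval P \<phi>) \<le> sym_eps N (Suc k) P"
proof -
  obtain \<theta> where \<theta>: "product_functional (Suc k) \<theta>"
    "\<And>xs. length xs = Suc k \<Longrightarrow> \<theta> (tprod xs) = (\<Prod>x\<leftarrow>xs. \<phi> x)"
    using sym_eval_product_functional[OF \<phi>] by blast
  have \<phi>': "clinear \<phi>" using \<phi> by (simp add: short_functional_def)
  note lin = product_functional_linear[OF \<theta>(1)]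
  have "sym_eval P \<phi> = \<theta> (pol P)"
  proof (rule cvec.linear_eq_on[OF clinear_sym_eval[OF \<phi>'] clinear_compose[OF clinear_pol lin]])
    show "P \<in> cvec.span {sprod xs |xs. length xs = Suc k}" using P by (simp add: sym_power_def)
    fix b :: "'v sym_alg" assume "b \<in> {sprod xs |xs. length xs = Suc k}"
    then obtain xs where xs: "b = sprod xs" "length xs = Suc k" by blast
    have perm: "\<theta> (tprod (permute_list \<sigma> xs)) = (\<Prod>x\<leftarrow>xs. \<phi> x)" if "\<sigma> permutes {..<length xs}" for \<sigma>
    proof -
      have "mset (map \<phi> (permute_list \<sigma> xs)) = mset (map \<phi> xs)" using that by (simp add: mset_permute_list)
      then have "(\<Prod>x\<leftarrow>permute_list \<sigma> xs. \<phi> x) = (\<Prod>x\<leftarrow>xs. \<phi> x)" by (metis prod_mset_prod_list)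
      then show ?thesis using \<theta>(2)[of "permute_list \<sigma> xs"] xs(2) by simp
    qed
    have "\<theta> (symmetrised xs) =
        1 / fact (length xs) * (\<Sum>\<sigma> | \<sigma> permutes {..<length xs}. \<theta> (tprod (permute_list \<sigma> xs)))"
      unfolding symmetrised_def using cvec.linear_scale[OF lin] cvec.linear_sum[OF lin] by simp
    also have "\<dots> = (\<Prod>x\<leftarrow>xs. \<phi> x)"
      by (simp add: perm card_permutations)
    finally show "sym_eval b \<phi> = \<theta> (pol b)"
      by (simp add: xs(1) sym_eval_sprod[OF \<phi>'] pol_sprod)
  qed
  then show ?thesis
    using injective_functional[OF injective_regular \<theta>(1) pol_in_tensor_power[OF P]] by (simp add: sym_eps_def)
qed

lemma sym_ev_alt: "sym_ev N k P = (SUP \<phi>\<in>{\<phi>. short_functional \<phi>}. cmod (sym_eval P \<phi>))"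
  unfolding sym_ev_def short_functional_iff by (rule arg_cong[where f = Sup]) blast

lemma sym_eval_le_sym_ev:
  assumes "P \<in> sym_power (Suc k)" "short_functional \<phi>"
  shows "cmod (sym_eval P \<phi>) \<le> sym_ev N (Suc k) P"
  unfolding sym_ev_alt
  by (rule cSUP_upper) (use assms sym_eval_le_sym_eps[OF assms(1)] in \<open>auto intro!: bdd_aboveI\<close>)

lemma short_functional_zero: "short_functional (\<lambda>_. 0)"
  unfolding short_functional_def by (auto intro: clinearI)

lemma sym_ev_nonneg: "P \<in> sym_power (Suc k) \<Longrightarrow> 0 \<le> sym_ev N (Suc k) P"
  using sym_eval_le_sym_ev[OF _ short_functional_zero] norm_ge_zero order_trans by blast

lemma sym_ev_le_sym_eps: "P \<in> sym_power (Suc k) \<Longrightarrow> sym_ev N (Suc k) P \<le> sym_eps N (Suc k) P"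
  unfolding sym_ev_alt
  by (rule cSUP_least) (use short_functional_zero sym_eval_le_sym_eps in auto)

lemma sym_eps_le_sym_pi: "P \<in> sym_power (Suc k) \<Longrightarrow> sym_eps N (Suc k) P \<le> sym_pi N (Suc k) P"
  unfolding sym_eps_def sym_pi_def by (intro injective_le_projective pol_in_tensor_power)

section \<open>The pairing element and its powers\<close>

definition xvar :: "'v \<Rightarrow> 'v bipoly" where
  "xvar b = Poly_Mapping.single ({#b#}, {#}) 1"

definition yvar :: "'v \<Rightarrow> 'v bipoly" where
  "yvar b = Poly_Mapping.single ({#}, {#b#}) 1"

definition xlin :: "'v \<Rightarrow> 'v bipoly" where
  "xlin v = (\<Sum>b\<in>B. const (coord b v) * xvar b)"

text \<open>In the basis dual to B the coordinates of \<psi> are its values on B.\<close>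

definition ylin :: "('v \<Rightarrow> complex) \<Rightarrow> 'v bipoly" where
  "ylin \<psi> = (\<Sum>b\<in>B. const (\<psi> b) * yvar b)"

definition pairing :: "'v bipoly" where
  "pairing = (\<Sum>b\<in>B. xvar b * yvar b)"

text \<open>For fixed \<open>v\<close>, substitute the coordinates of \<open>v\<close> for the \<open>y\<close>-variables, read the
  \<open>x\<close>-variables as basis vectors, and keep the part of bidegree \<open>(k, k)\<close>.\<close>

definition contract :: "nat \<Rightarrow> 'v \<Rightarrow> 'v bipoly \<Rightarrow> 'v sym_alg" where
  "contract k v = free_lift (\<lambda>(M, M'). if size M = k \<and> size M' = k \<and> set_mset M \<subseteq> B
     then (\<Prod>b\<in>#M'. coord b v) *\<^sub>C sprod_mset M else 0)"

lemma linear_contract: "clinear (contract k v)"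
  unfolding contract_def by (rule clinear_free_lift)

lemma contract_monomial:
  "contract k v (Poly_Mapping.single (mset zs, mset cs) 1) =
     (if length zs = k \<and> length cs = k \<and> set zs \<subseteq> B then (\<Prod>b\<leftarrow>cs. coord b v) *\<^sub>C sprod zs else 0)"
  unfolding contract_def free_lift_word
  by (simp flip: prod_mset_prod_list)

lemma contract_sum_const: "contract k v (\<Sum>b\<in>A. const (c b) * f b) = (\<Sum>b\<in>A. c b *\<^sub>C contract k v (f b))"
  by (simp add: const_mult cvec.linear_sum[OF linear_contract] cvec.linear_scale[OF linear_contract])

abbreviation monomial :: "'v list \<Rightarrow> 'v list \<Rightarrow> 'v bipoly" where
  "monomial zs cs \<equiv> Poly_Mapping.single (mset zs, mset cs) 1"

lemma monomial_Nil: "monomial [] [] = 1"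
  by (metis mset.simps(1) single_one zero_prod_def)

lemma monomial_xvar: "monomial zs cs * xvar b = monomial (zs @ [b]) cs"
  by (simp add: xvar_def mult_single)

lemma monomial_yvar: "monomial zs cs * yvar b = monomial zs (cs @ [b])"
  by (simp add: yvar_def mult_single)

lemma contract_y_product:
  assumes "set zs \<subseteq> B" "\<And>\<psi>. \<psi> \<in> set \<psi>s \<Longrightarrow> clinear \<psi>"
  shows "contract k v (monomial zs cs * prod_list (map ylin \<psi>s)) =
    (if length zs = k \<and> length cs + length \<psi>s = k
     then ((\<Prod>b\<leftarrow>cs. coord b v) * (\<Prod>\<psi>\<leftarrow>\<psi>s. \<psi> v)) *\<^sub>C sprod zs else 0)"
  using assms(2)
proof (induction \<psi>s arbitrary: cs)
  case Nil
  then show ?case using assms(1) by (simp add: contract_monomial)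
next
  case (Cons \<psi> \<psi>s)
  let ?R = "prod_list (map ylin \<psi>s)"
  have IH: "contract k v (monomial zs (cs @ [b]) * ?R) =
      (if length zs = k \<and> length cs + length (\<psi> # \<psi>s) = k
       then ((\<Prod>b\<leftarrow>cs @ [b]. coord b v) * (\<Prod>\<psi>\<leftarrow>\<psi>s. \<psi> v)) *\<^sub>C sprod zs else 0)" for b
    using Cons.IH[of "cs @ [b]"] Cons.prems by simp
  have \<psi>: "\<psi> v = (\<Sum>b\<in>B. coord b v * \<psi> b)"
    using linear_coord_expansion[of \<psi> v] Cons.prems by simp
  have "monomial zs cs * prod_list (map ylin (\<psi> # \<psi>s)) =
      (\<Sum>b\<in>B. const (\<psi> b) * (monomial zs (cs @ [b]) * ?R))"
    unfolding monomial_yvar[symmetric] by (simp add: ylin_def sum_distrib_left sum_distrib_right mult_ac)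
  then have "contract k v (monomial zs cs * prod_list (map ylin (\<psi> # \<psi>s))) =
      (\<Sum>b\<in>B. \<psi> b *\<^sub>C contract k v (monomial zs (cs @ [b]) * ?R))"
    by (simp only: contract_sum_const)
  also have "\<dots> = (if length zs = k \<and> length cs + length (\<psi> # \<psi>s) = k
      then (\<Sum>b\<in>B. (\<psi> b * ((\<Prod>b\<leftarrow>cs @ [b]. coord b v) * (\<Prod>\<psi>\<leftarrow>\<psi>s. \<psi> v))) *\<^sub>C sprod zs) else 0)"
    unfolding IH by (auto simp: scaleC_scaleC intro!: sum.neutral)
  also have "(\<Sum>b\<in>B. (\<psi> b * ((\<Prod>b\<leftarrow>cs @ [b]. coord b v) * (\<Prod>\<psi>\<leftarrow>\<psi>s. \<psi> v))) *\<^sub>C sprod zs) =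
      ((\<Prod>b\<leftarrow>cs. coord b v) * (\<Prod>\<psi>\<leftarrow>\<psi> # \<psi>s. \<psi> v)) *\<^sub>C sprod zs"
    unfolding cvec.scale_sum_left[symmetric]
    by (simp add: \<psi> sum_distrib_left sum_distrib_right mult_ac)
  finally show ?case .
qed

text \<open>\<open>contract\<close> reads basis monomials, so the vectors of \<open>vs\<close> are
  expanded in B one at a time and collected in \<open>zs\<close>; multilinearity of
  \<open>sprod\<close> undoes each expansion.\<close>

lemma contract_product:
  assumes "set zs \<subseteq> B" "\<And>\<psi>. \<psi> \<in> set \<psi>s \<Longrightarrow> clinear \<psi>"
  shows "contract k v (monomial zs [] * (prod_list (map xlin vs) * prod_list (map ylin \<psi>s))) =
    (if length zs + length vs = k \<and> length \<psi>s = k then (\<Prod>\<psi>\<leftarrow>\<psi>s. \<psi> v) *\<^sub>C sprod (zs @ vs) else 0)"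
  using assms(1)
proof (induction vs arbitrary: zs)
  case Nil
  then show ?case using contract_y_product[OF Nil assms(2), of \<psi>s k v "[]"] by simp
next
  case (Cons x vs)
  let ?R = "prod_list (map xlin vs) * prod_list (map ylin \<psi>s)"
  have "monomial zs [] * (prod_list (map xlin (x # vs)) * prod_list (map ylin \<psi>s)) =
      (\<Sum>b\<in>B. const (coord b x) * (monomial (zs @ [b]) [] * ?R))"
    unfolding monomial_xvar[symmetric] by (simp add: xlin_def sum_distrib_left sum_distrib_right mult_ac)
  then have "contract k v (monomial zs [] * (prod_list (map xlin (x # vs)) * prod_list (map ylin \<psi>s))) =
      (\<Sum>b\<in>B. coord b x *\<^sub>C contract k v (monomial (zs @ [b]) [] * ?R))"
    by (simp only: contract_sum_const)
  also have "\<dots> = (\<Sum>b\<in>B. coord b x *\<^sub>C (if length zs + length (x # vs) = k \<and> length \<psi>s = k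
      then (\<Prod>\<psi>\<leftarrow>\<psi>s. \<psi> v) *\<^sub>C sprod (zs @ b # vs) else 0))"
  proof (intro sum.cong refl arg_cong[where f = "scaleC _"])
    fix b assume "b \<in> B"
    with Cons.prems have "set (zs @ [b]) \<subseteq> B" by simp
    from Cons.IH[OF this]
    show "contract k v (monomial (zs @ [b]) [] * ?R) =
        (if length zs + length (x # vs) = k \<and> length \<psi>s = k
         then (\<Prod>\<psi>\<leftarrow>\<psi>s. \<psi> v) *\<^sub>C sprod (zs @ b # vs) else 0)"
      by simp
  qed
  also have "\<dots> = (if length zs + length (x # vs) = k \<and> length \<psi>s = k
      then (\<Prod>\<psi>\<leftarrow>\<psi>s. \<psi> v) *\<^sub>C (\<Sum>b\<in>B. coord b x *\<^sub>C sprod (zs @ b # vs)) else 0)"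
    by (auto simp: cvec.scale_sum_right scaleC_scaleC mult.commute intro!: sum.neutral)
  also have "(\<Sum>b\<in>B. coord b x *\<^sub>C sprod (zs @ b # vs)) = sprod (zs @ x # vs)"
    using multilinear_sum[OF multilinear_sprod, of zs "\<lambda>b. coord b x" "\<lambda>b. b" B vs] by (simp add: sum_coord)
  finally show ?case .
qed

text \<open>Each factor x_b y_b contributes the vector b with weight \<open>coord b v\<close>, and
  summing over b restores v.\<close>

lemma contract_pairing_power_aux:
  assumes "set zs \<subseteq> B"
  shows "contract k v (monomial zs cs * pairing ^ j) =
    (if length zs + j = k \<and> length cs + j = k
     then (\<Prod>b\<leftarrow>cs. coord b v) *\<^sub>C sprod (zs @ replicate j v) else 0)"
  using assms
proof (induction j arbitrary: zs cs)
  case 0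
  then show ?case by (simp add: contract_monomial)
next
  case (Suc j)
  have "monomial zs cs * pairing ^ Suc j =
      (\<Sum>b\<in>B. const 1 * (monomial (zs @ [b]) (cs @ [b]) * pairing ^ j))"
    unfolding monomial_xvar[symmetric] monomial_yvar[symmetric]
    by (simp add: pairing_def[of] sum_distrib_left sum_distrib_right mult_ac bipoly.\<iota>_1)
  then have "contract k v (monomial zs cs * pairing ^ Suc j) =
      (\<Sum>b\<in>B. contract k v (monomial (zs @ [b]) (cs @ [b]) * pairing ^ j))"
    by (simp only: contract_sum_const scaleC_one)
  also have "\<dots> = (\<Sum>b\<in>B. if length zs + Suc j = k \<and> length cs + Suc j = k
      then (\<Prod>b\<leftarrow>cs. coord b v) *\<^sub>C (coord b v *\<^sub>C sprod (zs @ b # replicate j v)) else 0)"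
  proof (rule sum.cong)
    fix b assume "b \<in> B"
    with Suc.prems have "set (zs @ [b]) \<subseteq> B" by simp
    from Suc.IH[OF this, of "cs @ [b]"]
    show "contract k v (monomial (zs @ [b]) (cs @ [b]) * pairing ^ j) =
        (if length zs + Suc j = k \<and> length cs + Suc j = k
         then (\<Prod>b\<leftarrow>cs. coord b v) *\<^sub>C (coord b v *\<^sub>C sprod (zs @ b # replicate j v)) else 0)"
      by (simp add: scaleC_scaleC)
  qed simp
  also have "\<dots> = (if length zs + Suc j = k \<and> length cs + Suc j = k
      then (\<Prod>b\<leftarrow>cs. coord b v) *\<^sub>C (\<Sum>b\<in>B. coord b v *\<^sub>C sprod (zs @ b # replicate j v)) else 0)"
    by (auto simp: cvec.scale_sum_right intro!: sum.neutral)
  also have "(\<Sum>b\<in>B. coord b v *\<^sub>C sprod (zs @ b # replicate j v)) = sprod (zs @ replicate (Suc j) v)"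
    using multilinear_sum[OF multilinear_sprod, of zs "\<lambda>b. coord b v" "\<lambda>b. b" B "replicate j v"]
    by (simp add: sum_coord)
  finally show ?case .
qed

lemma contract_pairing_power: "contract k v (pairing ^ k) = sprod (replicate k v)"
  using contract_pairing_power_aux[of "[]" k v "[]" k] by (simp add: monomial_Nil[simplified])

text \<open>The y-part is a power of one functional, since contracting against \<psi>^k amounts to
  evaluating at \<psi>, which \<open>sym_ev\<close> controls; the weight keeps products of such
  powers in the absolutely convex hull. The x-part may be any product of unit ball vectors, as the
  projective norm allows.\<close>

definition generators :: "'v bipoly set" where
  "generators = {prod_list (map xlin vs) * (const (power_coeff l) * ylin \<psi> ^ l) | vs l \<psi>.
     (\<forall>v\<in>set vs. N v \<le> 1) \<and> short_functional \<psi>}"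

text \<open>The monomials involving a variable outside \<open>B\<close> lie in this ideal, so that the
  generators span everything modulo it.\<close>

definition kernel :: "'v bipoly set" where
  "kernel = {f. \<forall>k v g. contract k v (g * f) = 0}"

lemma ideal_kernel: "bipoly.is_ideal kernel"
  unfolding bipoly.is_ideal_def kernel_def
  by (simp add: distrib_left cvec.linear_add[OF linear_contract] cvec.linear_0[OF linear_contract]
      flip: mult.assoc)

lemma contract_kernel: "f \<in> kernel \<Longrightarrow> contract k v f = 0"
  unfolding kernel_def by (metis (mono_tags, lifting) mem_Collect_eq mult_1)

lemma ylin_combination: "const c * ylin \<phi> + const d * ylin \<psi> = ylin (\<lambda>v. c * \<phi> v + d * \<psi> v)"
  by (simp add: ylin_def sum_distrib_left sum.distrib distrib_right bipoly.\<iota>_add bipoly.\<iota>_mult mult.assoc)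

lemma short_functional_combination:
  assumes "short_functional \<phi>" "short_functional \<psi>" "cmod c + cmod d \<le> 1"
  shows "short_functional (\<lambda>v. c * \<phi> v + d * \<psi> v)"
  unfolding short_functional_def
proof (intro conjI allI)
  have lin: "clinear \<phi>" "clinear \<psi>" and le: "cmod (\<phi> x) \<le> N x" "cmod (\<psi> x) \<le> N x" for x
    using assms by (auto simp: short_functional_def)
  show "clinear (\<lambda>v. c * \<phi> v + d * \<psi> v)"
    using cvec.linear_add[OF lin(1)] cvec.linear_scale[OF lin(1)]
      cvec.linear_add[OF lin(2)] cvec.linear_scale[OF lin(2)]
    by (intro clinearI) (simp_all add: algebra_simps)
  fix x
  have "cmod (c * \<phi> x + d * \<psi> x) \<le> cmod c * cmod (\<phi> x) + cmod d * cmod (\<psi> x)"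
    by (rule order_trans[OF norm_triangle_ineq]) (simp add: norm_mult)
  also have "\<dots> \<le> cmod c * N x + cmod d * N x" by (intro add_mono mult_left_mono le) auto
  also have "\<dots> \<le> 1 * N x" unfolding distrib_right[symmetric] by (intro mult_right_mono assms) simp
  finally show "cmod (c * \<phi> x + d * \<psi> x) \<le> N x" by simp
qed

text \<open>The x-parts concatenate; \<open>power_mult_average\<close> replaces the product of the
  y-parts by an average of weighted powers of single functionals.\<close>

lemma generators_mult:
  assumes "g \<in> generators" "h \<in> generators"
  shows "bipoly.combination generators kernel (g * h) 1"
proof -
  from assms obtain vs a \<phi> ws b \<psi> where
    g: "g = prod_list (map xlin vs) * (const (power_coeff a) * ylin \<phi> ^ a)"
      "\<forall>v\<in>set vs. N v \<le> 1" "short_functional \<phi>" and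
    h: "h = prod_list (map xlin ws) * (const (power_coeff b) * ylin \<psi> ^ b)"
      "\<forall>v\<in>set ws. N v \<le> 1" "short_functional \<psi>"
    unfolding generators_def by blast
  have X: "\<forall>v\<in>set (vs @ ws). N v \<le> 1" using g h by auto
  have gh: "g * h = prod_list (map xlin (vs @ ws)) *
      (const (power_coeff a * power_coeff b) * (ylin \<phi> ^ a * ylin \<psi> ^ b))"
    by (simp add: g h bipoly.\<iota>_mult mult_ac)
  show ?thesis
  \<comment> \<open>The proportions a / k and b / k need k > 0; in degree 0 both y-parts are
    1.\<close>
  proof (cases "a + b = 0")
    case True
    then have "g * h \<in> generators"
      unfolding generators_def gh using X g(3)
      by (auto simp: power_coeff_def intro!: exI[of _ "vs @ ws"] exI[of _ "0::nat"])
    then show ?thesis by (rule bipoly.combination_generator[OF ideal_kernel])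
  next
    case False
    define k where "k = a + b"
    let ?\<theta> = "root_of_unity (Suc k)"
    define s t where "s = complex_of_real (real a / real k)" and "t = complex_of_real (real b / real k)"
    define \<omega> where "\<omega> i = (\<lambda>v. s * \<phi> v + (t * ?\<theta> i) * \<psi> v)" for i
    let ?X = "prod_list (map xlin (vs @ ws))"
    let ?c = "\<lambda>i. cnj (?\<theta> i) ^ b / of_nat (Suc k)"
    \<comment> \<open>The real numbers s and t are nonnegative with sum 1, so every \<omega> i is
      again short.\<close>
    have st: "cmod s + cmod (t * ?\<theta> i) \<le> 1" for i
    proof -
      have "cmod s + cmod t = real a / real k + real b / real k"
        unfolding s_def t_def norm_of_real by simp
      also have "\<dots> = 1"
        using False unfolding add_divide_distrib[symmetric] by (simp add: k_def flip: of_nat_add)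
      finally show ?thesis by (simp add: norm_mult)
    qed
    have gen: "?X * (const (power_coeff k) * ylin (\<omega> i) ^ k) \<in> generators" for i
      unfolding generators_def mem_Collect_eq
      by (intro exI[of _ "vs @ ws"] exI[of _ k] exI[of _ "\<omega> i"] conjI refl X)
        (simp add: \<omega>_def short_functional_combination[OF g(3) h(3) st])
    have "0 < a + b" using False by simp
    from bipoly.power_mult_average[OF this, of "ylin \<phi>" "ylin \<psi>"]
    have "const (power_coeff a * power_coeff b) * (ylin \<phi> ^ a * ylin \<psi> ^ b) =
        (\<Sum>i<Suc k. const (?c i) * (const (power_coeff k) * ylin (\<omega> i) ^ k))"
      unfolding \<omega>_def ylin_combination[symmetric] s_def t_def k_def .
    then have "g * h = (\<Sum>i<Suc k. const (?c i) * (?X * (const (power_coeff k) * ylin (\<omega> i) ^ k)))"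
      unfolding gh by (simp only: sum_distrib_left mult.left_commute[of ?X])
    moreover have "bipoly.combination generators kernel
        (\<Sum>i<Suc k. const (?c i) * (?X * (const (power_coeff k) * ylin (\<omega> i) ^ k)))
        (\<Sum>i<Suc k. cmod (?c i) * 1)"
      by (intro bipoly.combination_sum[OF ideal_kernel]
          bipoly.combination_scale[OF ideal_kernel]
          bipoly.combination_generator[OF ideal_kernel] gen)
    moreover have "(\<Sum>i<Suc k. cmod (?c i) * 1) = 1"
      by (simp add: norm_divide norm_power del: sum.lessThan_Suc of_nat_Suc)
    ultimately show ?thesis by simp
  qed
qed

lemma xlin_add: "xlin (v + w) = xlin v + xlin w"
  by (simp add: xlin_def cvec.linear_add[OF linear_coord] bipoly.\<iota>_add distrib_right sum.distrib)

lemma xlin_scale: "xlin (c *\<^sub>C v) = const c * xlin v"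
  by (simp add: xlin_def cvec.representation_scale[OF independent_B] span_B bipoly.\<iota>_mult
      sum_distrib_left mult.assoc)

lemma ylin_scale: "ylin (\<lambda>v. c * \<psi> v) = const c * ylin \<psi>"
  by (simp add: ylin_def bipoly.\<iota>_mult sum_distrib_left mult.assoc)

lemma xlin_basis: "b \<in> B \<Longrightarrow> xlin b = xvar b"
  by (simp add: xlin_def cvec.representation_basis[OF independent_B] if_distrib[of const]
      if_distrib[of "\<lambda>x. x * _"] bipoly.\<iota>_0 bipoly.\<iota>_1 finite_B cong: if_cong)

lemma ylin_coord: "b \<in> B \<Longrightarrow> ylin (coord b) = yvar b"
  by (simp add: ylin_def cvec.representation_basis[OF independent_B] if_distrib[of const]
      if_distrib[of "\<lambda>x. x * _"] bipoly.\<iota>_0 bipoly.\<iota>_1 finite_B cong: if_cong sum.cong)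

lemma normalised_vector:
  obtains w where "N w \<le> 1" "v = complex_of_real (N v) *\<^sub>C w"
proof (cases "v = 0")
  case True
  then show ?thesis using that[of 0] by simp
next
  case False
  then have "N v \<noteq> 0" by simp
  then show ?thesis
    using that[of "complex_of_real (1 / N v) *\<^sub>C v"]
    by (simp add: N_scale scaleC_scaleC scaleC_one norm_divide)
qed

lemma generators_xlin: "N v \<le> 1 \<Longrightarrow> xlin v \<in> generators"
  unfolding generators_def mem_Collect_eq
  by (intro exI[of _ "[v]"] exI[of _ 0] exI[of _ "\<lambda>_. 0"])
    (simp add: power_coeff_def bipoly.\<iota>_1 short_functional_zero)

lemma generators_ylin: "short_functional \<psi> \<Longrightarrow> const (power_coeff l) * ylin \<psi> ^ l \<in> generators"
  unfolding generators_def mem_Collect_eq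
  by (intro exI[of _ "[]"] exI[of _ l] exI[of _ \<psi>]) simp

abbreviation generated :: "'v bipoly \<Rightarrow> bool" where
  "generated f \<equiv> \<exists>r. bipoly.combination generators kernel f r"

lemma generated_mult: "generated f \<Longrightarrow> generated g \<Longrightarrow> generated (f * g)"
  using bipoly.combination_mult[OF ideal_kernel] generators_mult by blast

lemma generated_add: "generated f \<Longrightarrow> generated g \<Longrightarrow> generated (f + g)"
  using bipoly.combination_add[OF ideal_kernel] by blast

lemma generated_scale: "generated f \<Longrightarrow> generated (const c * f)"
  using bipoly.combination_scale[OF ideal_kernel] by blast

lemma generated_generator: "g \<in> generators \<Longrightarrow> generated g"
  using bipoly.combination_generator[OF ideal_kernel] by blast

lemma kernelI:
  assumes "\<And>k v zs cs. contract k v (monomial zs cs * f) = 0" shows "f \<in> kernel"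
  unfolding kernel_def
proof (intro CollectI allI)
  fix k v and g :: "'v bipoly"
  have lin: "clinear (\<lambda>g. contract k v (g * f))"
    by (rule clinearI)
      (simp_all add: distrib_right cvec.linear_add[OF linear_contract] cvec.linear_scale[OF linear_contract]
        mult.assoc flip: const_mult, simp add: const_mult cvec.linear_scale[OF linear_contract])
  have zero: "clinear (\<lambda>_. 0 :: 'v sym_alg)" by (rule clinearI) simp_all
  show "contract k v (g * f) = 0"
  proof (rule cvec.linear_eq_on[OF lin zero span_words])
    fix b :: "'v bipoly" assume "b \<in> range (\<lambda>x. Poly_Mapping.single x (1::complex))"
    then obtain M M' where "b = Poly_Mapping.single (M, M') (1::complex)" by auto
    then show "contract k v (b * f) = 0" using assms ex_mset by metis
  qed
qed

lemma generated_xvar: "generated (xvar b)"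
proof (cases "b \<in> B")
  case True
  obtain w where "N w \<le> 1" "b = complex_of_real (N b) *\<^sub>C w" by (rule normalised_vector)
  then have "xvar b = const (N b) * xlin w" using xlin_scale True by (metis xlin_basis)
  then show ?thesis using generated_scale[OF generated_generator[OF generators_xlin]] \<open>N w \<le> 1\<close> by simp
next
  case False
  then have "xvar b \<in> kernel"
    by (intro kernelI) (simp add: monomial_xvar contract_monomial del: mset_append)
  then show ?thesis using bipoly.combination.ideal[of "xvar b" kernel 0] by blast
qed

lemma generated_yvar: "generated (yvar b)"
proof (cases "b \<in> B")
  case True
  obtain C \<psi> where \<psi>: "short_functional \<psi>" "coord b = (\<lambda>v. complex_of_real C * \<psi> v)"
    using bounded_functional_normalise[OF linear_coord[of b]] by blast
  then have "yvar b = const C * ylin \<psi>" using ylin_scale True by (metis ylin_coord)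
  moreover have "ylin \<psi> \<in> generators"
    using generators_ylin[OF \<psi>(1), of 1] by (simp add: power_coeff_def bipoly.\<iota>_1)
  ultimately show ?thesis using generated_scale[OF generated_generator] by simp
next
  case False
  then have "yvar b \<in> kernel"
    by (intro kernelI) (simp add: monomial_yvar contract_monomial coord_outside del: mset_append)
  then show ?thesis using bipoly.combination.ideal[of "yvar b" kernel 0] by blast
qed

text \<open>This makes the gauge finite everywhere. Variables at basis vectors are multiples of
  generators, the others lie in the kernel, and monomials are products of variables.\<close>

lemma generated_all: "generated f"
proof -
  have mono: "generated (monomial zs cs)" for zs cs
  proof (induction cs rule: rev_induct)
    case Nil
    show ?case
    proof (induction zs rule: rev_induct)
      case Nil
      have "1 \<in> generators" using generators_ylin[OF short_functional_zero, of 0]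
        by (simp add: power_coeff_def bipoly.\<iota>_1)
      then show ?case unfolding monomial_Nil by (rule generated_generator)
    next
      case (snoc b zs)
      then show ?case unfolding monomial_xvar[symmetric] by (intro generated_mult generated_xvar)
    qed
  next
    case (snoc b cs)
    then show ?case unfolding monomial_yvar[symmetric] by (intro generated_mult generated_yvar)
  qed
  show ?thesis
    using span_words[of f]
  proof (induction rule: cvec.span_induct_alt)
    case base
    show ?case using bipoly.combination.ideal[of 0 kernel 0] ideal_kernel
      by (auto simp: bipoly.is_ideal_def)
  next
    case (step c x y)
    then obtain M M' where "x = Poly_Mapping.single (M, M') (1::complex)" by auto
    then have "generated x" using mono ex_mset by metis
    then show ?case
      unfolding const_mult[symmetric] by (intro generated_add generated_scale step)
  qed
qed

text \<open>A character restricts on the x-side to a short functional \<phi>. Since x_b goes to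
  \<phi> b, the pairing element has the same image as \<open>ylin \<phi>\<close>, so the generators
  with \<psi> = \<phi> bound all its weighted powers by 1.\<close>

lemma character_pairing:
  assumes add: "\<And>a b. h (a + b) = h a + h b" and mult: "\<And>a b. h (a * b) = h a * h b"
    and const: "\<And>c. h (const c) = c" and le: "\<And>g. g \<in> generators \<Longrightarrow> cmod (h g) \<le> 1"
  shows "cmod (h pairing) \<le> exp (- 1)"
proof -
  have zero: "h 0 = 0" and one: "h 1 = 1"
    using const[of 0] const[of 1] by (simp_all add: bipoly.\<iota>_0 bipoly.\<iota>_1)
  have sum: "h (\<Sum>i\<in>A. f i) = (\<Sum>i\<in>A. h (f i))" for f and A :: "'v set"
    by (induction A rule: infinite_finite_induct) (simp_all add: zero add)
  have power: "h (f ^ n) = h f ^ n" for f n by (induction n) (simp_all add: one mult)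
  define \<phi> where "\<phi> v = h (xlin v)" for v
  have lin: "clinear \<phi>"
    by (rule clinearI) (simp_all add: \<phi>_def xlin_add xlin_scale add mult const)
  have "cmod (\<phi> v) \<le> N v" for v
  proof -
    obtain w where w: "N w \<le> 1" "v = complex_of_real (N v) *\<^sub>C w" by (rule normalised_vector)
    have "\<phi> v = N v * \<phi> w" using w(2) cvec.linear_scale[OF lin] by (metis scaleC_complex)
    moreover have "cmod (\<phi> w) \<le> 1" unfolding \<phi>_def by (intro le generators_xlin w)
    ultimately show ?thesis by (simp add: norm_mult mult_left_le)
  qed
  with lin have short: "short_functional \<phi>" by (simp add: short_functional_def)
  have "h pairing = (\<Sum>b\<in>B. \<phi> b * h (yvar b))"
    unfolding pairing_def sum by (rule sum.cong) (simp_all add: mult \<phi>_def xlin_basis)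
  also have "\<dots> = h (ylin \<phi>)" unfolding ylin_def sum by (simp add: mult const)
  finally have eq: "h pairing = h (ylin \<phi>)" .
  have "power_coeff l * cmod (h pairing) ^ l \<le> 1" for l
    using le[OF generators_ylin[OF short, of l]] power_coeff_nonneg[of l]
    by (simp add: mult const power eq norm_mult norm_power)
  then show ?thesis using power_coeff_unbounded[of "cmod (h pairing)"] by (meson not_le)
qed

lemma pairing_power_bound:
  assumes "exp (- 1) < \<rho>"
  shows "\<exists>C. \<forall>m. bipoly.combination generators kernel (pairing ^ m) (C * \<rho> ^ m)"
proof (rule bipoly.combination_power_bound[OF ideal_kernel])
  show "0 < \<rho>" using assms order_less_trans[OF exp_gt_zero] by blast
  show "cmod (h pairing) < \<rho>" if "\<And>a b. h (a + b) = h a + h b" "\<And>a b. h (a * b) = h a * h b"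
    "\<And>c. h (const c) = c" "\<And>g. g \<in> generators \<Longrightarrow> cmod (h g) \<le> 1" for h
    using character_pairing[of h, OF that] assms by simp
qed (use generators_mult generated_all in auto)

lemma contract_generator:
  assumes "clinear \<psi>"
  shows "contract k v (prod_list (map xlin vs) * (const a * ylin \<psi> ^ l)) =
    (if length vs = k \<and> l = k then (a * \<psi> v ^ k) *\<^sub>C sprod vs else 0)"
proof -
  have "prod_list (map ylin (replicate l \<psi>)) = ylin \<psi> ^ l" by simp
  then have "prod_list (map xlin vs) * (const a * ylin \<psi> ^ l) =
      a *\<^sub>C (monomial [] [] * (prod_list (map xlin vs) * prod_list (map ylin (replicate l \<psi>))))"
    unfolding const_mult[symmetric] monomial_Nil by (simp add: mult_ac)
  also have "contract k v \<dots> = a *\<^sub>C contract k v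
      (monomial [] [] * (prod_list (map xlin vs) * prod_list (map ylin (replicate l \<psi>))))"
    by (rule cvec.linear_scale[OF linear_contract])
  also have "\<dots> = (if length vs = k \<and> l = k then (a * \<psi> v ^ k) *\<^sub>C sprod vs else 0)"
    by (subst contract_product) (use assms in \<open>auto simp: scaleC_scaleC\<close>)
  finally show ?thesis .
qed

section \<open>From combinations to operators on the graded pieces\<close>

lemma sym_pi_add:
  "P \<in> sym_power (Suc k) \<Longrightarrow> Q \<in> sym_power (Suc k) \<Longrightarrow>
    sym_pi N (Suc k) (P + Q) \<le> sym_pi N (Suc k) P + sym_pi N (Suc k) Q"
  unfolding sym_pi_def cvec.linear_add[OF clinear_pol]
  by (intro projective_power_add pol_in_tensor_power)

lemma sym_pi_scale:
  "P \<in> sym_power (Suc k) \<Longrightarrow> sym_pi N (Suc k) (c *\<^sub>C P) \<le> cmod c * sym_pi N (Suc k) P"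
  unfolding sym_pi_def cvec.linear_scale[OF clinear_pol]
  by (intro projective_power_scale pol_in_tensor_power)

lemma sym_power_subspace: "cvec.subspace (sym_power k)"
  unfolding sym_power_def by (rule cvec.subspace_span)

lemma sprod_in_sym_power: "length xs = k \<Longrightarrow> sprod xs \<in> sym_power k"
  unfolding sym_power_def by (rule cvec.span_base) auto

text \<open>A generator of bidegree (k, k) acts as the rank one operator sending P to
  \<open>power_coeff k\<close> times P(\<psi>) times a product of vectors of norm at most 1, whose
  projective norm is at most 1. The costs add up along the combination to r times weight times
  \<open>sym_ev\<close>.\<close>

lemma combination_operator:
  assumes "bipoly.combination generators kernel f r"
  shows "\<exists>L. clinear L \<and> (\<forall>v. L (sprod (replicate (Suc k) v)) = contract (Suc k) v f) \<and>
    (\<forall>P\<in>sym_power (Suc k). L P \<in> sym_power (Suc k) \<and>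
      sym_pi N (Suc k) (L P) \<le> r * power_coeff (Suc k) * sym_ev N (Suc k) P)"
  using assms
proof (induction rule: bipoly.combination.induct)
  case (ideal f r)
  have "sym_pi N (Suc k) 0 \<le> 0"
    using sym_pi_scale[OF cvec.subspace_0[OF sym_power_subspace], of k 0] by simp
  moreover have "clinear (\<lambda>_. 0 :: 'v sym_alg)" by (rule clinearI) simp_all
  ultimately show ?case
    using contract_kernel[OF ideal(1)] ideal(2) power_coeff_nonneg sym_ev_nonneg
      cvec.subspace_0[OF sym_power_subspace]
    by (intro exI[of _ "\<lambda>_. 0"]) (auto intro: order_trans)
next
  case (step g f r c s)
  let ?k = "Suc k"
  obtain L where L: "clinear L" "\<And>v. L (sprod (replicate ?k v)) = contract ?k v f"
    "\<And>P. P \<in> sym_power ?k \<Longrightarrow> L P \<in> sym_power ?k"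
    "\<And>P. P \<in> sym_power ?k \<Longrightarrow> sym_pi N ?k (L P) \<le> r * power_coeff ?k * sym_ev N ?k P"
    using step.IH by metis
  obtain vs l \<psi> where g: "g = prod_list (map xlin vs) * (const (power_coeff l) * ylin \<psi> ^ l)"
    "\<forall>v\<in>set vs. N v \<le> 1" "short_functional \<psi>"
    using step.hyps(1) unfolding generators_def by blast
  then have \<psi>: "clinear \<psi>" by (simp add: short_functional_def)
  have cg: "contract ?k v g = (if length vs = ?k \<and> l = ?k then (power_coeff l * \<psi> v ^ ?k) *\<^sub>C sprod vs else 0)" for v
    unfolding g(1) by (rule contract_generator[OF \<psi>])
  have lin: "clinear (\<lambda>P. (\<gamma> * sym_eval P \<psi>) *\<^sub>C w + L P)" for \<gamma> and w :: "'v sym_alg"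
    by (rule clinearI)
      (simp_all add: cvec.linear_add[OF clinear_sym_eval[OF \<psi>]] cvec.linear_add[OF L(1)]
        cvec.linear_scale[OF clinear_sym_eval[OF \<psi>]] cvec.linear_scale[OF L(1)]
        scaleC_add_right scaleC_add_left scaleC_scaleC algebra_simps)
  show ?case
  \<comment> \<open>Generators of any other bidegree are annihilated by the contraction.\<close>
  proof (cases "length vs = ?k \<and> l = ?k")
    case True
    define L' where "L' P = ((c * power_coeff ?k) * sym_eval P \<psi>) *\<^sub>C sprod vs + L P" for P
    have w: "sprod vs \<in> sym_power ?k" using True by (simp add: sprod_in_sym_power)
    have eval: "sym_eval (sprod (replicate ?k v)) \<psi> = \<psi> v ^ ?k" for v
      by (simp add: sym_eval_sprod[OF \<psi>] del: replicate_Suc power_Suc)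
    have "L' (sprod (replicate ?k v)) = contract ?k v (const c * g + f)" for v
      using True unfolding L'_def eval L(2) cvec.linear_add[OF linear_contract] const_mult
        cvec.linear_scale[OF linear_contract] cg
      by (simp add: scaleC_scaleC mult.assoc del: power_Suc replicate_Suc)
    moreover have "L' P \<in> sym_power ?k \<and> sym_pi N ?k (L' P) \<le> s * power_coeff ?k * sym_ev N ?k P"
      if P: "P \<in> sym_power ?k" for P
    proof
      have mem: "((c * power_coeff ?k) * sym_eval P \<psi>) *\<^sub>C sprod vs \<in> sym_power ?k"
        by (rule cvec.subspace_scale[OF sym_power_subspace w])
      show "L' P \<in> sym_power ?k"
        unfolding L'_def by (rule cvec.subspace_add[OF sym_power_subspace mem L(3)[OF P]])
      have "0 \<le> (\<Prod>x\<leftarrow>vs. N x) \<and> (\<Prod>x\<leftarrow>vs. N x) \<le> 1"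
        using g(2) by (induction vs) (auto intro: mult_le_one)
      then have unit: "sym_pi N ?k (sprod vs) \<le> 1"
        using projective_power_symmetrised[of vs k] True by (simp add: sym_pi_def pol_sprod)
      have "sym_pi N ?k (((c * power_coeff ?k) * sym_eval P \<psi>) *\<^sub>C sprod vs) \<le>
          cmod c * power_coeff ?k * cmod (sym_eval P \<psi>) * sym_pi N ?k (sprod vs)"
        using sym_pi_scale[OF w, of "(c * power_coeff ?k) * sym_eval P \<psi>"] power_coeff_nonneg[of ?k]
        by (simp add: norm_mult)
      also have "\<dots> \<le> cmod c * power_coeff ?k * cmod (sym_eval P \<psi>) * 1"
        by (intro mult_left_mono unit) (simp add: power_coeff_nonneg)
      also have "\<dots> \<le> cmod c * power_coeff ?k * sym_ev N ?k P"
        using sym_eval_le_sym_ev[OF P g(3)] by (simp add: mult_left_mono power_coeff_nonneg)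
      finally have "sym_pi N ?k (L' P) \<le>
          cmod c * power_coeff ?k * sym_ev N ?k P + r * power_coeff ?k * sym_ev N ?k P"
        unfolding L'_def using sym_pi_add[OF mem L(3)[OF P]] L(4)[OF P] by linarith
      also have "\<dots> = (cmod c + r) * (power_coeff ?k * sym_ev N ?k P)" by (simp add: algebra_simps)
      also have "\<dots> \<le> s * (power_coeff ?k * sym_ev N ?k P)"
        by (intro mult_right_mono step mult_nonneg_nonneg power_coeff_nonneg sym_ev_nonneg[OF P])
      finally show "sym_pi N ?k (L' P) \<le> s * power_coeff ?k * sym_ev N ?k P" by (simp only: mult.assoc)
    qed
    moreover have "clinear L'" unfolding L'_def by (rule lin)
    ultimately show ?thesis by blast
  next
    case False
    have "contract ?k v (const c * g + f) = contract ?k v f" for v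
      unfolding cvec.linear_add[OF linear_contract] const_mult cvec.linear_scale[OF linear_contract] cg
      using False by auto
    moreover have "sym_pi N ?k (L P) \<le> s * power_coeff ?k * sym_ev N ?k P" if P: "P \<in> sym_power ?k" for P
    proof -
      have "r \<le> s" using step.hyps(3) norm_ge_zero[of c] by linarith
      then have "r * (power_coeff ?k * sym_ev N ?k P) \<le> s * (power_coeff ?k * sym_ev N ?k P)"
        by (intro mult_right_mono mult_nonneg_nonneg power_coeff_nonneg sym_ev_nonneg[OF P])
      with L(4)[OF P] show ?thesis by (simp add: mult.assoc)
    qed
    ultimately show ?thesis using L by (intro exI[of _ L]) simp
  qed
qed

text \<open>For a power of the pairing element the operator L fixes all pure powers; these span, so
  L is the identity on the graded piece.\<close>

lemma sym_pi_le_combination: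
  assumes "bipoly.combination generators kernel (pairing ^ Suc k) r" "P \<in> sym_power (Suc k)"
  shows "sym_pi N (Suc k) P \<le> r * power_coeff (Suc k) * sym_ev N (Suc k) P"
proof -
  obtain L where L: "clinear L" "\<And>v. L (sprod (replicate (Suc k) v)) = contract (Suc k) v (pairing ^ Suc k)"
    "\<And>P. P \<in> sym_power (Suc k) \<Longrightarrow> sym_pi N (Suc k) (L P) \<le> r * power_coeff (Suc k) * sym_ev N (Suc k) P"
    using combination_operator[OF assms(1), of k] by metis
  have "L P = P"
    by (rule cvec.linear_eq_on[OF L(1) cvec.linear_id[unfolded id_def]
          assms(2)[unfolded span_pure_powers]])
      (auto simp: L(2) contract_pairing_power simp del: replicate_Suc power_Suc)
  with L(3)[OF assms(2)] show ?thesis by simp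
qed

theorem sym_pi_le_sym_ev:
  assumes "0 < \<epsilon>"
  shows "\<exists>k0. \<forall>k\<ge>k0. \<forall>P\<in>sym_power (Suc k). sym_pi N (Suc k) P \<le> exp (\<epsilon> * real (Suc k)) * sym_ev N (Suc k) P"
proof -
  \<comment> \<open>Half of \<epsilon> is spent on exceeding the rate 1/e, the other half on
    absorbing C.\<close>
  obtain C where C: "\<And>m. bipoly.combination generators kernel (pairing ^ m) (C * exp (- 1 + \<epsilon> / 2) ^ m)"
    using pairing_power_bound[of "exp (- 1 + \<epsilon> / 2)"] assms by auto
  \<comment> \<open>C may be small or 0, hence the maximum with 1 under the logarithm.\<close>
  obtain k0 where k0: "ln (max C 1) / (\<epsilon> / 2) \<le> real k0" using real_arch_simple by blast
  have "sym_pi N (Suc k) P \<le> exp (\<epsilon> * real (Suc k)) * sym_ev N (Suc k) P"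
    if k: "k0 \<le> k" and P: "P \<in> sym_power (Suc k)" for k P
  proof -
    let ?k = "real (Suc k)"
    have "ln (max C 1) / (\<epsilon> / 2) \<le> ?k" using k0 k by simp
    then have "ln (max C 1) \<le> \<epsilon> / 2 * ?k" using assms by (simp add: field_simps)
    then have "exp (ln (max C 1)) \<le> exp (\<epsilon> / 2 * ?k)" by (subst exp_le_cancel_iff)
    then have CE: "C \<le> exp (\<epsilon> / 2 * ?k)" by simp
    have pow: "exp (- 1 + \<epsilon> / 2) ^ Suc k = exp (- ?k + \<epsilon> / 2 * ?k)"
      unfolding exp_of_nat_mult[symmetric] by (simp add: algebra_simps)
    have C0: "0 \<le> C * exp (- 1 + \<epsilon> / 2) ^ Suc k" by (rule bipoly.combination_nonneg[OF C])
    have "C * exp (- 1 + \<epsilon> / 2) ^ Suc k * power_coeff (Suc k) \<le>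
        C * exp (- 1 + \<epsilon> / 2) ^ Suc k * exp ?k"
      by (rule mult_left_mono[OF power_coeff_le C0])
    also have "\<dots> = C * exp (\<epsilon> / 2 * ?k)" unfolding pow mult.assoc exp_add[symmetric] by simp
    also have "\<dots> \<le> exp (\<epsilon> / 2 * ?k) * exp (\<epsilon> / 2 * ?k)" by (rule mult_right_mono[OF CE]) simp
    also have "\<dots> = exp (\<epsilon> * ?k)" unfolding exp_add[symmetric] by (simp add: algebra_simps)
    finally have "C * exp (- 1 + \<epsilon> / 2) ^ Suc k * power_coeff (Suc k) * sym_ev N (Suc k) P \<le>
        exp (\<epsilon> * ?k) * sym_ev N (Suc k) P"
      by (rule mult_right_mono[OF _ sym_ev_nonneg[OF P]])
    with sym_pi_le_combination[OF C P] show ?thesis by linarith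
  qed
  then show ?thesis by blast
qed

text \<open>The order M' \<le> M settles one inequality for every \<epsilon>, so only the
  subexponential bound of M by M' has to be supplied.\<close>

lemma equivalent_graded_norms_sandwich:
  assumes "\<And>\<epsilon>. 0 < \<epsilon> \<Longrightarrow> \<exists>k0. \<forall>k\<ge>k0. \<forall>P\<in>sym_power (Suc k).
      M (Suc k) P \<le> exp (\<epsilon> * real (Suc k)) * M' (Suc k) P"
    and "\<And>k P. P \<in> sym_power (Suc k) \<Longrightarrow> 0 \<le> M' (Suc k) P"
    and "\<And>k P. P \<in> sym_power (Suc k) \<Longrightarrow> M' (Suc k) P \<le> M (Suc k) P"
  shows "equivalent_graded_norms M M'"
  unfolding equivalent_graded_norms_def
proof (intro allI impI)
  fix \<epsilon> :: real assume \<epsilon>: "0 < \<epsilon>"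
  obtain k0 where k0: "\<And>k P. k0 \<le> k \<Longrightarrow> P \<in> sym_power (Suc k) \<Longrightarrow>
      M (Suc k) P \<le> exp (\<epsilon> * real (Suc k)) * M' (Suc k) P"
    using assms(1)[OF \<epsilon>] by blast
  have "exp (- \<epsilon> * real k) * M k P \<le> M' k P \<and> M' k P \<le> exp (\<epsilon> * real k) * M k P"
    \<comment> \<open>The shift by one keeps k positive, where the hypotheses compare the
      norms.\<close>
    if k: "Suc k0 \<le> k" and P: "P \<in> sym_power k" for k P
  proof -
    obtain j where j: "k = Suc j" "k0 \<le> j" using k by (cases k) auto
    have "M k P \<le> exp (\<epsilon> * real k) * M' k P" using k0[OF j(2)] P j(1) by blast
    then have "exp (- \<epsilon> * real k) * M k P \<le> exp (- \<epsilon> * real k) * (exp (\<epsilon> * real k) * M' k P)"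
      by (rule mult_left_mono) simp
    also have "\<dots> = M' k P" unfolding mult.assoc[symmetric] exp_add[symmetric] by simp
    finally have "exp (- \<epsilon> * real k) * M k P \<le> M' k P" .
    moreover have "M' k P \<le> 1 * M k P" "0 \<le> M k P"
      using assms(2,3) P j(1) order_trans by (auto, blast)
    moreover have "1 * M k P \<le> exp (\<epsilon> * real k) * M k P"
      using \<epsilon> \<open>0 \<le> M k P\<close> by (intro mult_right_mono) auto
    ultimately show ?thesis by linarith
  qed
  then show "\<exists>k0. \<forall>k\<ge>k0. \<forall>P\<in>sym_power k.
      exp (- \<epsilon> * real k) * M k P \<le> M' k P \<and> M' k P \<le> exp (\<epsilon> * real k) * M k P" by blast
qed

lemma sym_pi_equivalent_sym_ev: "equivalent_graded_norms (sym_pi N) (sym_ev N)"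
  by (rule equivalent_graded_norms_sandwich, erule sym_pi_le_sym_ev, erule sym_ev_nonneg,
      rule order_trans[OF sym_ev_le_sym_eps sym_eps_le_sym_pi])

lemma sym_pi_equivalent_sym_eps: "equivalent_graded_norms (sym_pi N) (sym_eps N)"
proof (rule equivalent_graded_norms_sandwich)
  fix \<epsilon> :: real assume "0 < \<epsilon>"
  then obtain k0 where k0: "\<And>k P. k0 \<le> k \<Longrightarrow> P \<in> sym_power (Suc k) \<Longrightarrow>
      sym_pi N (Suc k) P \<le> exp (\<epsilon> * real (Suc k)) * sym_ev N (Suc k) P"
    using sym_pi_le_sym_ev by metis
  have "sym_pi N (Suc k) P \<le> exp (\<epsilon> * real (Suc k)) * sym_eps N (Suc k) P"
    if "k0 \<le> k" "P \<in> sym_power (Suc k)" for k P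
    by (rule order_trans[OF k0[OF that]]) (simp add: sym_ev_le_sym_eps[OF that(2)])
  then show "\<exists>k0. \<forall>k\<ge>k0. \<forall>P\<in>sym_power (Suc k).
      sym_pi N (Suc k) P \<le> exp (\<epsilon> * real (Suc k)) * sym_eps N (Suc k) P" by blast
qed (auto intro: sym_eps_le_sym_pi order_trans[OF sym_ev_nonneg sym_ev_le_sym_eps])

lemma sym_eps_equivalent_sym_ev: "equivalent_graded_norms (sym_eps N) (sym_ev N)"
proof (rule equivalent_graded_norms_sandwich)
  fix \<epsilon> :: real assume "0 < \<epsilon>"
  then obtain k0 where k0: "\<And>k P. k0 \<le> k \<Longrightarrow> P \<in> sym_power (Suc k) \<Longrightarrow>
      sym_pi N (Suc k) P \<le> exp (\<epsilon> * real (Suc k)) * sym_ev N (Suc k) P"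
    using sym_pi_le_sym_ev by metis
  have "sym_eps N (Suc k) P \<le> exp (\<epsilon> * real (Suc k)) * sym_ev N (Suc k) P"
    if "k0 \<le> k" "P \<in> sym_power (Suc k)" for k P
    by (rule order_trans[OF sym_eps_le_sym_pi[OF that(2)] k0[OF that]])
  then show "\<exists>k0. \<forall>k\<ge>k0. \<forall>P\<in>sym_power (Suc k).
      sym_eps N (Suc k) P \<le> exp (\<epsilon> * real (Suc k)) * sym_ev N (Suc k) P" by blast
qed (auto intro: sym_ev_nonneg sym_ev_le_sym_eps)

end

theorem theorem3p13:
  fixes N :: "'v::complex_vec \<Rightarrow> real" and B :: "'v set"
  assumes "finite_dimensional_vector_space (scaleC :: complex \<Rightarrow> 'v \<Rightarrow> 'v) B"
    and "is_norm N"
  shows "equivalent_graded_norms (sym_pi N) (sym_eps N) \<and>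
         equivalent_graded_norms (sym_eps N) (sym_ev N) \<and>
         equivalent_graded_norms (sym_pi N) (sym_ev N)"
proof -
  interpret fd_normed N B by (rule fd_normed.intro[OF assms])
  show ?thesis
    using sym_pi_equivalent_sym_eps sym_eps_equivalent_sym_ev sym_pi_equivalent_sym_ev by blast
qed

end
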